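(* Let $d\ge 0$ and $m,n_1,n_2\ge 1$ be integers, and let $k$ be an integer with $$\frac{1}{2}\left(-3+\sqrt{1+4n_2m(m+1)}\right)\ \le\ k\ \le\ \frac{1}{2}\left(-1+\sqrt{1+4n_2m(m+1)}\right).$$ If the four linear systems $\mathcal{L}_d((k+1)^{n_1})$, $\mathcal{L}_d(k^{n_1})$, $\mathcal{L}_{k-1}(m^{n_2})$ and $\mathcal{L}_k(m^{n_2})$ are non-special, then the linear system $\mathcal{L}_d(m^{n_1n_2})$ is non-special.
   Context: Work over $\mathbb{C}$. For points $q_1,\dots,q_n$ of the projective plane $\mathbb{P}^2$, consider the linear system of plane curves of degree $d$ having multiplicity at least $m$ at each $q_i$. It is the projectivization of the vector space of homogeneous polynomials of degree $d$ in three variables (including $0$) that vanish to order at least $m$ at each $q_i$, i.e. whose Taylor expansion at each $q_i$ in local affine coordinates has no terms of degree less than $m$ (no condition if $m=0$; for $d=-1$ the vector space is $0$). Its dimension is the dimension of this vector space minus $1$, so the dimension is $-1$ exactly when the system is empty. The notation $\mathcal{L}_d(m^n)$ denotes this system for $n$ points $q_1,\dots,q_n$ in general position. Its dimension $l$ is the minimum value over all $n$-tuples of distinct points, which is attained on a nonempty Zariski open set of $n$-tuples. The virtual dimension is $v(d,m,n)=\frac{d(d+3)}{2}-n\,\frac{m(m+1)}{2}$, and the expected dimension is $e(d,m,n)=\max\{-1,\,v(d,m,n)\}$. One always has $l\ge e$. The system $\mathcal{L}_d(m^n)$ is called non-special if $l=e(d,m,n)$, and special otherwise. *)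

theory Defs
  imports "HOL-Analysis.Analysis" "HOL-Library.Poly_Mapping"
begin

section \<open>Polynomials in three variables over the complex numbers\<close>

text \<open>Variables are indexed by the three-element type \<open>3\<close>; a monomial is its exponent
  vector, and multiplication of polynomials is the convolution product on finitely supported
  functions.\<close>

type_synonym monom3 = "3 \<Rightarrow>\<^sub>0 nat"
type_synonym poly3 = "monom3 \<Rightarrow>\<^sub>0 complex"

definition const3 :: "complex \<Rightarrow> poly3" where
  "const3 c = Poly_Mapping.single 0 c"

definition var3 :: "3 \<Rightarrow> poly3" where
  "var3 j = Poly_Mapping.single (Poly_Mapping.single j 1) 1"

definition mdeg :: "monom3 \<Rightarrow> nat" where
  "mdeg a = (\<Sum>j\<in>UNIV. Poly_Mapping.lookup a j)"

definition subst3 :: "(3 \<Rightarrow> poly3) \<Rightarrow> poly3 \<Rightarrow> poly3" where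
  "subst3 \<sigma> f =
     (\<Sum>a\<in>Poly_Mapping.keys f.
        const3 (Poly_Mapping.lookup f a) * (\<Prod>j\<in>UNIV. \<sigma> j ^ Poly_Mapping.lookup a j))"

definition scale3 :: "complex \<Rightarrow> poly3 \<Rightarrow> poly3" where
  "scale3 c f = const3 c * f"

global_interpretation poly3: vector_space scale3
  by standard
    (simp_all add: scale3_def const3_def algebra_simps single_add mult_single flip: mult.assoc single_one)

text \<open>The degree is an integer so that degree \<open>-1\<close> is allowed; for negative \<open>d\<close> only the zero
  polynomial qualifies.\<close>

definition homogeneous :: "int \<Rightarrow> poly3 \<Rightarrow> bool" where
  "homogeneous d f \<longleftrightarrow> (\<forall>a\<in>Poly_Mapping.keys f. int (mdeg a) = d)"


section \<open>The projective plane\<close>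

definition proportional :: "complex ^ 3 \<Rightarrow> complex ^ 3 \<Rightarrow> bool" where
  "proportional u v \<longleftrightarrow> u \<noteq> 0 \<and> v \<noteq> 0 \<and> (\<exists>c. c \<noteq> 0 \<and> v = c *s u)"

lemma part_equivp_proportional: "part_equivp proportional"
proof (rule part_equivpI)
  show "\<exists>x. proportional x x"
    by (rule exI[of _ "axis 1 1"], auto simp: proportional_def axis_eq_0_iff intro!: exI[of _ 1])
  show "symp proportional"
  proof (rule sympI)
    fix u v assume "proportional u v"
    then obtain c where c: "u \<noteq> 0" "v \<noteq> 0" "c \<noteq> 0" "v = c *s u"
      by (auto simp: proportional_def)
    then have "u = inverse c *s v" by (simp add: vector_smult_assoc)
    with c show "proportional v u"
      unfolding proportional_def by (metis inverse_nonzero_iff_nonzero)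
  qed
  show "transp proportional"
  proof (rule transpI)
    fix u v w assume "proportional u v" "proportional v w"
    then obtain b c where "u \<noteq> 0" "w \<noteq> 0" "c \<noteq> 0" "b \<noteq> 0" "w = b *s (c *s u)"
      by (auto simp: proportional_def)
    then show "proportional u w"
      unfolding proportional_def by (metis vector_smult_assoc mult_eq_0_iff)
  qed
qed

quotient_type proj_plane = "complex ^ 3" / partial: proportional
  by (rule part_equivp_proportional)


section \<open>Multiplicity at a point\<close>

text \<open>Taylor expansion of \<open>f\<close> at the point with homogeneous coordinates \<open>v\<close>, in the affine chart
  where coordinate \<open>i\<close> (with \<open>v $ i \<noteq> 0\<close>) equals 1: coordinate \<open>i\<close> is replaced by the
  constant \<open>v $ i / v $ i = 1\<close>, and coordinate \<open>j \<noteq> i\<close> by \<open>v $ j / v $ i\<close> plus the local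
  coordinate \<open>var3 j\<close>. The variable \<open>var3 i\<close> does not occur in the result.\<close>

definition local_expansion :: "3 \<Rightarrow> complex ^ 3 \<Rightarrow> poly3 \<Rightarrow> poly3" where
  "local_expansion i v f =
     subst3 (\<lambda>j. const3 (v $ j / v $ i) + (if j = i then 0 else var3 j)) f"

text \<open>All affine charts containing the point are quantified over; for homogeneous \<open>f\<close> the
  condition does not depend on the chart.\<close>

lift_definition vanishes_to_order :: "int \<Rightarrow> proj_plane \<Rightarrow> poly3 \<Rightarrow> bool" is
  "\<lambda>m v f. \<forall>i. v $ i \<noteq> 0 \<longrightarrow>
     (\<forall>a\<in>Poly_Mapping.keys (local_expansion i v f). m \<le> int (mdeg a))"
  by (auto simp: proportional_def local_expansion_def)


section \<open>Linear systems of plane curves\<close>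

definition forms_through :: "int \<Rightarrow> int \<Rightarrow> proj_plane set \<Rightarrow> poly3 set" where
  "forms_through d m Q = {f. homogeneous d f \<and> (\<forall>q\<in>Q. vanishes_to_order m q f)}"

text \<open>The dimension of the system for \<open>n\<close> points in general position: the minimum over all
  \<open>n\<close>-tuples of distinct points.\<close>

definition system_dim :: "int \<Rightarrow> int \<Rightarrow> nat \<Rightarrow> int" where
  "system_dim d m n =
     int (LEAST r. \<exists>q :: nat \<Rightarrow> proj_plane. inj_on q {..<n} \<and>
                     r = poly3.dim (forms_through d m (q ` {..<n}))) - 1"

text \<open>Both divisions are exact.\<close>

definition virtual_dim :: "int \<Rightarrow> int \<Rightarrow> nat \<Rightarrow> int" where
  "virtual_dim d m n = d * (d + 3) div 2 - int n * (m * (m + 1) div 2)"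

definition expected_dim :: "int \<Rightarrow> int \<Rightarrow> nat \<Rightarrow> int" where
  "expected_dim d m n = max (-1) (virtual_dim d m n)"

definition non_special :: "int \<Rightarrow> int \<Rightarrow> nat \<Rightarrow> bool" where
  "non_special d m n \<longleftrightarrow> system_dim d m n = expected_dim d m n"

end

theory Submission
  imports Defs "Jordan_Normal_Form.Determinant"
begin

text \<open>Count conditions, write \<open>tri m = m (m + 1) / 2\<close>, and put \<open>N = n2 tri m\<close>. The bounds on \<open>k\<close> say
  that \<open>tri k \<le> N \<le> tri (k + 1)\<close>, so \<open>N = tri k + c\<close> with \<open>0 \<le> c \<le> k + 1\<close>. The \<open>n1 n2\<close> points are
  arranged in \<open>n1\<close> clusters of \<open>n2\<close> points, and each cluster is shrunk to its centre. Dimensions of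
  kernels only go up in a limit, so it is enough that the limit conditions cut out a space of the
  expected dimension.

  \<^bold>\<open>The limit of one cluster.\<close> Since no curve of degree \<open>k - 1\<close> has multiplicity \<open>m\<close> at \<open>n2\<close> general
  points, while those points impose independent conditions in degree \<open>k\<close>, a cluster tends to the
  conditions of a point of multiplicity \<open>k\<close> together with \<open>c\<close> linear conditions on the form of degree
  \<open>k\<close> that starts the Taylor expansion there. In suitable linear coordinates \<open>\<xi>, \<eta>\<close> at the centre, and
  if \<open>\<eta>\<close> shrinks slightly faster than \<open>\<xi>\<close>, the limit even becomes monomial: the Taylor coefficients with
  exponents \<open>(p, q)\<close>, \<open>p + q < k\<close>, or \<open>p + q = k\<close> and \<open>q < c\<close>, have to vanish
  (\<open>cluster_exponents\<close>). The last \<open>c\<close> conditions say that the leading form, read as a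
  polynomial in one variable, vanishes to order \<open>c\<close> at a point \<open>b\<close>, which may be chosen freely for each
  cluster. That such coordinates exist is \<open>exists_template\<close>, and \<open>collision\<close> is the limit argument: the
  exponents in question are an initial segment for the weights of the scaling.

  \<^bold>\<open>Osculation.\<close> Both this step and the next one rest on characteristic 0 through the Wronskian: an
  \<open>r\<close>-dimensional space of univariate polynomials has only finitely many inflection points, that is, points at
  which a nonzero member vanishes to order \<open>r\<close> (\<open>generic_point_not_inflection\<close>). In the form
  \<open>generic_osculation_dim\<close>: vanishing to order \<open>c\<close> at a generic \<open>b\<close> imposes \<open>c\<close> conditions, or else
  forces the polynomial to be zero.

  \<^bold>\<open>Several clusters.\<close> Let \<open>X\<close> be the space of forms of degree \<open>d\<close> satisfying the limit conditions at
  \<open>n1\<close> generic centres \<open>z i\<close> and directions \<open>b i\<close>. If the points of multiplicity \<open>k + 1\<close> impose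
  independent conditions, or those of multiplicity \<open>k\<close> leave no curves, there is nothing to do.
  Otherwise multiplicity \<open>k\<close> imposes independent conditions and multiplicity \<open>k + 1\<close> leaves no curves.
  By symmetry of the generic configuration, either the leading forms of all members of \<open>X\<close> vanish at
  every centre, so that \<open>X = 0\<close>, or at every centre some member of \<open>X\<close> has a nonzero leading form. In
  the second case osculation shows that each group of \<open>c\<close> conditions is independent of all the
  other ones, and \<open>X\<close> has the expected dimension (\<open>cluster_system_expected_dim\<close>).

  General position is expressed by properties of configurations that hold somewhere, and then
  everywhere but finitely often on each line through a point where they hold (\<open>generic\<close>). Together with
  semicontinuity this reduces non-speciality to the existence of one configuration in the
  affine plane with small enough kernel (\<open>non_special_iff_affine_system\<close>).\<close>

hide_const (open) Module.smult
no_notation vec_index (infixl "$" 100)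

section \<open>Dimension counts for kernels of linear functionals\<close>

text \<open>A copy of the locale of vector spaces, so that the constants below are not at the same time
  introduced for real vector spaces. The ambient spaces are infinite-dimensional; only some of their subspaces
  are finite-dimensional.\<close>

locale linear_space = vector_space scale
  for scale :: "'a::field \<Rightarrow> 'b::ab_group_add \<Rightarrow> 'b" (infixr "\<star>" 75)
begin

definition fin_dim :: "'b set \<Rightarrow> bool" where
  "fin_dim V \<longleftrightarrow> (\<exists>B. finite B \<and> V \<subseteq> span B)"

lemma fin_dim_subset: "fin_dim V \<Longrightarrow> U \<subseteq> V \<Longrightarrow> fin_dim U"
  unfolding fin_dim_def by blast

lemma fin_dim_independent:
  assumes "fin_dim V" "independent S" "S \<subseteq> V"
  shows "finite S"
  using assms independent_span_bound[of _ S] unfolding fin_dim_def by blast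

lemma fin_dim_basis:
  assumes "fin_dim V" "independent S" "S \<subseteq> V"
  obtains B where "S \<subseteq> B" "B \<subseteq> V" "independent B" "finite B" "V \<subseteq> span B" "card B = dim V"
proof -
  obtain B where B: "S \<subseteq> B" "B \<subseteq> V" "independent B" "V \<subseteq> span B"
    using maximal_independent_subset_extend[OF assms(3,2)] by blast
  have "finite B" using fin_dim_independent[OF assms(1) B(3,2)] .
  moreover have "card B = dim V" using basis_card_eq_dim B by blast
  ultimately show thesis using that B by blast
qed

lemma independent_le_dim:
  assumes "fin_dim V" "independent S" "S \<subseteq> V"
  shows "card S \<le> dim V"
proof -
  obtain B where "S \<subseteq> B" "finite B" "card B = dim V"
    by (rule fin_dim_basis[OF assms])
  thus ?thesis by (metis card_mono)
qed

lemma dim_mono_fin: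
  assumes "fin_dim V" "U \<subseteq> V"
  shows "dim U \<le> dim V"
proof -
  obtain B where "B \<subseteq> U" "independent B" "card B = dim U"
    by (rule basis_exists[of U])
  thus ?thesis using independent_le_dim[OF assms(1)] assms(2) by force
qed

lemma subspace_eq_if_dim_ge:
  assumes "fin_dim V" "subspace U" "U \<subseteq> V" "dim V \<le> dim U"
  shows "U = V"
proof -
  obtain B where B: "B \<subseteq> U" "independent B" "U \<subseteq> span B" "card B = dim U"
    by (rule basis_exists[of U])
  have BV: "B \<subseteq> V" using B assms(3) by blast
  obtain C where C: "B \<subseteq> C" "finite C" "V \<subseteq> span C" "card C = dim V"
    by (rule fin_dim_basis[OF assms(1) B(2) BV])
  have "card C \<le> card B" using C(4) B(4) assms(4) by simp
  hence "C = B" using C(1,2) by (metis card_subset_eq card_mono le_antisym)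
  moreover have "span B \<subseteq> U" using B(1) assms(2) by (simp add: span_minimal)
  ultimately show ?thesis using C(3) assms(3) by blast
qed

text \<open>A basis of the intersection is extended to bases of \<open>A\<close> and of \<open>B\<close>; the union of these two bases is
  independent.\<close>

lemma dim_Int_modular:
  assumes "fin_dim V" "subspace V" "subspace A" "subspace B" "A \<subseteq> V" "B \<subseteq> V"
  shows "dim A + dim B \<le> dim V + dim (A \<inter> B)"
proof -
  have fA: "fin_dim A" and fB: "fin_dim B" and fI: "fin_dim (A \<inter> B)"
    using assms(5,6) by (auto intro: fin_dim_subset[OF assms(1)])
  obtain C where C: "C \<subseteq> A \<inter> B" "independent C" "A \<inter> B \<subseteq> span C" "card C = dim (A \<inter> B)"
    by (rule basis_exists[of "A \<inter> B"])
  obtain P where P: "C \<subseteq> P" "P \<subseteq> A" "independent P" "finite P" "card P = dim A"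
    by (rule fin_dim_basis[OF fA C(2)]) (use C(1) in auto)
  obtain Q where Q: "C \<subseteq> Q" "Q \<subseteq> B" "independent Q" "finite Q" "card Q = dim B"
    by (rule fin_dim_basis[OF fB C(2)]) (use C(1) in auto)
  have spC: "x \<in> span C" if "x \<in> span P" "x \<in> span Q" for x
    using that C(3) span_minimal[OF P(2) assms(3)] span_minimal[OF Q(2) assms(4)] by blast
  have PQ: "P \<inter> Q = C"
  proof
    show "C \<subseteq> P \<inter> Q" using P Q by blast
    show "P \<inter> Q \<subseteq> C"
    proof
      fix x assume x: "x \<in> P \<inter> Q"
      have sC: "x \<in> span C" using spC[of x] x span_base by blast
      show "x \<in> C"
      proof (rule ccontr)
        assume "x \<notin> C"
        hence "C \<subseteq> P - {x}" using P by blast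
        hence "x \<in> span (P - {x})" using sC span_mono by blast
        thus False using P(3) x unfolding dependent_def by blast
      qed
    qed
  qed
  have ind: "independent (P \<union> Q)"
    unfolding independent_explicit_finite_subsets
  proof (intro allI impI ballI)
    fix S u v
    assume S: "S \<subseteq> P \<union> Q" "finite S" "(\<Sum>v\<in>S. u v \<star> v) = 0" "v \<in> S"
    define w where "w v = (if v \<in> S then u v else 0)" for v
    have fin: "finite (P \<union> Q)" using P Q by simp
    have "(\<Sum>v\<in>P \<union> Q. w v \<star> v) = (\<Sum>v\<in>S. w v \<star> v)"
      by (rule sum.mono_neutral_right) (use S fin in \<open>auto simp: w_def\<close>)
    also have "\<dots> = 0" using S(3) by (simp add: w_def)
    finally have z: "(\<Sum>v\<in>P \<union> Q. w v \<star> v) = 0" .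
    have "P \<union> Q = P \<union> (Q - C)" using PQ by blast
    moreover have "P \<inter> (Q - C) = {}" using PQ by blast
    ultimately have "(\<Sum>v\<in>P. w v \<star> v) + (\<Sum>v\<in>Q - C. w v \<star> v) = 0"
      using z sum.union_disjoint[OF P(4) finite_Diff[OF Q(4)], of C "\<lambda>v. w v \<star> v"] by simp
    hence eq: "(\<Sum>v\<in>Q - C. w v \<star> v) = - (\<Sum>v\<in>P. w v \<star> v)"
      by (simp add: eq_neg_iff_add_eq_0 add.commute)
    have "(\<Sum>v\<in>Q - C. w v \<star> v) \<in> span P"
      unfolding eq by (intro span_neg span_sum span_scale span_base)
    moreover have "(\<Sum>v\<in>Q - C. w v \<star> v) \<in> span Q"
      by (intro span_sum span_scale span_base) auto
    ultimately have "(\<Sum>v\<in>Q - C. w v \<star> v) \<in> span C" using spC by blast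
    then obtain r where r: "(\<Sum>v\<in>Q - C. w v \<star> v) = (\<Sum>v\<in>C. r v \<star> v)"
      using span_finite[of C] finite_subset[OF Q(1) Q(4)] by auto
    define q where "q v = (if v \<in> C then - r v else w v)" for v
    have "(\<Sum>v\<in>Q. q v \<star> v) = (\<Sum>v\<in>C. q v \<star> v) + (\<Sum>v\<in>Q - C. q v \<star> v)"
      using sum.subset_diff[OF Q(1) Q(4), of "\<lambda>v. q v \<star> v"] by (simp add: add.commute)
    also have "\<dots> = - (\<Sum>v\<in>C. r v \<star> v) + (\<Sum>v\<in>Q - C. w v \<star> v)"
      by (simp add: q_def sum_negf)
    also have "\<dots> = 0" using r by simp
    finally have q0: "(\<Sum>v\<in>Q. q v \<star> v) = 0" .
    have qQ: "\<forall>v\<in>Q. q v = 0"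
      using independent_explicit_finite_subsets[THEN iffD1, rule_format, OF Q(3) subset_refl Q(4) q0] by blast
    hence wQ: "w v = 0" if "v \<in> Q - C" for v using that by (auto simp: q_def)
    hence "(\<Sum>v\<in>P. w v \<star> v) = 0" using eq by simp
    hence "\<forall>v\<in>P. w v = 0"
      using independent_explicit_finite_subsets[THEN iffD1, rule_format, OF P(3) subset_refl P(4)] by blast
    hence "w v = 0" using wQ S(1,4) PQ by blast
    thus "u v = 0" using S(4) by (simp add: w_def)
  qed
  have "card (P \<union> Q) \<le> dim V"
    by (rule independent_le_dim[OF assms(1) ind]) (use P Q assms in blast)
  moreover have "card P + card Q = card (P \<union> Q) + card C"
    using card_Un_Int[OF P(4) Q(4)] PQ by simp
  ultimately show ?thesis using P(5) Q(5) C(4) by simp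
qed

definition functional :: "('b \<Rightarrow> 'a) \<Rightarrow> bool" where
  "functional l \<longleftrightarrow> (\<forall>x y. l (x + y) = l x + l y) \<and> (\<forall>c x. l (c \<star> x) = c * l x)"

lemma functional_zero: "functional l \<Longrightarrow> l 0 = 0"
  unfolding functional_def by (metis mult_zero_left scale_zero_left)

lemma functional_sum: "functional l \<Longrightarrow> l (sum f S) = (\<Sum>i\<in>S. l (f i))"
  by (induction S rule: infinite_finite_induct) (auto simp: functional_zero functional_def)

lemma functional_diff: "functional l \<Longrightarrow> l (x - y) = l x - l y"
  unfolding functional_def by (metis add_diff_cancel diff_add_cancel)

lemma functional_scale: "functional l \<Longrightarrow> l (c \<star> x) = c * l x"
  unfolding functional_def by blast

definition common_kernel :: "'b set \<Rightarrow> 'x set \<Rightarrow> ('x \<Rightarrow> 'b \<Rightarrow> 'a) \<Rightarrow> 'b set" where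
  "common_kernel V A l = {f\<in>V. \<forall>a\<in>A. l a f = 0}"

lemma subspace_common_kernel:
  assumes "subspace V" "\<And>a. a \<in> A \<Longrightarrow> functional (l a)"
  shows "subspace (common_kernel V A l)"
  using assms functional_zero
  by (auto simp: subspace_def common_kernel_def functional_def)

lemma dim_kernel_functional:
  assumes "fin_dim V" "subspace V" "functional l" "f \<in> V" "l f \<noteq> 0"
  shows "dim {g\<in>V. l g = 0} + 1 = dim V"
proof -
  let ?K = "{g\<in>V. l g = 0}"
  have sK: "subspace ?K" using assms(2,3) functional_zero[OF assms(3)]
    by (auto simp: subspace_def functional_def)
  have fK: "fin_dim ?K" using fin_dim_subset[OF assms(1)] by auto
  obtain B where B: "B \<subseteq> ?K" "independent B" "?K \<subseteq> span B" "card B = dim ?K"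
    by (rule basis_exists[of ?K])
  have finB: "finite B" using fin_dim_independent[OF fK B(2,1)] .
  have spB: "span B \<subseteq> ?K" using B(1) sK by (rule span_minimal)
  hence fB: "f \<notin> span B" using assms(5) by blast
  have "independent (insert f B)" using independent_insertI[OF fB B(2)] .
  moreover have "insert f B \<subseteq> V" using B(1) assms(4) by blast
  moreover have "V \<subseteq> span (insert f B)"
  proof
    fix g assume g: "g \<in> V"
    have "g - (l g / l f) \<star> f \<in> ?K"
      using g assms by (auto simp: functional_diff functional_scale subspace_diff subspace_scale)
    hence "g - (l g / l f) \<star> f \<in> span B" using B(3) by blast
    thus "g \<in> span (insert f B)" by (simp only: span_insert) blast
  qed
  ultimately have "card (insert f B) = dim V" using basis_card_eq_dim by blast
  moreover have "f \<notin> B" using fB span_base by blast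
  ultimately show ?thesis using finB B(4) by simp
qed

lemma dim_kernel_functional_ge:
  assumes "fin_dim V" "subspace V" "functional l"
  shows "dim V \<le> dim {g\<in>V. l g = 0} + 1"
proof (cases "\<exists>f\<in>V. l f \<noteq> 0")
  case True
  then show ?thesis using dim_kernel_functional[OF assms] by fastforce
next
  case False
  hence "{g\<in>V. l g = 0} = V" by blast
  thus ?thesis by simp
qed

lemma dim_common_kernel_ge:
  assumes "finite A" "fin_dim V" "subspace V" "\<And>a. a \<in> A \<Longrightarrow> functional (l a)"
  shows "dim V \<le> dim (common_kernel V A l) + card A"
  using assms
proof (induction A)
  case empty
  then show ?case by (simp add: common_kernel_def)
next
  case (insert a A)
  have eq: "common_kernel V (insert a A) l = {g\<in>common_kernel V A l. l a g = 0}"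
    by (auto simp: common_kernel_def)
  have "fin_dim (common_kernel V A l)"
    by (rule fin_dim_subset[OF insert.prems(1)]) (auto simp: common_kernel_def)
  from dim_kernel_functional_ge[OF this subspace_common_kernel, of "l a"]
  have "dim (common_kernel V A l) \<le> dim (common_kernel V (insert a A) l) + 1"
    unfolding eq using insert.prems by simp
  thus ?case using insert by simp
qed

text \<open>The rank of a family of functionals is attained by finitely many members, which come with a dual
  system of vectors. This is Gaussian elimination: choose a member that does not vanish on \<open>V\<close>, pass
  to its kernel in \<open>V\<close>, and repeat.\<close>

lemma dual_system:
  assumes "fin_dim V" "subspace V" "\<And>a. a \<in> A \<Longrightarrow> functional (l a)"
  obtains r b f where "r + dim (common_kernel V A l) = dim V"
    "\<And>i. i < r \<Longrightarrow> b i \<in> A" "\<And>i. i < r \<Longrightarrow> f i \<in> V"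
    "\<And>i j. i < r \<Longrightarrow> j < r \<Longrightarrow> l (b i) (f j) = (if i = j then 1 else 0)"
proof -
  have "\<exists>r b f. r + dim (common_kernel V A l) = dim V \<and>
     (\<forall>i<r. b i \<in> A \<and> f i \<in> V \<and> (\<forall>j<r. l (b i) (f j) = (if i = j then 1 else 0)))"
    using assms(1,2)
  proof (induction "dim V" arbitrary: V rule: less_induct)
    case less
    show ?case
    proof (cases "\<forall>a\<in>A. \<forall>f\<in>V. l a f = 0")
      case True
      hence "common_kernel V A l = V" by (auto simp: common_kernel_def)
      thus ?thesis by (intro exI[of _ 0]) simp
    next
      case False
      then obtain a g where a: "a \<in> A" and g: "g \<in> V" "l a g \<noteq> 0" by blast
      note fa = assms(3)[OF a]
      let ?W = "{h\<in>V. l a h = 0}"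
      have d: "dim ?W + 1 = dim V" using dim_kernel_functional[OF less.prems fa g] .
      have sW: "subspace ?W"
        using less.prems(2) fa functional_zero[OF fa] by (auto simp: subspace_def functional_def)
      obtain r b f where IH: "r + dim (common_kernel ?W A l) = dim ?W"
        "\<forall>i<r. b i \<in> A \<and> f i \<in> ?W \<and> (\<forall>j<r. l (b i) (f j) = (if i = j then 1 else 0))"
        using less.hyps[of ?W] d sW fin_dim_subset[OF less.prems(1), of ?W] by auto
      have "common_kernel ?W A l = common_kernel V A l"
        using a by (auto simp: common_kernel_def)
      define g1 where "g1 = (1 / l a g) \<star> g"
      have g1: "g1 \<in> V" "l a g1 = 1"
        using g less.prems(2) fa by (auto simp: g1_def subspace_scale functional_scale)
      define h where "h = g1 - (\<Sum>i<r. l (b i) g1 \<star> f i)"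
      have hV: "h \<in> V" unfolding h_def
        using g1 IH(2) less.prems(2) by (intro subspace_diff subspace_sum subspace_scale) auto
      have ha: "l a h = 1"
        using IH(2) g1 by (simp add: h_def functional_diff[OF fa] functional_sum[OF fa] functional_scale[OF fa])
      have hb: "l (b j) h = 0" if "j < r" for j
      proof -
        have fb: "functional (l (b j))" using IH(2) that assms(3) by blast
        have "(\<Sum>i<r. l (b i) g1 * l (b j) (f i)) = (\<Sum>i<r. if i = j then l (b i) g1 else 0)"
          using IH(2) that by (intro sum.cong) auto
        thus ?thesis using that
          by (simp add: h_def functional_diff[OF fb] functional_sum[OF fb] functional_scale[OF fb])
      qed
      show ?thesis
      proof (intro exI conjI)
        show "Suc r + dim (common_kernel V A l) = dim V"
          using IH(1) d \<open>common_kernel ?W A l = common_kernel V A l\<close> by simp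
        show "\<forall>i<Suc r. (b(r := a)) i \<in> A \<and> (f(r := h)) i \<in> V \<and>
          (\<forall>j<Suc r. l ((b(r := a)) i) ((f(r := h)) j) = (if i = j then 1 else 0))"
          using IH(2) hb ha hV a by (auto simp: less_Suc_eq)
      qed
    qed
  qed
  thus thesis using that by blast
qed

lemma dual_family_independent:
  assumes "\<And>i. i < r \<Longrightarrow> functional (l (b i))"
    "\<And>i j. i < r \<Longrightarrow> j < r \<Longrightarrow> l (b i) (g j) = (if i = j then 1 else 0)"
  shows "inj_on g {..<r}" "independent (g ` {..<r})" "dim (span (g ` {..<r})) = r"
proof -
  show inj: "inj_on g {..<r}"
    by (rule inj_onI) (metis assms(2) lessThan_iff zero_neq_one)
  show ind: "independent (g ` {..<r})"
  proof (rule independent_if_scalars_zero)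
    fix u x assume u: "(\<Sum>x\<in>g ` {..<r}. u x \<star> x) = 0" and x: "x \<in> g ` {..<r}"
    then obtain j where j: "j < r" "x = g j" by auto
    note fb = assms(1)[OF j(1)]
    have "0 = l (b j) (\<Sum>i<r. u (g i) \<star> g i)"
      using u by (simp add: sum.reindex[OF inj] functional_zero[OF fb])
    also have "\<dots> = (\<Sum>i<r. if i = j then u (g i) else 0)"
      unfolding functional_sum[OF fb] using assms(2) j by (intro sum.cong) (auto simp: functional_scale[OF fb])
    also have "\<dots> = u x" using j by simp
    finally show "u x = 0" by simp
  qed simp
  show "dim (span (g ` {..<r})) = r"
    using dim_span_eq_card_independent[OF ind] card_image[OF inj] by simp
qed

text \<open>The members of the dual system for a separating family form a basis of the dual space of \<open>V\<close>.\<close>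

lemma functional_in_span_of_separating:
  assumes "fin_dim V" "subspace V" "\<And>a. a \<in> A \<Longrightarrow> functional (l a)"
    "common_kernel V A l \<subseteq> {0}" "functional \<phi>"
  obtains r :: nat and b e where "\<And>i. i < r \<Longrightarrow> b i \<in> A"
    "\<And>f. f \<in> V \<Longrightarrow> \<phi> f = (\<Sum>i<r. e i * l (b i) f)"
proof -
  obtain r b g where D: "r + dim (common_kernel V A l) = dim V"
    "\<And>i. i < r \<Longrightarrow> b i \<in> A" "\<And>i. i < r \<Longrightarrow> g i \<in> V"
    "\<And>i j. i < r \<Longrightarrow> j < r \<Longrightarrow> l (b i) (g j) = (if i = j then 1 else 0)"
    by (rule dual_system[OF assms(1-3)]) (blast intro: that)+
  have fb: "functional (l (b i))" if "i < r" for i using that D(2) assms(3) by blast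
  note inj = dual_family_independent(1)[of r l b g, OF fb D(4)]
    and dimg = dual_family_independent(3)[of r l b g, OF fb D(4)]
  have "span (g ` {..<r}) = V"
  proof (rule subspace_eq_if_dim_ge[OF assms(1)])
    show "span (g ` {..<r}) \<subseteq> V" by (rule span_minimal) (use D(3) assms(2) in auto)
    have "dim (common_kernel V A l) = 0"
      using assms(4) dim_le_card[of "common_kernel V A l" "{}"] by simp
    thus "dim V \<le> dim (span (g ` {..<r}))"
      using D(1) dimg by simp
  qed simp
  have exp: "f = (\<Sum>i<r. l (b i) f \<star> g i)" if "f \<in> V" for f
  proof -
    have "f \<in> span (g ` {..<r})" using that \<open>span (g ` {..<r}) = V\<close> by simp
    hence "f \<in> range (\<lambda>u. \<Sum>v\<in>g ` {..<r}. u v \<star> v)" by (subst (asm) span_finite) simp_all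
    then obtain u where u: "f = (\<Sum>x\<in>g ` {..<r}. u x \<star> x)" by (rule rangeE)
    hence f: "f = (\<Sum>i<r. u (g i) \<star> g i)" by (simp add: sum.reindex[OF inj])
    have "l (b j) f = u (g j)" if j: "j < r" for j
    proof -
      note fb = fb[OF j]
      have "l (b j) f = (\<Sum>i<r. if i = j then u (g i) else 0)"
        unfolding f functional_sum[OF fb] using D(4) j by (intro sum.cong) (auto simp: functional_scale[OF fb])
      thus ?thesis using j by simp
    qed
    thus ?thesis using f by simp
  qed
  show thesis
  proof (rule that[of r b "\<lambda>i. \<phi> (g i)"])
    fix f assume "f \<in> V"
    from exp[OF this] show "\<phi> f = (\<Sum>i<r. \<phi> (g i) * l (b i) f)"
      using functional_sum[OF assms(5), of "\<lambda>i. l (b i) f \<star> g i" "{..<r}"]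
      by (simp add: functional_scale[OF assms(5)] mult.commute)
  qed (use D in auto)
qed

end

section \<open>Univariate polynomials: inflection points and singular matrices\<close>

lemma coeff_mult_top:
  fixes p q :: "'a::comm_semiring_0 poly"
  assumes "degree p \<le> m" "degree q \<le> n"
  shows "coeff (p * q) (m + n) = coeff p m * coeff q n"
proof -
  have "coeff (p * q) (m + n) = (\<Sum>i\<le>m + n. if i = m then coeff p m * coeff q n else 0)"
    unfolding coeff_mult
  proof (intro sum.cong refl)
    fix i assume "i \<in> {..m + n}"
    consider "i < m" | "i = m" | "i > m" by linarith
    thus "coeff p i * coeff q (m + n - i) = (if i = m then coeff p m * coeff q n else 0)"
    proof cases
      case 1
      hence "coeff q (m + n - i) = 0" using assms by (intro coeff_eq_0) linarith
      thus ?thesis using 1 by simp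
    next
      case 3
      hence "coeff p i = 0" using assms by (intro coeff_eq_0) linarith
      thus ?thesis using 3 by simp
    qed simp
  qed
  thus ?thesis by simp
qed

text \<open>The operator \<open>X d/dX\<close> multiplies the leading coefficient by the degree, so two polynomials with zero
  Wronskian have the same degree in characteristic 0. Applied to \<open>h\<close> and to \<open>f - c h\<close>, where \<open>c\<close> is chosen to
  remove the coefficient of degree \<open>degree h\<close>, this leaves only \<open>f - c h = 0\<close>.\<close>

lemma zero_wronskian_imp_proportional:
  fixes f h :: "complex poly"
  assumes "h \<noteq> 0" "pderiv f * h = f * pderiv h"
  obtains c where "f = smult c h"
proof -
  define c where "c = coeff f (degree h) / lead_coeff h"
  define g where "g = f - smult c h"
  define D where "D p = pCons 0 (pderiv p)" for p :: "complex poly"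
  have cD: "coeff (D p) i = of_nat i * coeff p i" for p i
    unfolding D_def by (cases i) (auto simp: coeff_pderiv)
  have dD: "degree (D p) \<le> degree p" for p
    by (rule degree_le) (auto simp: cD coeff_eq_0)
  have w: "D g * h = g * D h"
    using assms(2) unfolding D_def g_def
    by (simp add: algebra_simps pderiv_diff pderiv_smult)
  have "g = 0"
  proof (rule ccontr)
    assume g: "g \<noteq> 0"
    have "coeff (D g * h) (degree g + degree h) = of_nat (degree g) * lead_coeff g * lead_coeff h"
      using coeff_mult_top[OF dD[of g] order_refl, of h] by (simp add: cD)
    moreover have "coeff (g * D h) (degree g + degree h) = lead_coeff g * (of_nat (degree h) * lead_coeff h)"
      using coeff_mult_top[OF order_refl dD[of h], of g] by (simp add: cD)
    ultimately have "of_nat (degree g) = (of_nat (degree h) :: complex)"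
      using w g assms(1) by simp
    hence "degree g = degree h" by simp
    hence "lead_coeff g = 0" using assms(1) by (simp add: g_def c_def)
    thus False using g by simp
  qed
  thus thesis using that by (simp add: g_def)
qed

text \<open>Induction on the number of polynomials. Fix the first one, \<open>h\<close>. The map \<open>g \<mapsto> g' h - g h'\<close> kills the
  multiples of \<open>h\<close> and nothing else, so it produces a space spanned by one polynomial less; it lowers
  orders of vanishing by at most one. Away from the zeros of \<open>h\<close> and the exceptional points of the
  smaller space, a combination that vanishes to full order is a multiple of \<open>h\<close> that vanishes where
  \<open>h\<close> does not.\<close>

lemma generic_point_not_inflection:
  fixes hs :: "complex poly list"
  shows "finite {s. \<exists>x. [:-s, 1:] ^ length hs dvd (\<Sum>i<length hs. smult (x i) (hs ! i)) \<and>
                       (\<Sum>i<length hs. smult (x i) (hs ! i)) \<noteq> 0}"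
proof (induction "length hs" arbitrary: hs)
  case 0
  then show ?case by simp
next
  case (Suc n)
  then obtain h gs where hs: "hs = h # gs" and n: "length gs = n" by (cases hs) auto
  have sum: "(\<Sum>i<length hs. smult (x i) (hs ! i)) =
      smult (x 0) h + (\<Sum>i<n. smult (x (Suc i)) (gs ! i))" for x
    unfolding hs using n by (simp add: sum.lessThan_Suc_shift del: sum.lessThan_Suc)
  show ?case
  proof (cases "h = 0")
    case True
    have "{s. \<exists>x. [:-s, 1:] ^ length hs dvd (\<Sum>i<length hs. smult (x i) (hs ! i)) \<and>
                       (\<Sum>i<length hs. smult (x i) (hs ! i)) \<noteq> 0}
       \<subseteq> {s. \<exists>x. [:-s, 1:] ^ length gs dvd (\<Sum>i<length gs. smult (x i) (gs ! i)) \<and>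
                       (\<Sum>i<length gs. smult (x i) (gs ! i)) \<noteq> 0}" (is "_ \<subseteq> ?B")
    proof safe
      fix s x
      assume a: "[:-s, 1:] ^ length hs dvd (\<Sum>i<length hs. smult (x i) (hs ! i))"
        "(\<Sum>i<length hs. smult (x i) (hs ! i)) \<noteq> 0"
      have "[:-s, 1:] ^ n dvd [:-s, 1:] ^ length hs" using n hs by (intro le_imp_power_dvd) simp
      hence "[:-s, 1:] ^ n dvd (\<Sum>i<n. smult (x (Suc i)) (gs ! i))"
        using a(1) unfolding sum True by (simp add: dvd_trans)
      thus "\<exists>x. [:-s, 1:] ^ length gs dvd (\<Sum>i<length gs. smult (x i) (gs ! i)) \<and>
                       (\<Sum>i<length gs. smult (x i) (gs ! i)) \<noteq> 0"
        using a(2) unfolding sum True n by (intro exI[of _ "\<lambda>i. x (Suc i)"]) simp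
    qed
    moreover have "finite ?B" using Suc.hyps(1)[of gs] n by simp
    ultimately show ?thesis by (rule finite_subset)
  next
    case False
    define W where "W g = pderiv g * h - g * pderiv h" for g
    let ?B = "{s. \<exists>x. [:-s, 1:] ^ length (map W gs) dvd (\<Sum>i<length (map W gs). smult (x i) (map W gs ! i)) \<and>
                       (\<Sum>i<length (map W gs). smult (x i) (map W gs ! i)) \<noteq> 0}"
    have "finite (?B \<union> {s. poly h s = 0})"
      using Suc.hyps(1)[of "map W gs"] n poly_roots_finite[OF False] by simp
    moreover have "{s. \<exists>x. [:-s, 1:] ^ length hs dvd (\<Sum>i<length hs. smult (x i) (hs ! i)) \<and>
                       (\<Sum>i<length hs. smult (x i) (hs ! i)) \<noteq> 0} \<subseteq> ?B \<union> {s. poly h s = 0}"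
    proof safe
      fix s x
      assume a: "[:-s, 1:] ^ length hs dvd (\<Sum>i<length hs. smult (x i) (hs ! i))"
        "(\<Sum>i<length hs. smult (x i) (hs ! i)) \<noteq> 0"
        and hs0: "poly h s \<noteq> 0"
      define f where "f = (\<Sum>i<length hs. smult (x i) (hs ! i))"
      have Wadd: "W (p + q) = W p + W q" for p q by (simp add: W_def pderiv_add algebra_simps)
      have Wsm: "W (smult c p) = smult c (W p)" for c p
        by (simp add: W_def pderiv_smult smult_diff_right)
      have Wsum: "W (\<Sum>i<m. F i) = (\<Sum>i<m. W (F i))" for F and m :: nat
        by (induction m) (auto simp: Wadd, simp add: W_def)
      have "W h = 0" by (simp add: W_def)
      hence Wf: "W f = (\<Sum>i<length (map W gs). smult (x (Suc i)) (map W gs ! i))"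
        unfolding f_def sum Wadd Wsm Wsum using n by simp
      obtain g where g: "f = [:-s, 1:] ^ Suc n * g" using a(1) n hs by (auto simp: f_def)
      have "pderiv f = [:-s, 1:] ^ n * (smult (of_nat (Suc n)) g + [:-s, 1:] * pderiv g)"
        unfolding g pderiv_mult pderiv_power_Suc by (simp add: pderiv_pCons algebra_simps)
      moreover have "f = [:-s, 1:] ^ n * ([:-s, 1:] * g)" unfolding g by (simp add: algebra_simps)
      ultimately have "[:-s, 1:] ^ n dvd W f" unfolding W_def by (metis dvd_diff dvd_mult2 dvd_triv_left)
      have "W f \<noteq> 0"
      proof
        assume "W f = 0"
        then obtain c where c: "f = smult c h"
          using zero_wronskian_imp_proportional[OF False, of f] by (auto simp: W_def)
        have "poly f s = 0" unfolding g by simp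
        hence "c = 0" using c hs0 by simp
        thus False using c a(2) by (simp add: f_def)
      qed
      thus "\<exists>x. [:-s, 1:] ^ length (map W gs) dvd (\<Sum>i<length (map W gs). smult (x i) (map W gs ! i)) \<and>
                       (\<Sum>i<length (map W gs). smult (x i) (map W gs ! i)) \<noteq> 0"
        using Wf \<open>[:-s, 1:] ^ n dvd W f\<close> n by (intro exI[of _ "\<lambda>i. x (Suc i)"]) simp
    qed
    ultimately show ?thesis using finite_subset by blast
  qed
qed

lemma power_linear_dvd_iff_coeff:
  fixes p :: "complex poly"
  shows "[:-b, 1:] ^ c dvd p \<longleftrightarrow> (\<forall>q<c. coeff (p \<circ>\<^sub>p [:b, 1:]) q = 0)"
proof -
  have pcompose_power: "p ^ n \<circ>\<^sub>p q = (p \<circ>\<^sub>p q) ^ n" for p q :: "complex poly" and n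
    by (induction n) (auto simp: pcompose_mult pcompose_1)
  have 1: "[:-b, 1:] ^ c \<circ>\<^sub>p [:b, 1:] = monom 1 c"
    by (simp add: pcompose_power pcompose_pCons monom_altdef)
  have 2: "monom 1 c \<circ>\<^sub>p [:-b, 1:] = [:-b, 1:] ^ c"
    by (simp add: pcompose_power pcompose_pCons monom_altdef)
  have 3: "p \<circ>\<^sub>p [:b, 1:] \<circ>\<^sub>p [:-b, 1:] = p"
    by (simp add: pcompose_assoc[symmetric] pcompose_pCons)
  have "[:-b, 1:] ^ c dvd p \<longleftrightarrow> monom 1 c dvd p \<circ>\<^sub>p [:b, 1:]"
  proof
    assume "[:-b, 1:] ^ c dvd p"
    thus "monom 1 c dvd p \<circ>\<^sub>p [:b, 1:]" using 1 by (metis dvd_def pcompose_mult)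
  next
    assume "monom 1 c dvd p \<circ>\<^sub>p [:b, 1:]"
    thus "[:-b, 1:] ^ c dvd p" using 2 3 by (metis dvd_def pcompose_mult)
  qed
  thus ?thesis by (simp add: monom_1_dvd_iff')
qed

text \<open>The determinant is a polynomial in the parameter with value 1 at \<open>t0\<close>.\<close>

lemma finite_singular_values:
  fixes M :: "nat \<Rightarrow> nat \<Rightarrow> complex poly"
  assumes "\<And>i j. i < r \<Longrightarrow> j < r \<Longrightarrow> poly (M i j) t0 = (if i = j then 1 else 0)"
  shows "finite {t. \<exists>x. (\<exists>j<r. x j \<noteq> 0) \<and> (\<forall>i<r. (\<Sum>j<r. poly (M i j) t * x j) = 0)}"
proof -
  define A where "A = mat r r (\<lambda>(i, j). M i j)"
  interpret ev: comm_ring_hom "\<lambda>p. poly p t" for t :: complex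
    by unfold_locales auto
  have A: "A \<in> carrier_mat r r" by (simp add: A_def)
  have "map_mat (\<lambda>p. poly p t0) A = 1\<^sub>m r"
    by (rule eq_matI) (auto simp: A_def assms)
  hence "poly (det A) t0 = 1" using ev.hom_det[of t0 A] by simp
  hence "det A \<noteq> 0" by auto
  hence "finite {t. poly (det A) t = 0}" by (rule poly_roots_finite)
  moreover have "{t. \<exists>x. (\<exists>j<r. x j \<noteq> 0) \<and> (\<forall>i<r. (\<Sum>j<r. poly (M i j) t * x j) = 0)}
      \<subseteq> {t. poly (det A) t = 0}"
  proof safe
    fix t x j
    assume j: "j < r" "x j \<noteq> 0" and z: "\<forall>i<r. (\<Sum>j<r. poly (M i j) t * x j) = 0"
    let ?B = "map_mat (\<lambda>p. poly p t) A"
    let ?v = "Matrix.vec r x"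
    have "?B *\<^sub>v ?v = 0\<^sub>v r"
    proof (rule eq_vecI)
      fix i assume i: "i < dim_vec (0\<^sub>v r :: complex Matrix.vec)"
      have "vec_index (?B *\<^sub>v ?v) i = (\<Sum>j<r. poly (M i j) t * x j)"
        using i by (auto simp: A_def scalar_prod_def atLeast0LessThan intro!: sum.cong)
      thus "vec_index (?B *\<^sub>v ?v) i = vec_index (0\<^sub>v r) i" using z i by simp
    qed (simp add: A_def)
    moreover have "?v \<noteq> 0\<^sub>v r" using j by (metis index_vec index_zero_vec(1))
    moreover have "?v \<in> carrier_vec r" by simp
    moreover have "?B \<in> carrier_mat r r" using A by simp
    ultimately have "det ?B = 0" using det_0_iff_vec_prod_zero_field by blast
    thus "poly (det A) t = 0" by simp
  qed
  ultimately show ?thesis using finite_subset by blast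
qed

section \<open>Forms and linear conditions on their coefficients\<close>

global_interpretation poly3: linear_space scale3
  by unfold_locales

lemma lookup_scale3: "Poly_Mapping.lookup (scale3 c f) a = c * Poly_Mapping.lookup f a"
  by (simp add: scale3_def const3_def Poly_Mapping.map.rep_eq when_def flip: mult_map_scale_conv_mult)

lemma keys_scale3: "Poly_Mapping.keys (scale3 c f) \<subseteq> Poly_Mapping.keys f"
  by (auto simp: in_keys_iff lookup_scale3)

text \<open>Evaluation, coefficients and Taylor coefficients of a form are all of this shape, with \<open>c a\<close> their value on
  the monomial \<open>a\<close>.\<close>

definition lin :: "(monom3 \<Rightarrow> complex) \<Rightarrow> poly3 \<Rightarrow> complex" where
  "lin c f = (\<Sum>a\<in>Poly_Mapping.keys f. Poly_Mapping.lookup f a * c a)"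

lemma lin_superset:
  assumes "finite S" "Poly_Mapping.keys f \<subseteq> S"
  shows "lin c f = (\<Sum>a\<in>S. Poly_Mapping.lookup f a * c a)"
  unfolding lin_def by (rule sum.mono_neutral_left) (use assms in \<open>auto simp: in_keys_iff\<close>)

lemma functional_lin: "poly3.functional (lin c)"
  unfolding poly3.functional_def
proof (intro conjI allI)
  fix f g :: poly3
  let ?S = "Poly_Mapping.keys f \<union> Poly_Mapping.keys g"
  have "Poly_Mapping.keys (f + g) \<subseteq> ?S" by (rule keys_add)
  thus "lin c (f + g) = lin c f + lin c g"
    using lin_superset[of ?S "f + g" c] lin_superset[of ?S f c] lin_superset[of ?S g c]
    by (simp add: lookup_add ring_distribs sum.distrib)
next
  fix k and f :: poly3
  show "lin c (scale3 k f) = k * lin c f"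
    using lin_superset[OF _ keys_scale3, of f c k]
    by (simp add: lin_def lookup_scale3 sum_distrib_left mult.assoc)
qed

lemma lin_single [simp]: "lin c (Poly_Mapping.single a x) = x * c a"
  by (cases "x = 0") (auto simp: lin_def)

lemma lin_cong: "(\<And>a. a \<in> Poly_Mapping.keys f \<Longrightarrow> c a = c' a) \<Longrightarrow> lin c f = lin c' f"
  by (simp add: lin_def)

lemma lin_sum: "lin (\<lambda>a. \<Sum>i\<in>I. c i a) f = (\<Sum>i\<in>I. lin (c i) f)"
  unfolding lin_def sum_distrib_left by (rule sum.swap)

lemma lin_mult: "lin (\<lambda>a. k * c a) f = k * lin c f"
  unfolding lin_def sum_distrib_left by (simp add: mult_ac)

definition polys_on :: "monom3 set \<Rightarrow> poly3 set" where
  "polys_on M = {f. Poly_Mapping.keys f \<subseteq> M}"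

lemma subspace_polys_on: "poly3.subspace (polys_on M)"
  unfolding polys_on_def poly3.subspace_def
  using order_trans[OF keys_add] order_trans[OF keys_scale3] by auto

lemma poly3_sum_singles:
  assumes "finite M" "f \<in> polys_on M"
  shows "f = (\<Sum>a\<in>M. scale3 (Poly_Mapping.lookup f a) (Poly_Mapping.single a 1))"
proof (rule poly_mapping_eqI)
  fix b
  have "(\<Sum>a\<in>M. Poly_Mapping.lookup f a * Poly_Mapping.lookup (Poly_Mapping.single a 1) b)
      = (\<Sum>a\<in>M. if a = b then Poly_Mapping.lookup f a else 0)"
    by (intro sum.cong) (auto simp: lookup_single when_def)
  thus "Poly_Mapping.lookup f b =
    Poly_Mapping.lookup (\<Sum>a\<in>M. scale3 (Poly_Mapping.lookup f a) (Poly_Mapping.single a 1)) b"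
    using assms by (auto simp: lookup_sum lookup_scale3 polys_on_def in_keys_iff)
qed

lemma
  assumes "finite M"
  shows fin_dim_polys_on: "poly3.fin_dim (polys_on M)"
    and dim_polys_on: "poly3.dim (polys_on M) = card M"
proof -
  let ?B = "(\<lambda>a. Poly_Mapping.single a (1::complex)) ` M"
  have sp: "polys_on M \<subseteq> poly3.span ?B"
  proof
    fix f assume "f \<in> polys_on M"
    note f = poly3_sum_singles[OF assms this]
    show "f \<in> poly3.span ?B"
      by (subst f) (intro poly3.span_sum poly3.span_scale poly3.span_base imageI)
  qed
  thus "poly3.fin_dim (polys_on M)" unfolding poly3.fin_dim_def using assms by blast
  have inj: "inj_on (\<lambda>a. Poly_Mapping.single a (1::complex)) M"
    by (rule inj_onI) (metis lookup_single_eq lookup_single_not_eq zero_neq_one)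
  have "poly3.independent ?B"
  proof (rule poly3.independent_if_scalars_zero)
    fix u x assume u: "(\<Sum>x\<in>?B. scale3 (u x) x) = 0" and x: "x \<in> ?B"
    then obtain a where a: "a \<in> M" "x = Poly_Mapping.single a 1" by auto
    have "0 = Poly_Mapping.lookup (\<Sum>b\<in>M. scale3 (u (Poly_Mapping.single b 1)) (Poly_Mapping.single b 1)) a"
      using u by (simp add: sum.reindex[OF inj])
    also have "\<dots> = (\<Sum>b\<in>M. if b = a then u (Poly_Mapping.single b 1) else 0)"
      unfolding lookup_sum lookup_scale3 by (intro sum.cong) (auto simp: lookup_single when_def)
    also have "\<dots> = u x" using a assms by simp
    finally show "u x = 0" by simp
  qed (use assms in simp)
  moreover have "?B \<subseteq> polys_on M" by (auto simp: polys_on_def)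
  ultimately have "card ?B = poly3.dim (polys_on M)"
    using sp by (intro poly3.basis_card_eq_dim) auto
  thus "poly3.dim (polys_on M) = card M" using card_image[OF inj] by simp
qed

definition mon :: "nat \<Rightarrow> nat \<Rightarrow> nat \<Rightarrow> monom3" where
  "mon p q r = Poly_Mapping.single 1 p + Poly_Mapping.single 2 q + Poly_Mapping.single 3 r"

lemma lookup_mon [simp]:
  "Poly_Mapping.lookup (mon p q r) 1 = p" "Poly_Mapping.lookup (mon p q r) 2 = q"
  "Poly_Mapping.lookup (mon p q r) 3 = r"
  by (simp_all add: mon_def lookup_add lookup_single)

lemma monom3_eqI:
  fixes a b :: monom3
  assumes "Poly_Mapping.lookup a 1 = Poly_Mapping.lookup b 1"
    "Poly_Mapping.lookup a 2 = Poly_Mapping.lookup b 2" "Poly_Mapping.lookup a 3 = Poly_Mapping.lookup b 3"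
  shows "a = b"
proof (rule poly_mapping_eqI)
  fix j :: 3
  show "Poly_Mapping.lookup a j = Poly_Mapping.lookup b j"
    using assms exhaust_3[of j] by auto
qed

lemma mon_lookup: "mon (Poly_Mapping.lookup a 1) (Poly_Mapping.lookup a 2) (Poly_Mapping.lookup a 3) = a"
  by (rule monom3_eqI) auto

lemma mdeg_eq: "mdeg a = Poly_Mapping.lookup a 1 + Poly_Mapping.lookup a 2 + Poly_Mapping.lookup a 3"
  by (simp add: mdeg_def sum_3)

text \<open>The number of monomials of degree less than \<open>n\<close> in two variables, which is the number of
  conditions imposed by a point of multiplicity \<open>n\<close>.\<close>

definition tri :: "nat \<Rightarrow> nat" where "tri n = n * (n + 1) div 2"

lemma tri_Suc: "tri (Suc n) = tri n + Suc n"
  by (simp add: tri_def)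

lemma two_tri: "2 * tri k = k * (k + 1)"
proof (induction k)
  case 0
  then show ?case by (simp add: tri_def)
next
  case (Suc k)
  then show ?case by (simp add: tri_Suc)
qed

lemma card_exponents_below: "card {(p, q). p + q < n} = tri n" and
  finite_exponents_below: "finite {(p, q). p + q < (n::nat)}"
proof -
  show fin: "finite {(p, q). p + q < n}" for n :: nat
    by (rule finite_subset[of _ "{..n} \<times> {..n}"]) auto
  show "card {(p, q). p + q < n} = tri n"
  proof (induction n)
    case 0
    then show ?case by (simp add: tri_def)
  next
    case (Suc n)
    have "{(p, q). p + q < Suc n} = {(p, q). p + q < n} \<union> (\<lambda>p. (p, n - p)) ` {..n}"
      by (auto simp: image_iff less_Suc_eq)
    moreover have "card ((\<lambda>p. (p, n - p)) ` {..n}) = Suc n"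
      by (subst card_image) (auto simp: inj_on_def)
    moreover have "{(p, q). p + q < n} \<inter> (\<lambda>p. (p, n - p)) ` {..n} = {}" by auto
    ultimately show ?case
      using card_Un_disjoint[OF fin[of n], of "(\<lambda>p. (p, n - p)) ` {..n}"] Suc by (simp add: tri_Suc)
  qed
qed

definition monoms :: "int \<Rightarrow> monom3 set" where "monoms d = {a. int (mdeg a) = d}"

lemma bij_betw_monoms:
  "bij_betw (\<lambda>(p, q). mon p q (nat d - p - q)) {(p, q). p + q < nat (d + 1)} (monoms d)"
proof (rule bij_betwI[of _ _ _ "\<lambda>a. (Poly_Mapping.lookup a 1, Poly_Mapping.lookup a 2)"])
  show "(\<lambda>(p, q). mon p q (nat d - p - q)) \<in> {(p, q). p + q < nat (d + 1)} \<rightarrow> monoms d"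
    by (auto simp: monoms_def mdeg_eq)
  show "(\<lambda>a. (Poly_Mapping.lookup a 1, Poly_Mapping.lookup a 2)) \<in> monoms d \<rightarrow> {(p, q). p + q < nat (d + 1)}"
    by (auto simp: monoms_def mdeg_eq)
  fix a assume "a \<in> monoms d"
  hence "nat d - Poly_Mapping.lookup a 1 - Poly_Mapping.lookup a 2 = Poly_Mapping.lookup a 3"
    by (auto simp: monoms_def mdeg_eq)
  thus "(case (Poly_Mapping.lookup a 1, Poly_Mapping.lookup a 2) of (p, q) \<Rightarrow> mon p q (nat d - p - q)) = a"
    by (simp add: mon_lookup)
qed auto

lemma finite_monoms: "finite (monoms d)" and card_monoms: "card (monoms d) = tri (nat (d + 1))"
  using bij_betw_finite[OF bij_betw_monoms[of d]] bij_betw_same_card[OF bij_betw_monoms[of d]]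
    card_exponents_below finite_exponents_below by simp_all

abbreviation forms :: "int \<Rightarrow> poly3 set" where "forms d \<equiv> polys_on (monoms d)"

lemma homogeneous_iff: "homogeneous d f \<longleftrightarrow> f \<in> forms d"
  by (auto simp: homogeneous_def polys_on_def monoms_def)

text \<open>Semicontinuity along a line. At \<open>t0\<close> choose functionals of the family and forms dual to them. The matrix of
  their values is the identity at \<open>t0\<close>, hence invertible for all but finitely many \<open>t\<close>, and then
  the span of the forms meets the kernel only in 0.\<close>

lemma open_kernel_dim:
  fixes c :: "'x \<Rightarrow> complex \<Rightarrow> monom3 \<Rightarrow> complex"
  assumes M: "finite M"
    and poly: "\<And>x a. x \<in> A \<Longrightarrow> a \<in> M \<Longrightarrow> \<exists>P. \<forall>t. c x t a = poly P t"
    and r: "poly3.dim (poly3.common_kernel (polys_on M) A (\<lambda>x. lin (c x t0))) \<le> r"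
  shows "finite {t. \<not> poly3.dim (poly3.common_kernel (polys_on M) A (\<lambda>x. lin (c x t))) \<le> r}"
proof -
  note fd = fin_dim_polys_on[OF M]
  obtain n b f where D: "n + poly3.dim (poly3.common_kernel (polys_on M) A (\<lambda>x. lin (c x t0))) = poly3.dim (polys_on M)"
    "\<And>i. i < n \<Longrightarrow> b i \<in> A" "\<And>i. i < n \<Longrightarrow> f i \<in> polys_on M"
    "\<And>i j. i < n \<Longrightarrow> j < n \<Longrightarrow> lin (c (b i) t0) (f j) = (if i = j then 1 else 0)"
    by (rule poly3.dual_system[OF fd subspace_polys_on functional_lin, of A "\<lambda>x. c x t0"]) (blast intro: that)
  have "\<exists>P. \<forall>t. lin (c (b i) t) (f j) = poly P t" if "i < n" "j < n" for i j
  proof -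
    have "\<forall>a\<in>M. \<exists>P. \<forall>t. c (b i) t a = poly P t" using poly D(2)[OF that(1)] by blast
    then obtain P where P: "\<And>a t. a \<in> M \<Longrightarrow> c (b i) t a = poly (P a) t" by metis
    have "lin (c (b i) t) (f j) = poly (\<Sum>a\<in>M. Polynomial.smult (Poly_Mapping.lookup (f j) a) (P a)) t" for t
      using lin_superset[OF M, of "f j" "c (b i) t"] D(3)[OF that(2)] P
      by (simp add: polys_on_def poly_sum)
    thus ?thesis by blast
  qed
  then obtain Q where Q: "\<And>i j t. i < n \<Longrightarrow> j < n \<Longrightarrow> lin (c (b i) t) (f j) = poly (Q i j) t"
    by metis
  have "finite {t. \<exists>x. (\<exists>j<n. x j \<noteq> 0) \<and> (\<forall>i<n. (\<Sum>j<n. poly (Q i j) t * x j) = 0)}" (is "finite ?S")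
    by (rule finite_singular_values[of _ _ t0]) (use Q D(4) in auto)
  moreover have "{t. \<not> poly3.dim (poly3.common_kernel (polys_on M) A (\<lambda>x. lin (c x t))) \<le> r} \<subseteq> ?S"
  proof (rule subsetI, rule ccontr)
    fix t assume t: "t \<in> {t. \<not> poly3.dim (poly3.common_kernel (polys_on M) A (\<lambda>x. lin (c x t))) \<le> r}"
      and "t \<notin> ?S"
    let ?K = "poly3.common_kernel (polys_on M) A (\<lambda>x. lin (c x t))"
    note dual = poly3.dual_family_independent[of n "\<lambda>x. lin (c x t0)" b f, OF functional_lin D(4)]
    let ?F = "poly3.span (f ` {..<n})"
    have FV: "?F \<subseteq> polys_on M" by (rule poly3.span_minimal) (use D(3) subspace_polys_on in auto)
    have "?K \<inter> ?F \<subseteq> {0}"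
    proof
      fix g assume g: "g \<in> ?K \<inter> ?F"
      have "g \<in> range (\<lambda>u. \<Sum>v\<in>f ` {..<n}. scale3 (u v) v)"
        using g poly3.span_finite[of "f ` {..<n}"] by simp
      then obtain u where "g = (\<Sum>v\<in>f ` {..<n}. scale3 (u v) v)" by (rule rangeE)
      hence gu: "g = (\<Sum>j<n. scale3 (u (f j)) (f j))" by (simp add: sum.reindex[OF dual(1)])
      have "(\<Sum>j<n. poly (Q i j) t * u (f j)) = 0" if i: "i < n" for i
      proof -
        have "0 = lin (c (b i) t) g" using g D(2)[OF i] by (auto simp: poly3.common_kernel_def)
        also have "\<dots> = (\<Sum>j<n. poly (Q i j) t * u (f j))"
          unfolding gu poly3.functional_sum[OF functional_lin]
          by (intro sum.cong) (use Q i in \<open>auto simp: poly3.functional_scale[OF functional_lin]\<close>)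
        finally show ?thesis by simp
      qed
      hence "\<forall>j<n. u (f j) = 0" using \<open>t \<notin> ?S\<close> by (auto dest!: spec[of _ "\<lambda>j. u (f j)"])
      thus "g \<in> {0}" using gu by simp
    qed
    hence "poly3.dim (?K \<inter> ?F) = 0" using poly3.dim_le_card[of "?K \<inter> ?F" "{}"] by simp
    moreover have "poly3.dim ?K + poly3.dim ?F \<le> poly3.dim (polys_on M) + poly3.dim (?K \<inter> ?F)"
      by (rule poly3.dim_Int_modular[OF fd subspace_polys_on poly3.subspace_common_kernel[OF subspace_polys_on functional_lin] poly3.subspace_span _ FV])
         (auto simp: poly3.common_kernel_def)
    ultimately have "poly3.dim ?K \<le> r" using dual(3) D(1) r by simp
    thus False using t by simp
  qed
  ultimately show ?thesis using finite_subset by blast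
qed

section \<open>Evaluation, Taylor coefficients and order of vanishing\<close>

lemma prod_UNIV_3: "(\<Prod>j\<in>(UNIV::3 set). f j) = f 1 * f 2 * f 3"
  unfolding UNIV_3 by (simp add: mult.assoc)

definition triple :: "'a \<Rightarrow> 'a \<Rightarrow> 'a \<Rightarrow> 3 \<Rightarrow> 'a" where
  "triple a b c = (\<lambda>j. if j = 1 then a else if j = 2 then b else c)"

lemma triple_simps [simp]: "triple a b c 1 = a" "triple a b c 2 = b" "triple a b c 3 = c"
  by (simp_all add: triple_def)

lemma triple_eta: "triple (x 1) (x 2) (x 3) = x"
proof
  fix j :: 3
  show "triple (x 1) (x 2) (x 3) j = x j" using exhaust_3[of j] by auto
qed

definition eval3 :: "(3 \<Rightarrow> complex) \<Rightarrow> poly3 \<Rightarrow> complex" where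
  "eval3 x = lin (\<lambda>a. \<Prod>j\<in>UNIV. x j ^ Poly_Mapping.lookup a j)"

lemma eval3_add: "eval3 x (f + g) = eval3 x f + eval3 x g"
  using functional_lin by (simp add: eval3_def poly3.functional_def)

lemma eval3_sum: "eval3 x (sum f I) = (\<Sum>i\<in>I. eval3 x (f i))"
  unfolding eval3_def by (rule poly3.functional_sum[OF functional_lin])

lemma eval3_single: "eval3 x (Poly_Mapping.single a c) = c * (\<Prod>j\<in>UNIV. x j ^ Poly_Mapping.lookup a j)"
  by (simp add: eval3_def)

lemma poly3_eq_sum_single: "f = (\<Sum>a\<in>Poly_Mapping.keys f. Poly_Mapping.single a (Poly_Mapping.lookup f a))"
  for f :: poly3
proof (rule poly_mapping_eqI)
  fix b
  have "(\<Sum>a\<in>Poly_Mapping.keys f. Poly_Mapping.lookup (Poly_Mapping.single a (Poly_Mapping.lookup f a)) b)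
      = (\<Sum>a\<in>Poly_Mapping.keys f. if a = b then Poly_Mapping.lookup f a else 0)"
    by (intro sum.cong) (auto simp: lookup_single when_def)
  thus "Poly_Mapping.lookup f b = Poly_Mapping.lookup
      (\<Sum>a\<in>Poly_Mapping.keys f. Poly_Mapping.single a (Poly_Mapping.lookup f a)) b"
    by (auto simp: lookup_sum in_keys_iff)
qed

lemma eval3_mult: "eval3 x (f * g) = eval3 x f * eval3 x g"
proof -
  let ?s = "\<lambda>f a. Poly_Mapping.single a (Poly_Mapping.lookup f a)"
  have "f * g = (\<Sum>a\<in>Poly_Mapping.keys f. \<Sum>b\<in>Poly_Mapping.keys g. ?s f a * ?s g b)"
    by (subst (1) poly3_eq_sum_single[of f], subst (1) poly3_eq_sum_single[of g]) (simp add: sum_product)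
  hence "eval3 x (f * g) = (\<Sum>a\<in>Poly_Mapping.keys f. \<Sum>b\<in>Poly_Mapping.keys g. eval3 x (?s f a) * eval3 x (?s g b))"
    by (simp add: eval3_sum mult_single eval3_single lookup_add power_add prod.distrib mult_ac)
  also have "\<dots> = eval3 x (\<Sum>a\<in>Poly_Mapping.keys f. ?s f a) * eval3 x (\<Sum>b\<in>Poly_Mapping.keys g. ?s g b)"
    by (simp add: eval3_sum sum_product)
  finally show ?thesis by (simp flip: poly3_eq_sum_single)
qed

lemma eval3_const3 [simp]: "eval3 x (const3 c) = c"
  by (simp add: const3_def eval3_single)

lemma eval3_one [simp]: "eval3 x 1 = 1"
  using eval3_const3[of x 1] by (simp add: const3_def)

lemma eval3_zero [simp]: "eval3 x 0 = 0"
  by (simp add: eval3_def lin_def)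

lemma eval3_var3 [simp]: "eval3 x (var3 j) = x j"
proof -
  have "(\<Prod>i\<in>UNIV. x i ^ Poly_Mapping.lookup (Poly_Mapping.single j 1) i) = (\<Prod>i\<in>UNIV. if i = j then x i else 1)"
    by (intro prod.cong) (auto simp: lookup_single when_def)
  thus ?thesis by (simp add: var3_def eval3_single)
qed

lemma eval3_power: "eval3 x (f ^ n) = eval3 x f ^ n"
  by (induction n) (auto simp: eval3_mult)

lemma eval3_prod: "eval3 x (\<Prod>j\<in>I. f j) = (\<Prod>j\<in>I. eval3 x (f j))"
  by (induction I rule: infinite_finite_induct) (auto simp: eval3_mult)

lemma eval3_subst3: "eval3 x (subst3 \<sigma> f) = eval3 (\<lambda>j. eval3 x (\<sigma> j)) f"
  by (simp add: subst3_def eval3_sum eval3_mult eval3_prod eval3_power)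
     (simp add: eval3_def lin_def)

lemma eval3_local_expansion:
  "eval3 h (local_expansion i v f) = eval3 (\<lambda>j. v $ j / v $ i + (if j = i then 0 else h j)) f"
  unfolding local_expansion_def eval3_subst3
  by (intro arg_cong[where f = "\<lambda>x. eval3 x f"] ext) (simp add: eval3_add)

lemma eval3_homogeneous:
  assumes "f \<in> forms (int d)"
  shows "eval3 (\<lambda>j. c * x j) f = c ^ d * eval3 x f"
proof -
  have "eval3 (\<lambda>j. c * x j) f = lin (\<lambda>a. c ^ d * (\<Prod>j\<in>UNIV. x j ^ Poly_Mapping.lookup a j)) f"
    unfolding eval3_def
  proof (rule lin_cong)
    fix a assume "a \<in> Poly_Mapping.keys f"
    hence "mdeg a = d" using assms by (auto simp: polys_on_def monoms_def)
    thus "(\<Prod>j\<in>UNIV. (c * x j) ^ Poly_Mapping.lookup a j) = c ^ d * (\<Prod>j\<in>UNIV. x j ^ Poly_Mapping.lookup a j)"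
      by (auto simp: power_mult_distrib prod.distrib power_sum mdeg_def)
  qed
  thus ?thesis by (simp add: lin_mult eval3_def)
qed

definition eval_poly :: "(3 \<Rightarrow> complex poly) \<Rightarrow> poly3 \<Rightarrow> complex poly" where
  "eval_poly \<sigma> f = (\<Sum>a\<in>Poly_Mapping.keys f.
     Polynomial.smult (Poly_Mapping.lookup f a) (\<Prod>j\<in>UNIV. \<sigma> j ^ Poly_Mapping.lookup a j))"

lemma poly_eval_poly [simp]: "poly (eval_poly \<sigma> f) t = eval3 (\<lambda>j. poly (\<sigma> j) t) f"
  by (simp add: eval_poly_def eval3_def lin_def poly_sum poly_prod)

lemma coeff_eval_poly:
  "coeff (eval_poly \<sigma> f) l = lin (\<lambda>a. coeff (\<Prod>j\<in>UNIV. \<sigma> j ^ Poly_Mapping.lookup a j) l) f"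
  by (simp add: eval_poly_def lin_def coeff_sum)

text \<open>Kronecker substitution: with \<open>B\<close> larger than all exponents, \<open>x = s\<close>, \<open>y = s ^ B\<close>, \<open>z = s ^ (B * B)\<close> sends
  different monomials to different powers of \<open>s\<close>.\<close>

lemma coeffs_zero_if_vanishing:
  fixes c :: "monom3 \<Rightarrow> complex"
  assumes "finite S" "\<And>w. (\<Sum>a\<in>S. c a * (\<Prod>j\<in>UNIV. w j ^ Poly_Mapping.lookup a j)) = 0" "b \<in> S"
  shows "c b = 0"
proof -
  define B where "B = Suc (\<Sum>a\<in>S. mdeg a)"
  have B: "Poly_Mapping.lookup a j < B" if "a \<in> S" for a j
  proof -
    have "Poly_Mapping.lookup a j \<le> mdeg a"
      unfolding mdeg_def by (rule member_le_sum) auto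
    also have "mdeg a \<le> (\<Sum>a\<in>S. mdeg a)" using assms(1) that by (intro member_le_sum) auto
    finally show ?thesis by (simp add: B_def)
  qed
  define code where "code a = Poly_Mapping.lookup a 1 + B * (Poly_Mapping.lookup a 2 + B * Poly_Mapping.lookup a (3::3))"
    for a :: monom3
  have inj: "a = a'" if "a \<in> S" "a' \<in> S" "code a = code a'" for a a'
  proof (rule monom3_eqI)
    have *: "code e mod B = Poly_Mapping.lookup e 1" "code e div B mod B = Poly_Mapping.lookup e 2"
      "code e div B div B = Poly_Mapping.lookup e 3" if "e \<in> S" for e
      using B[OF that, of 1] B[OF that, of 2] B[OF that, of 3] by (auto simp: code_def)
    thus "Poly_Mapping.lookup a 1 = Poly_Mapping.lookup a' 1" "Poly_Mapping.lookup a 2 = Poly_Mapping.lookup a' 2"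
      "Poly_Mapping.lookup a 3 = Poly_Mapping.lookup a' 3" using *[OF that(1)] *[OF that(2)] that(3) by simp_all
  qed
  define P where "P = (\<Sum>a\<in>S. monom (c a) (code a))"
  have "poly P s = 0" for s
  proof -
    have "poly P s = (\<Sum>a\<in>S. c a * (\<Prod>j\<in>UNIV. triple s (s ^ B) (s ^ (B * B)) j ^ Poly_Mapping.lookup a j))"
      unfolding P_def poly_sum
      by (intro sum.cong) (auto simp: prod_UNIV_3 poly_monom code_def power_add power_mult algebra_simps)
    thus ?thesis using assms(2) by simp
  qed
  hence "P = 0" using poly_all_0_iff_0 by blast
  hence "0 = coeff P (code b)" by simp
  also have "\<dots> = (\<Sum>a\<in>S. if a = b then c a else 0)"
    unfolding P_def coeff_sum by (intro sum.cong) (use inj assms(3) in auto)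
  finally show ?thesis using assms by simp
qed

lemma poly_eqI': "(\<And>t. poly p t = poly q t) \<Longrightarrow> p = (q :: complex poly)"
  using poly_eq_poly_eq_iff[of p q] by (simp add: fun_eq_iff)

lemma eval_poly_ray: "eval_poly (\<lambda>j. [:0, w j:]) f =
   (\<Sum>a\<in>Poly_Mapping.keys f. monom (Poly_Mapping.lookup f a * (\<Prod>j\<in>UNIV. w j ^ Poly_Mapping.lookup a j)) (mdeg a))"
proof (rule poly_eqI')
  fix t
  show "poly (eval_poly (\<lambda>j. [:0, w j:]) f) t = poly (\<Sum>a\<in>Poly_Mapping.keys f.
      monom (Poly_Mapping.lookup f a * (\<Prod>j\<in>UNIV. w j ^ Poly_Mapping.lookup a j)) (mdeg a)) t"
    unfolding poly_eval_poly poly_sum eval3_def lin_def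
    by (intro sum.cong) (auto simp: poly_monom mdeg_eq prod_UNIV_3 power_add power_mult_distrib)
qed

text \<open>The order of vanishing at the origin can be read off on the lines through the origin.\<close>

lemma mdeg_ge_iff_ray:
  "(\<forall>a\<in>Poly_Mapping.keys f. m \<le> mdeg a) \<longleftrightarrow> (\<forall>w. monom 1 m dvd eval_poly (\<lambda>j. [:0, w j:]) f)"
proof
  assume *: "\<forall>a\<in>Poly_Mapping.keys f. m \<le> mdeg a"
  show "\<forall>w. monom 1 m dvd eval_poly (\<lambda>j. [:0, w j:]) f"
    unfolding eval_poly_ray
  proof (intro allI dvd_sum)
    fix w :: "3 \<Rightarrow> complex" and a assume "a \<in> Poly_Mapping.keys f"
    with * show "monom 1 m dvd monom (Poly_Mapping.lookup f a * (\<Prod>j\<in>UNIV. w j ^ Poly_Mapping.lookup a j)) (mdeg a)"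
      by (auto simp: monom_1_dvd_iff')
  qed
next
  assume *: "\<forall>w. monom 1 m dvd eval_poly (\<lambda>j. [:0, w j:]) f"
  show "\<forall>a\<in>Poly_Mapping.keys f. m \<le> mdeg a"
  proof (rule ballI, rule ccontr)
    fix b assume b: "b \<in> Poly_Mapping.keys f" "\<not> m \<le> mdeg b"
    have "Poly_Mapping.lookup f b = 0"
    proof (rule coeffs_zero_if_vanishing[of "{a\<in>Poly_Mapping.keys f. mdeg a = mdeg b}"])
      fix w :: "3 \<Rightarrow> complex"
      have "0 = coeff (eval_poly (\<lambda>j. [:0, w j:]) f) (mdeg b)"
        using * b by (simp add: monom_1_dvd_iff')
      also have "\<dots> = (\<Sum>a\<in>{a\<in>Poly_Mapping.keys f. mdeg a = mdeg b}. Poly_Mapping.lookup f a * (\<Prod>j\<in>UNIV. w j ^ Poly_Mapping.lookup a j))"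
        unfolding eval_poly_ray coeff_sum by (simp add: sum.If_cases Int_def)
      finally show "(\<Sum>a\<in>{a\<in>Poly_Mapping.keys f. mdeg a = mdeg b}. Poly_Mapping.lookup f a * (\<Prod>j\<in>UNIV. w j ^ Poly_Mapping.lookup a j)) = 0" by simp
    qed (use b in auto)
    thus False using b by (simp add: in_keys_iff)
  qed
qed

text \<open>Multiplicity at least \<open>m\<close> at \<open>v\<close>, tested on the lines through \<open>v\<close> in the three-dimensional space of
  homogeneous coordinates. This condition refers to no affine chart, and the linear conditions it consists of depend
  polynomially on \<open>v\<close>, also where a coordinate of \<open>v\<close> is zero.\<close>

definition vanishes_along :: "nat \<Rightarrow> (3 \<Rightarrow> complex) \<Rightarrow> poly3 \<Rightarrow> bool" where
  "vanishes_along m v f \<longleftrightarrow> (\<forall>w. monom 1 m dvd eval_poly (\<lambda>j. [:v j, w j:]) f)"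

text \<open>By homogeneity, moving away from \<open>v / v $ i\<close> inside the chart is, up to scaling, the same as moving along a line
  through \<open>v\<close>.\<close>

lemma mdeg_local_expansion_ge:
  assumes f: "f \<in> forms (int d)" and v: "v $ i \<noteq> 0" and van: "vanishes_along m (($) v) f"
  shows "\<forall>a\<in>Poly_Mapping.keys (local_expansion i v f). m \<le> mdeg a"
  unfolding mdeg_ge_iff_ray
proof
  fix w :: "3 \<Rightarrow> complex"
  define w' where "w' j = (if j = i then 0 else v $ i * w j)" for j
  have "eval_poly (\<lambda>j. [:0, w j:]) (local_expansion i v f)
      = Polynomial.smult ((1 / v $ i) ^ d) (eval_poly (\<lambda>j. [:v $ j, w' j:]) f)"
  proof (rule poly_eqI')
    fix t
    have "eval3 (\<lambda>j. v $ j / v $ i + (if j = i then 0 else t * w j)) f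
        = eval3 (\<lambda>j. 1 / v $ i * (v $ j + t * w' j)) f"
      using v by (intro arg_cong[where f = "\<lambda>x. eval3 x f"] ext) (auto simp: w'_def field_simps)
    also have "\<dots> = (1 / v $ i) ^ d * eval3 (\<lambda>j. v $ j + t * w' j) f"
      by (rule eval3_homogeneous[OF f])
    finally show "poly (eval_poly (\<lambda>j. [:0, w j:]) (local_expansion i v f)) t
      = poly (Polynomial.smult ((1 / v $ i) ^ d) (eval_poly (\<lambda>j. [:v $ j, w' j:]) f)) t"
      by (simp add: eval3_local_expansion)
  qed
  thus "monom 1 m dvd eval_poly (\<lambda>j. [:0, w j:]) (local_expansion i v f)"
    using van by (simp add: vanishes_along_def dvd_smult)
qed

text \<open>The coefficient of \<open>\<xi> ^ p * \<eta> ^ q\<close> in the expansion at \<open>(x, y)\<close>, in the chart where the third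
  coordinate is 1, of the monomial \<open>a\<close>.\<close>

definition taylor_coeff :: "complex \<Rightarrow> complex \<Rightarrow> nat \<Rightarrow> nat \<Rightarrow> monom3 \<Rightarrow> complex" where
  "taylor_coeff x y p q a =
     of_nat (Poly_Mapping.lookup a 1 choose p) * x ^ (Poly_Mapping.lookup a 1 - p) *
     (of_nat (Poly_Mapping.lookup a 2 choose q) * y ^ (Poly_Mapping.lookup a 2 - q))"

definition taylor :: "complex \<Rightarrow> complex \<Rightarrow> nat \<Rightarrow> nat \<Rightarrow> poly3 \<Rightarrow> complex" where
  "taylor x y p q = lin (taylor_coeff x y p q)"

lemma taylor_eq_0:
  assumes "f \<in> forms (int d)" "d < p + q"
  shows "taylor x y p q f = 0"
proof -
  have "taylor x y p q f = lin (\<lambda>a. 0) f" unfolding taylor_def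
  proof (rule lin_cong)
    fix a assume "a \<in> Poly_Mapping.keys f"
    hence "mdeg a = d" using assms by (auto simp: polys_on_def monoms_def)
    hence "Poly_Mapping.lookup a 1 < p \<or> Poly_Mapping.lookup a 2 < q" using assms(2) by (auto simp: mdeg_eq)
    thus "taylor_coeff x y p q a = 0" by (auto simp: taylor_coeff_def)
  qed
  thus ?thesis by (simp add: lin_def)
qed

lemma homogeneous_taylor_formula:
  assumes "f \<in> forms (int d)"
  shows "eval3 (triple X Y Z) f = (\<Sum>p\<le>d. \<Sum>q\<le>d. taylor x y p q f *
           ((X - x * Z) ^ p * (Y - y * Z) ^ q * Z ^ (d - p - q)))"
proof -
  have bin: "X ^ n = (\<Sum>p\<le>d. of_nat (n choose p) * x ^ (n - p) * (X - x * Z) ^ p * Z ^ (n - p))"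
    if "n \<le> d" for n and X x :: complex
  proof -
    have "X ^ n = ((X - x * Z) + x * Z) ^ n" by simp
    also have "\<dots> = (\<Sum>p\<le>n. of_nat (n choose p) * (X - x * Z) ^ p * (x * Z) ^ (n - p))"
      by (rule binomial_ring)
    also have "\<dots> = (\<Sum>p\<le>n. of_nat (n choose p) * x ^ (n - p) * (X - x * Z) ^ p * Z ^ (n - p))"
      by (simp add: power_mult_distrib mult_ac)
    also have "\<dots> = (\<Sum>p\<le>d. of_nat (n choose p) * x ^ (n - p) * (X - x * Z) ^ p * Z ^ (n - p))"
      by (rule sum.mono_neutral_left) (use that in auto)
    finally show ?thesis .
  qed
  let ?F = "\<lambda>p q. (X - x * Z) ^ p * (Y - y * Z) ^ q * Z ^ (d - p - q)"
  have "eval3 (triple X Y Z) f = lin (\<lambda>a. \<Sum>p\<le>d. \<Sum>q\<le>d. ?F p q * taylor_coeff x y p q a) f"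
    unfolding eval3_def
  proof (rule lin_cong)
    fix a assume "a \<in> Poly_Mapping.keys f"
    hence "mdeg a = d" using assms by (auto simp: polys_on_def monoms_def)
    define k l r where "k = Poly_Mapping.lookup a 1" "l = Poly_Mapping.lookup a 2" "r = Poly_Mapping.lookup a (3::3)"
    have klr: "k + l + r = d" using \<open>mdeg a = d\<close> by (simp add: mdeg_eq k_l_r_def)
    have "X ^ k * Y ^ l * Z ^ r = (\<Sum>p\<le>d. \<Sum>q\<le>d. ?F p q * taylor_coeff x y p q a)"
    proof -
      have "X ^ k * Y ^ l * Z ^ r =
        (\<Sum>p\<le>d. \<Sum>q\<le>d. of_nat (k choose p) * x ^ (k - p) * (X - x * Z) ^ p * Z ^ (k - p) *
           (of_nat (l choose q) * y ^ (l - q) * (Y - y * Z) ^ q * Z ^ (l - q)) * Z ^ r)"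
      proof -
        have "k \<le> d" "l \<le> d" using klr by simp_all
        from bin[OF this(1), of X x] bin[OF this(2), of Y y] show ?thesis
          unfolding sum_distrib_right[symmetric, of _ "Z ^ r"] sum_product[symmetric] by simp
      qed
      also have "\<dots> = (\<Sum>p\<le>d. \<Sum>q\<le>d. ?F p q * taylor_coeff x y p q a)"
      proof (intro sum.cong refl)
        fix p q
        show "of_nat (k choose p) * x ^ (k - p) * (X - x * Z) ^ p * Z ^ (k - p) *
           (of_nat (l choose q) * y ^ (l - q) * (Y - y * Z) ^ q * Z ^ (l - q)) * Z ^ r
           = ?F p q * taylor_coeff x y p q a"
        proof (cases "p \<le> k \<and> q \<le> l")
          case True
          hence "d - p - q = (k - p) + (l - q) + r" using klr by simp
          thus ?thesis by (simp add: taylor_coeff_def power_add flip: k_l_r_def)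
        next
          case False
          thus ?thesis by (auto simp: taylor_coeff_def simp flip: k_l_r_def)
        qed
      qed
      finally show ?thesis .
    qed
    thus "(\<Prod>j\<in>UNIV. triple X Y Z j ^ Poly_Mapping.lookup a j) = (\<Sum>p\<le>d. \<Sum>q\<le>d. ?F p q * taylor_coeff x y p q a)"
      by (simp add: prod_UNIV_3 k_l_r_def)
  qed
  also have "\<dots> = (\<Sum>p\<le>d. \<Sum>q\<le>d. taylor x y p q f * ?F p q)"
    unfolding lin_sum lin_mult taylor_def by (intro sum.cong refl mult.commute)
  finally show ?thesis .
qed

text \<open>In the Taylor formula at \<open>(v 1 / v 3, v 2 / v 3)\<close> the factors \<open>X - x Z\<close> and \<open>Y - y Z\<close> vanish at \<open>v\<close>, so along
  a line through \<open>v\<close> they are multiples of the parameter.\<close>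

lemma vanishes_along_if_taylor:
  assumes f: "f \<in> forms (int d)" and v: "v 3 \<noteq> 0"
    and T: "\<And>p q. p + q < m \<Longrightarrow> taylor (v 1 / v 3) (v 2 / v 3) p q f = 0"
  shows "vanishes_along m v f"
  unfolding vanishes_along_def
proof
  fix w :: "3 \<Rightarrow> complex"
  define x y where "x = v 1 / v 3" and "y = v 2 / v 3"
  have vxy: "v 1 = x * v 3" "v 2 = y * v 3" using v by (simp_all add: x_def y_def)
  let ?G = "\<lambda>p q. Polynomial.smult (taylor x y p q f)
     ([:0, w 1 - x * w 3:] ^ p * [:0, w 2 - y * w 3:] ^ q * [:v 3, w 3:] ^ (d - p - q))"
  have "eval_poly (\<lambda>j. [:v j, w j:]) f = (\<Sum>p\<le>d. \<Sum>q\<le>d. ?G p q)"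
  proof (rule poly_eqI')
    fix t
    have 1: "poly [:v 1, w 1:] t - x * poly [:v 3, w 3:] t = poly [:0, w 1 - x * w 3:] t"
      "poly [:v 2, w 2:] t - y * poly [:v 3, w 3:] t = poly [:0, w 2 - y * w 3:] t"
      by (simp_all add: vxy algebra_simps)
    have "poly (eval_poly (\<lambda>j. [:v j, w j:]) f) t
       = eval3 (triple (poly [:v 1, w 1:] t) (poly [:v 2, w 2:] t) (poly [:v 3, w 3:] t)) f"
      unfolding poly_eval_poly triple_eta[of "\<lambda>j. poly [:v j, w j:] t"] ..
    also have "\<dots> = (\<Sum>p\<le>d. \<Sum>q\<le>d. poly (?G p q) t)"
      by (subst homogeneous_taylor_formula[OF f, of _ _ _ x y]) (simp only: 1 poly_smult poly_mult poly_power)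
    finally show "poly (eval_poly (\<lambda>j. [:v j, w j:]) f) t = poly (\<Sum>p\<le>d. \<Sum>q\<le>d. ?G p q) t"
      by (simp add: poly_sum)
  qed
  moreover have "monom 1 m dvd (\<Sum>p\<le>d. \<Sum>q\<le>d. ?G p q)"
  proof (intro dvd_sum)
    fix p q
    show "monom 1 m dvd ?G p q"
    proof (cases "p + q < m")
      case True
      thus ?thesis using T by (simp add: x_def y_def)
    next
      case False
      have e: "[:0, c:] ^ n = monom (c ^ n) n" for c :: complex and n
        using monom_power[of c 1 n] by (simp add: monom_Suc monom_0)
      show ?thesis
        unfolding e mult_monom
        by (intro dvd_smult dvd_mult2) (use False in \<open>simp add: monom_1_dvd_iff'\<close>)
    qed
  qed
  ultimately show "monom 1 m dvd eval_poly (\<lambda>j. [:v j, w j:]) f" by simp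
qed

text \<open>On the line with direction \<open>(1, b)\<close> the coefficient of \<open>t ^ l\<close> is a polynomial in \<open>b\<close> whose coefficients are
  the Taylor coefficients of order \<open>l\<close>. It vanishes for all \<open>b\<close>.\<close>

lemma taylor_eq_0_if_vanishes:
  assumes f: "f \<in> forms (int d)"
    and van: "\<And>a b. monom 1 m dvd eval_poly (triple [:x, a:] [:y, b:] 1) f"
    and pq: "p + q < m"
  shows "taylor x y p q f = 0"
proof (cases "p \<le> d \<and> q \<le> d")
  case False
  thus ?thesis using taylor_eq_0[OF f, of p q] by auto
next
  case True
  let ?P = "\<lambda>b. \<Sum>p\<le>d. \<Sum>q\<le>d. monom (taylor x y p q f * b ^ q) (p + q)"
  have ev: "eval_poly (triple [:x, 1:] [:y, b:] 1) f = ?P b" for b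
  proof (rule poly_eqI')
    fix t
    have "poly (eval_poly (triple [:x, 1:] [:y, b:] 1) f) t = eval3 (triple (x + t) (y + t * b) 1) f"
      unfolding poly_eval_poly by (intro arg_cong[where f = "\<lambda>x. eval3 x f"] ext) (auto simp: triple_def)
    also have "\<dots> = poly (?P b) t"
      by (subst homogeneous_taylor_formula[OF f, of _ _ _ x y])
         (simp add: poly_sum poly_monom power_add power_mult_distrib mult_ac)
    finally show "poly (eval_poly (triple [:x, 1:] [:y, b:] 1) f) t = poly (?P b) t" .
  qed
  define Q where "Q = (\<Sum>p'\<le>d. \<Sum>q'\<le>d. if p' + q' = p + q then monom (taylor x y p' q' f) q' else 0)"
  have "poly Q b = 0" for b
  proof -
    have "0 = coeff (?P b) (p + q)" using van[of 1 b] pq unfolding ev by (simp add: monom_1_dvd_iff')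
    also have "\<dots> = poly Q b"
      unfolding Q_def coeff_sum poly_sum by (intro sum.cong refl) (auto simp: poly_monom)
    finally show ?thesis by simp
  qed
  hence "Q = 0" using poly_all_0_iff_0 by blast
  hence "0 = coeff Q q" by simp
  also have "\<dots> = (\<Sum>p'\<le>d. \<Sum>q'\<le>d. if p' = p \<and> q' = q then taylor x y p q f else 0)"
    unfolding Q_def coeff_sum by (intro sum.cong refl) auto
  also have "\<dots> = (\<Sum>p'\<le>d. if p' = p then taylor x y p q f else 0)"
    using True by (intro sum.cong refl) auto
  also have "\<dots> = taylor x y p q f" using True by simp
  finally show ?thesis by simp
qed

section \<open>Generic configurations\<close>

text \<open>The row of index \<open>i\<close> holds the coordinates of the \<open>i\<close>-th point, followed by further
  parameters attached to it. Rows and columns without a role are left arbitrary, so that configurations form a single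
  vector space.\<close>

type_synonym configuration = "nat \<Rightarrow> nat \<Rightarrow> complex"

definition line :: "configuration \<Rightarrow> configuration \<Rightarrow> complex \<Rightarrow> configuration" where
  "line u v t = (\<lambda>i j. u i j + t * (v i j - u i j))"

lemma line_0 [simp]: "line u v 0 = u"
  by (simp add: line_def)

lemma line_swap: "line v u (1 - t) = line u v t"
  by (simp add: line_def algebra_simps)

definition poly_on_lines :: "(configuration \<Rightarrow> complex) \<Rightarrow> bool" where
  "poly_on_lines P \<longleftrightarrow> (\<forall>u v. \<exists>p. \<forall>t. P (line u v t) = poly p t)"

lemma poly_on_lines_const [intro]: "poly_on_lines (\<lambda>u. c)"
  unfolding poly_on_lines_def by (intro allI exI[of _ "[:c:]"]) simp

lemma poly_on_lines_coord [intro]: "poly_on_lines (\<lambda>u. u i j)"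
  unfolding poly_on_lines_def
proof (intro allI)
  fix u v :: configuration
  show "\<exists>p. \<forall>t. line u v t i j = poly p t"
    by (intro exI[of _ "[:u i j, v i j - u i j:]"]) (simp add: line_def)
qed

lemma poly_on_lines_add [intro]:
  assumes "poly_on_lines P" "poly_on_lines Q"
  shows "poly_on_lines (\<lambda>u. P u + Q u)"
  unfolding poly_on_lines_def
proof (intro allI)
  fix u v
  obtain p q where "\<forall>t. P (line u v t) = poly p t" "\<forall>t. Q (line u v t) = poly q t"
    using assms unfolding poly_on_lines_def by metis
  thus "\<exists>p. \<forall>t. P (line u v t) + Q (line u v t) = poly p t"
    by (intro exI[of _ "p + q"]) simp
qed

lemma poly_on_lines_mult [intro]:
  assumes "poly_on_lines P" "poly_on_lines Q"
  shows "poly_on_lines (\<lambda>u. P u * Q u)"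
  unfolding poly_on_lines_def
proof (intro allI)
  fix u v
  obtain p q where "\<forall>t. P (line u v t) = poly p t" "\<forall>t. Q (line u v t) = poly q t"
    using assms unfolding poly_on_lines_def by metis
  thus "\<exists>p. \<forall>t. P (line u v t) * Q (line u v t) = poly p t"
    by (intro exI[of _ "p * q"]) simp
qed

lemma poly_on_lines_power [intro]: "poly_on_lines P \<Longrightarrow> poly_on_lines (\<lambda>u. P u ^ n)"
  by (induction n) auto

lemma poly_on_lines_sum [intro]:
  "(\<And>i. i \<in> I \<Longrightarrow> poly_on_lines (P i)) \<Longrightarrow> poly_on_lines (\<lambda>u. \<Sum>i\<in>I. P i u)"
  by (induction I rule: infinite_finite_induct) auto

lemma poly_on_lines_diff [intro]:
  assumes "poly_on_lines P" "poly_on_lines Q"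
  shows "poly_on_lines (\<lambda>u. P u - Q u)"
  using poly_on_lines_add[OF assms(1) poly_on_lines_mult[OF poly_on_lines_const[of "-1"] assms(2)]] by simp

text \<open>A substitute for nonempty Zariski open sets that needs polynomials in one variable only.\<close>

definition generic :: "(configuration \<Rightarrow> bool) \<Rightarrow> bool" where
  "generic Q \<longleftrightarrow> (\<exists>u. Q u) \<and> (\<forall>u v. Q u \<longrightarrow> finite {t. \<not> Q (line u v t)})"

lemma generic_ex: "generic Q \<Longrightarrow> \<exists>u. Q u"
  by (simp add: generic_def)

text \<open>On the line through a point of each of the two sets, both properties fail only finitely often.\<close>

lemma generic_conj:
  assumes "generic P" "generic Q"
  shows "generic (\<lambda>u. P u \<and> Q u)"
  unfolding generic_def
proof (intro conjI allI impI)
  obtain u v where uv: "P u" "Q v" using assms unfolding generic_def by blast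
  have "finite {t. \<not> P (line u v t)}" using assms(1) uv unfolding generic_def by blast
  moreover have "finite {t. \<not> Q (line u v t)}"
  proof (rule finite_subset)
    show "{t. \<not> Q (line u v t)} \<subseteq> (\<lambda>t. 1 - t) ` {t. \<not> Q (line v u t)}"
    proof
      fix t assume "t \<in> {t. \<not> Q (line u v t)}"
      hence "1 - t \<in> {t. \<not> Q (line v u t)}" by (simp add: line_swap)
      thus "t \<in> (\<lambda>t. 1 - t) ` {t. \<not> Q (line v u t)}" by (intro image_eqI[of _ _ "1 - t"]) auto
    qed
    show "finite ((\<lambda>t. 1 - t) ` {t. \<not> Q (line v u t)})"
      using assms(2) uv unfolding generic_def by blast
  qed
  ultimately have "finite ({t. \<not> P (line u v t)} \<union> {t. \<not> Q (line u v t)})" by simp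
  then obtain t where "t \<notin> {t. \<not> P (line u v t)} \<union> {t. \<not> Q (line u v t)}"
    using ex_new_if_finite[OF infinite_UNIV_char_0] by blast
  thus "\<exists>u. P u \<and> Q u" by blast
next
  fix u v assume "P u \<and> Q u"
  hence "finite ({t. \<not> P (line u v t)} \<union> {t. \<not> Q (line u v t)})"
    using assms unfolding generic_def by blast
  moreover have "{t. \<not> (P (line u v t) \<and> Q (line u v t))} =
      {t. \<not> P (line u v t)} \<union> {t. \<not> Q (line u v t)}" by blast
  ultimately show "finite {t. \<not> (P (line u v t) \<and> Q (line u v t))}" by simp
qed

lemma generic_all:
  assumes "finite I" "\<And>i. i \<in> I \<Longrightarrow> generic (Q i)"
  shows "generic (\<lambda>u. \<forall>i\<in>I. Q i u)"
  using assms
proof (induction I)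
  case empty
  then show ?case by (simp add: generic_def)
next
  case (insert i I)
  then show ?case using generic_conj[of "Q i" "\<lambda>u. \<forall>i\<in>I. Q i u"] by simp
qed

lemma generic_nonzero:
  assumes "poly_on_lines P" "P w \<noteq> 0"
  shows "generic (\<lambda>u. P u \<noteq> 0)"
  unfolding generic_def
proof (intro conjI allI impI)
  show "\<exists>u. P u \<noteq> 0" using assms by blast
  fix u v assume u: "P u \<noteq> 0"
  obtain p where p: "\<And>t. P (line u v t) = poly p t" using assms(1) unfolding poly_on_lines_def by metis
  have "poly p 0 \<noteq> 0" using u p[of 0] by simp
  hence "p \<noteq> 0" by auto
  thus "finite {t. \<not> P (line u v t) \<noteq> 0}" using poly_roots_finite by (simp add: p)
qed

lemma generic_kernel_dim:
  fixes c :: "'x \<Rightarrow> configuration \<Rightarrow> monom3 \<Rightarrow> complex"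
  assumes M: "finite M"
    and poly: "\<And>x a. x \<in> A \<Longrightarrow> a \<in> M \<Longrightarrow> poly_on_lines (\<lambda>u. c x u a)"
    and r: "poly3.dim (poly3.common_kernel (polys_on M) A (\<lambda>x. lin (c x w))) \<le> r"
  shows "generic (\<lambda>u. poly3.dim (poly3.common_kernel (polys_on M) A (\<lambda>x. lin (c x u))) \<le> r)"
  unfolding generic_def
proof (intro conjI allI impI exI)
  show "poly3.dim (poly3.common_kernel (polys_on M) A (\<lambda>x. lin (c x w))) \<le> r" by (rule r)
  fix u v
  assume u: "poly3.dim (poly3.common_kernel (polys_on M) A (\<lambda>x. lin (c x u))) \<le> r"
  show "finite {t. \<not> poly3.dim (poly3.common_kernel (polys_on M) A (\<lambda>x. lin (c x (line u v t)))) \<le> r}"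
    by (rule open_kernel_dim[OF M, of A "\<lambda>x t. c x (line u v t)" 0])
       (use poly u in \<open>auto simp: poly_on_lines_def\<close>)
qed

section \<open>Linear systems of points in an affine chart\<close>

definition affine_system :: "int \<Rightarrow> nat \<Rightarrow> nat \<Rightarrow> configuration \<Rightarrow> poly3 set" where
  "affine_system d m n u = poly3.common_kernel (forms d) {(i, p, q). i < n \<and> p + q < m}
     (\<lambda>x. lin ((\<lambda>(i, p, q). taylor_coeff (u i 0) (u i 1) p q) x))"

lemma mem_affine_system:
  "f \<in> affine_system d m n u \<longleftrightarrow>
     f \<in> forms d \<and> (\<forall>i<n. \<forall>p q. p + q < m \<longrightarrow> taylor (u i 0) (u i 1) p q f = 0)"
  by (auto simp: affine_system_def poly3.common_kernel_def taylor_def)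

definition projective_system :: "int \<Rightarrow> nat \<Rightarrow> nat \<Rightarrow> configuration \<Rightarrow> poly3 set" where
  "projective_system d m n v = poly3.common_kernel (forms d) {(i, w, l). i < n \<and> l < m}
     (\<lambda>x. lin ((\<lambda>(i, w, l) a. coeff (\<Prod>j\<in>UNIV. [:triple (v i 0) (v i 1) (v i 2) j, w j:] ^ Poly_Mapping.lookup a j) l) x))"

lemma mem_projective_system:
  "f \<in> projective_system d m n v \<longleftrightarrow>
     f \<in> forms d \<and> (\<forall>i<n. vanishes_along m (triple (v i 0) (v i 1) (v i 2)) f)"
  by (auto simp: projective_system_def poly3.common_kernel_def vanishes_along_def
      monom_1_dvd_iff' coeff_eval_poly)

lemma dim_affine_system_ge: "tri (nat (d + 1)) \<le> poly3.dim (affine_system d m n u) + n * tri m"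
proof -
  have eq: "{(i, p, q). i < n \<and> p + q < m} = {..<n} \<times> {(p, q). p + q < m}" by auto
  have "finite {(i, p, q). i < n \<and> p + q < m}" "card {(i, p, q). i < n \<and> p + q < m} = n * tri m"
    unfolding eq using finite_exponents_below card_exponents_below by simp_all
  thus ?thesis
    using poly3.dim_common_kernel_ge[OF _ fin_dim_polys_on[OF finite_monoms] subspace_polys_on functional_lin,
        of "{(i, p, q). i < n \<and> p + q < m}" d "\<lambda>x. (\<lambda>(i, p, q). taylor_coeff (u i 0) (u i 1) p q) x"]
    by (simp add: affine_system_def dim_polys_on[OF finite_monoms] card_monoms)
qed

lemma poly_on_lines_taylor_coeff [intro]:
  assumes "poly_on_lines X" "poly_on_lines Y"
  shows "poly_on_lines (\<lambda>u. taylor_coeff (X u) (Y u) p q a)"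
  unfolding taylor_coeff_def using assms by (intro poly_on_lines_mult poly_on_lines_power poly_on_lines_const)

lemma generic_affine_system_dim:
  assumes "poly3.dim (affine_system d m n u) \<le> r"
  shows "generic (\<lambda>u. poly3.dim (affine_system d m n u) \<le> r)"
  unfolding affine_system_def
  by (rule generic_kernel_dim[OF finite_monoms, where
        c = "\<lambda>x u. (\<lambda>(i, p, q). taylor_coeff (u i 0) (u i 1) p q) x"])
     (use assms in \<open>auto simp: affine_system_def\<close>)

lemma poly_on_lines_coeff_mult:
  assumes "\<And>l. poly_on_lines (\<lambda>u. coeff (F u) l)" "\<And>l. poly_on_lines (\<lambda>u. coeff (G u) l)"
  shows "poly_on_lines (\<lambda>u. coeff (F u * G u) l)"
  unfolding coeff_mult by (intro poly_on_lines_sum poly_on_lines_mult assms)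

lemma poly_on_lines_coeff_power:
  assumes "\<And>l. poly_on_lines (\<lambda>u. coeff (F u) l)"
  shows "poly_on_lines (\<lambda>u. coeff (F u ^ k) l)"
proof (induction k arbitrary: l)
  case 0
  then show ?case by auto
next
  case (Suc k)
  then show ?case using poly_on_lines_coeff_mult[OF assms] by simp
qed

text \<open>The conditions \<open>vanishes_along\<close> are coefficients of products of such linear polynomials.\<close>

lemma poly_on_lines_coeff_linear: "poly_on_lines (\<lambda>u. coeff [:u i j, w:] l)"
proof (cases l)
  case 0
  then show ?thesis by auto
next
  case (Suc l')
  then show ?thesis by auto
qed

lemma generic_projective_system_dim:
  assumes "poly3.dim (projective_system d m n u) \<le> r"
  shows "generic (\<lambda>u. poly3.dim (projective_system d m n u) \<le> r)"
  unfolding projective_system_def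
  by (rule generic_kernel_dim[OF finite_monoms, where
        c = "\<lambda>x v. (\<lambda>(i, w, l) a. coeff (\<Prod>j\<in>UNIV.
          [:triple (v i 0) (v i 1) (v i 2) j, w j:] ^ Poly_Mapping.lookup a j) l) x"])
     (use assms in \<open>auto simp: projective_system_def prod_UNIV_3
        intro!: poly_on_lines_coeff_mult poly_on_lines_coeff_power poly_on_lines_coeff_linear\<close>)

lemma forms_negative: "d < 0 \<Longrightarrow> forms d = {0}"
  by (auto simp: polys_on_def monoms_def)

lemma affine_system_subset_projective_system:
  assumes "\<And>i. i < n \<Longrightarrow> v i 2 \<noteq> 0"
  shows "affine_system d m n (\<lambda>i j. v i j / v i 2) \<subseteq> projective_system d m n v"
proof
  fix f assume f: "f \<in> affine_system d m n (\<lambda>i j. v i j / v i 2)"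
  have "vanishes_along m (triple (v i 0) (v i 1) (v i 2)) f" if i: "i < n" for i
  proof (cases "d < 0")
    case True
    hence "f = 0" using f forms_negative by (auto simp: mem_affine_system)
    thus ?thesis by (simp add: vanishes_along_def eval_poly_def)
  next
    case False
    hence "f \<in> forms (int (nat d))" using f by (simp add: mem_affine_system)
    thus ?thesis by (rule vanishes_along_if_taylor) (use f i assms in \<open>auto simp: mem_affine_system\<close>)
  qed
  thus "f \<in> projective_system d m n v" using f by (auto simp: mem_projective_system mem_affine_system)
qed

lemma projective_system_subset_forms_through:
  assumes "\<And>i. i < n \<Longrightarrow> q i = abs_proj_plane (w i) \<and> w i \<noteq> 0"
  shows "projective_system d m n (\<lambda>i j. w i $ (if j = 0 then 1 else if j = 1 then 2 else 3))
    \<subseteq> forms_through d (int m) (q ` {..<n})"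
proof
  let ?v = "\<lambda>i j. w i $ (if j = 0 then 1 else if j = 1 then 2 else (3::3))"
  fix f assume f: "f \<in> projective_system d m n ?v"
  have "vanishes_to_order (int m) (q i) f" if i: "i < n" for i
  proof -
    have 1: "proportional (w i) (w i)"
      using assms[OF i] by (auto simp: proportional_def intro!: exI[of _ 1])
    have "int m \<le> int (mdeg a)"
      if j: "w i $ j \<noteq> 0" and a: "a \<in> Poly_Mapping.keys (local_expansion j (w i) f)" for j a
    proof (cases "d < 0")
      case True
      hence "f = 0" using f forms_negative by (auto simp: mem_projective_system)
      hence "eval_poly (\<lambda>j. [:0, h j:]) (local_expansion j (w i) f) = 0" for h
        by (simp add: local_expansion_def subst3_def eval_poly_def)
      thus ?thesis using a mdeg_ge_iff_ray[of "local_expansion j (w i) f" m] by simp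
    next
      case False
      hence "f \<in> forms (int (nat d))" using f by (simp add: mem_projective_system)
      moreover have "vanishes_along m (($) (w i)) f"
        using f i triple_eta[of "($) (w i)"] by (auto simp: mem_projective_system)
      ultimately show ?thesis using mdeg_local_expansion_ge[of f "nat d" "w i" j m] j a by simp
    qed
    thus ?thesis using assms[OF i] 1 by (simp add: vanishes_to_order.abs_eq)
  qed
  thus "f \<in> forms_through d (int m) (q ` {..<n})"
    using f by (auto simp: forms_through_def homogeneous_iff mem_projective_system)
qed

definition affine_point :: "complex \<Rightarrow> complex \<Rightarrow> proj_plane" where
  "affine_point x y = abs_proj_plane (vec_lambda (triple x y 1))"

lemma proportional_affine: "proportional (vec_lambda (triple x y 1)) (vec_lambda (triple x y 1))"
proof -
  have "(vec_lambda (triple x y 1)) $ 3 \<noteq> 0" by simp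
  hence "(vec_lambda (triple x y 1)) \<noteq> 0" by (metis zero_index)
  thus ?thesis unfolding proportional_def by (metis vector_smult_lid zero_neq_one)
qed

lemma affine_point_inject: "affine_point x y = affine_point x' y' \<Longrightarrow> x = x' \<and> y = y'"
proof -
  assume "affine_point x y = affine_point x' y'"
  hence "proportional (vec_lambda (triple x y 1)) (vec_lambda (triple x' y' 1))"
    unfolding affine_point_def using Quotient_rel[OF Quotient_proj_plane] proportional_affine by blast
  then obtain c where "(vec_lambda (triple x' y' 1)) = c *s (vec_lambda (triple x y 1))"
    unfolding proportional_def by blast
  hence "\<forall>j. triple x' y' 1 j = c * triple x y 1 j" unfolding Finite_Cartesian_Product.vec_eq_iff by simp
  from spec[OF this, of 1] spec[OF this, of 2] spec[OF this, of 3] show "x = x' \<and> y = y'" by simp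
qed

lemma forms_through_subset_affine_system:
  "forms_through d (int m) ((\<lambda>i. affine_point (u i 0) (u i 1)) ` {..<n}) \<subseteq> affine_system d m n u"
proof
  fix f assume f: "f \<in> forms_through d (int m) ((\<lambda>i. affine_point (u i 0) (u i 1)) ` {..<n})"
  hence fd: "f \<in> forms d" by (simp add: forms_through_def homogeneous_iff)
  have "taylor (u i 0) (u i 1) p q f = 0" if i: "i < n" and pq: "p + q < m" for i p q
  proof (cases "d < 0")
    case True
    hence "f = 0" using fd forms_negative by blast
    thus ?thesis by (simp add: taylor_def lin_def)
  next
    case False
    let ?w = "vec_lambda (triple (u i 0) (u i 1) 1)"
    have "vanishes_to_order (int m) (affine_point (u i 0) (u i 1)) f"
      using f i by (auto simp: forms_through_def)
    hence "\<forall>a\<in>Poly_Mapping.keys (local_expansion 3 ?w f). int m \<le> int (mdeg a)"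
      unfolding affine_point_def by (subst (asm) vanishes_to_order.abs_eq) (auto simp: proportional_affine dest!: spec[of _ 3])
    hence L: "monom 1 m dvd eval_poly (\<lambda>j. [:0, w j:]) (local_expansion 3 ?w f)" for w
      using mdeg_ge_iff_ray[of "local_expansion 3 ?w f" m] by simp
    show ?thesis
    proof (rule taylor_eq_0_if_vanishes[OF _ _ pq])
      show "f \<in> forms (int (nat d))" using fd False by simp
      fix a b
      have "eval_poly (triple [:u i 0, a:] [:u i 1, b:] 1) f =
          eval_poly (\<lambda>j. [:0, triple a b 0 j:]) (local_expansion 3 ?w f)"
        by (rule poly_eqI', simp only: poly_eval_poly eval3_local_expansion,
            intro arg_cong[where f = "\<lambda>x. eval3 x f"] ext) (auto simp: triple_def)
      thus "monom 1 m dvd eval_poly (triple [:u i 0, a:] [:u i 1, b:] 1) f" using L by simp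
    qed
  qed
  thus "f \<in> affine_system d m n u" using fd by (simp add: mem_affine_system)
qed

lemma fin_dim_forms_through: "poly3.fin_dim (forms_through d m Q)"
  by (rule poly3.fin_dim_subset[OF fin_dim_polys_on[OF finite_monoms[of d]]])
     (auto simp: forms_through_def homogeneous_iff)

lemma fin_dim_affine_system: "poly3.fin_dim (affine_system d m n u)"
  by (rule poly3.fin_dim_subset[OF fin_dim_polys_on[OF finite_monoms[of d]]])
     (auto simp: mem_affine_system)

lemma fin_dim_projective_system: "poly3.fin_dim (projective_system d m n u)"
  by (rule poly3.fin_dim_subset[OF fin_dim_polys_on[OF finite_monoms[of d]]])
     (auto simp: mem_projective_system)

text \<open>Multiplicities at arbitrary points of the plane are expressed by conditions on homogeneous coordinates. By
  semicontinuity the points can be moved off the line at infinity without making the system larger.\<close>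

lemma exists_affine_system_dim_le:
  "\<exists>u. poly3.dim (affine_system d m n u) \<le> poly3.dim (forms_through d (int m) (q ` {..<n}))"
proof -
  have "\<exists>w. q i = abs_proj_plane w \<and> w \<noteq> 0" for i
  proof (induction "q i" rule: proj_plane.abs_induct)
    case (1 y)
    thus ?case unfolding proportional_def by metis
  qed
  then obtain w where w: "\<And>i. q i = abs_proj_plane (w i) \<and> w i \<noteq> 0" by metis
  let ?v = "\<lambda>i j. w i $ (if j = 0 then 1 else if j = 1 then 2 else (3::3))"
  let ?r = "poly3.dim (forms_through d (int m) (q ` {..<n}))"
  have "poly3.dim (projective_system d m n ?v) \<le> ?r"
    by (rule poly3.dim_mono_fin[OF fin_dim_forms_through projective_system_subset_forms_through]) (rule w)
  from generic_projective_system_dim[OF this]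
  have g1: "generic (\<lambda>u. poly3.dim (projective_system d m n u) \<le> ?r)" .
  have g2: "generic (\<lambda>u. \<forall>i\<in>{..<n}. u i 2 \<noteq> 0)"
    by (rule generic_all) (auto intro!: generic_nonzero[where w = "\<lambda>_ _. 1"])
  obtain v where v: "poly3.dim (projective_system d m n v) \<le> ?r" "\<forall>i\<in>{..<n}. v i 2 \<noteq> 0"
    using generic_conj[OF g1 g2] unfolding generic_def by blast
  have "poly3.dim (affine_system d m n (\<lambda>i j. v i j / v i 2)) \<le> poly3.dim (projective_system d m n v)"
    by (rule poly3.dim_mono_fin[OF fin_dim_projective_system affine_system_subset_projective_system]) (use v in auto)
  thus ?thesis using v(1) by (meson le_trans)
qed

text \<open>Both directions move points by semicontinuity: points that attain the minimum are moved into the affine chart,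
  and points of the affine chart are made distinct. No system is smaller than expected, because
  \<open>n\<close> points of the chart impose at most \<open>n * tri m\<close> conditions and other points are moved there first.\<close>

lemma non_special_iff_affine_system:
  assumes "d \<ge> -1"
  shows "non_special d (int m) n \<longleftrightarrow>
    (\<exists>u. poly3.dim (affine_system d m n u) \<le> tri (nat (d + 1)) - n * tri m)"
proof -
  define Q where "Q r \<longleftrightarrow> (\<exists>q :: nat \<Rightarrow> proj_plane. inj_on q {..<n} \<and>
     r = poly3.dim (forms_through d (int m) (q ` {..<n})))" for r
  define D where "D = tri (nat (d + 1)) - n * tri m"
  have points: "\<exists>r\<le>poly3.dim (affine_system d m n u). Q r"
    if inj: "inj_on (\<lambda>i. u i 0) {..<n}" for u
  proof (intro exI conjI)
    let ?q = "\<lambda>i. affine_point (u i 0) (u i 1)"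
    have "inj_on ?q {..<n}"
      using inj affine_point_inject by (auto simp: inj_on_def)
    thus "Q (poly3.dim (forms_through d (int m) (?q ` {..<n})))" unfolding Q_def by blast
    show "poly3.dim (forms_through d (int m) (?q ` {..<n})) \<le> poly3.dim (affine_system d m n u)"
      by (rule poly3.dim_mono_fin[OF fin_dim_affine_system forms_through_subset_affine_system])
  qed
  have "\<exists>r. Q r" using points[of "\<lambda>i j. of_nat i"] by (auto simp: inj_on_def)
  hence attained: "Q (Least Q)" by (metis LeastI)
  have sys: "system_dim d (int m) n = int (Least Q) - 1"
    by (simp add: system_dim_def Q_def[abs_def])
  have "expected_dim d (int m) n = int D - 1"
  proof -
    have 2: "2 * int (tri k) = int k * (int k + 1)" for k
      using arg_cong[OF two_tri[of k], of int] by (simp add: algebra_simps)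
    have "d * (d + 3) div 2 = int (tri (nat (d + 1))) - 1"
    proof -
      have "d * (d + 3) = 2 * (int (tri (nat (d + 1))) - 1)"
        using assms by (simp add: right_diff_distrib 2 algebra_simps)
      thus ?thesis by simp
    qed
    moreover have "int m * (int m + 1) div 2 = int (tri m)" using 2[of m] by simp
    ultimately have "expected_dim d (int m) n = max (-1) (int (tri (nat (d + 1))) - 1 - int (n * tri m))"
      by (simp add: expected_dim_def virtual_dim_def)
    thus ?thesis unfolding D_def by linarith
  qed
  hence ns: "non_special d (int m) n \<longleftrightarrow> Least Q = D" by (simp add: non_special_def sys)
  obtain q where "Least Q = poly3.dim (forms_through d (int m) (q ` {..<n}))"
    using attained unfolding Q_def by blast
  then obtain u1 where u1: "poly3.dim (affine_system d m n u1) \<le> Least Q"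
    using exists_affine_system_dim_le[of d m n q] by auto
  hence lower: "D \<le> Least Q" using dim_affine_system_ge[of d m n u1] by (simp add: D_def)
  show ?thesis
  proof
    assume "non_special d (int m) n"
    thus "\<exists>u. poly3.dim (affine_system d m n u) \<le> tri (nat (d + 1)) - n * tri m"
      using ns u1 D_def by auto
  next
    assume "\<exists>u. poly3.dim (affine_system d m n u) \<le> tri (nat (d + 1)) - n * tri m"
    then obtain u where "poly3.dim (affine_system d m n u) \<le> D" unfolding D_def by blast
    from generic_affine_system_dim[OF this]
    have g1: "generic (\<lambda>u. poly3.dim (affine_system d m n u) \<le> D)" .
    have g2: "generic (\<lambda>u. \<forall>x\<in>{(i, j). i < n \<and> j < i}. u (fst x) 0 - u (snd x) 0 \<noteq> 0)"
    proof (rule generic_all)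
      show "finite {(i, j). i < n \<and> j < i}"
        by (rule finite_subset[of _ "{..<n} \<times> {..<n}"]) auto
      fix x assume "x \<in> {(i, j). i < n \<and> j < i}"
      thus "generic (\<lambda>u. u (fst x) 0 - u (snd x) 0 \<noteq> 0)"
        by (intro generic_nonzero[where w = "\<lambda>i j. of_nat i"]) auto
    qed
    obtain v where v: "poly3.dim (affine_system d m n v) \<le> D"
      "\<forall>x\<in>{(i, j). i < n \<and> j < i}. v (fst x) 0 - v (snd x) 0 \<noteq> 0"
      using generic_conj[OF g1 g2] unfolding generic_def by blast
    have "inj_on (\<lambda>i. v i 0) {..<n}"
    proof (rule inj_onI, rule ccontr)
      fix i j assume "i \<in> {..<n}" "j \<in> {..<n}" "v i 0 = v j 0" "i \<noteq> j"
      thus False using bspec[OF v(2), of "(i, j)"] bspec[OF v(2), of "(j, i)"] by (cases "j < i") auto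
    qed
    from points[of v, OF this] obtain r where "r \<le> D" "Q r" using v(1) by (meson le_trans)
    hence "Least Q \<le> D" using Least_le[of Q r] by simp
    thus "non_special d (int m) n" using ns lower by simp
  qed
qed

section \<open>Osculation at a generic direction\<close>

text \<open>Choose \<open>e = min r c\<close> members of \<open>K\<close> with independent images under \<open>\<tau>\<close>, where \<open>r\<close> is the rank
  of \<open>\<tau>\<close> on \<open>K\<close>. If \<open>b\<close> is not an inflection point of the space of their images, their span
  meets the subspace of vanishing to order \<open>c\<close> at \<open>b\<close> only in 0.\<close>

lemma generic_osculation_dim:
  fixes \<tau> :: "poly3 \<Rightarrow> complex poly"
  assumes fd: "poly3.fin_dim K" and sub: "poly3.subspace K"
    and add: "\<And>f g. \<tau> (f + g) = \<tau> f + \<tau> g"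
    and scale: "\<And>a f. \<tau> (scale3 a f) = Polynomial.smult a (\<tau> f)"
  shows "finite {b. \<not> poly3.dim {f\<in>K. [:-b, 1:] ^ c dvd \<tau> f}
     \<le> max (poly3.dim {f\<in>K. \<tau> f = 0}) (poly3.dim K - c)}"
proof -
  have functional: "poly3.functional (\<lambda>f. coeff (\<tau> f) l)" for l
    by (simp add: poly3.functional_def add scale)
  have \<tau>0: "\<tau> 0 = 0" using add[of 0 0] by simp
  have \<tau>sum: "\<tau> (\<Sum>i<(n::nat). F i) = (\<Sum>i<n. \<tau> (F i))" for F n
    by (induction n) (simp_all add: \<tau>0 add)
  have ker: "poly3.common_kernel K UNIV (\<lambda>l f. coeff (\<tau> f) l) = {f\<in>K. \<tau> f = 0}"
    by (auto simp: poly3.common_kernel_def poly_eq_iff)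
  obtain r l g where D: "r + poly3.dim (poly3.common_kernel K UNIV (\<lambda>l f. coeff (\<tau> f) l)) = poly3.dim K"
    "\<And>i. i < r \<Longrightarrow> l i \<in> UNIV" "\<And>i. i < r \<Longrightarrow> g i \<in> K"
    "\<And>i j. i < r \<Longrightarrow> j < r \<Longrightarrow> coeff (\<tau> (g j)) (l i) = (if i = j then 1 else (0::complex))"
    by (rule poly3.dual_system[OF fd sub, of UNIV "\<lambda>l f. coeff (\<tau> f) l", OF functional]) (blast intro: that)
  define e where "e = min r c"
  define hs where "hs = map (\<lambda>i. \<tau> (g i)) [0..<e]"
  have lhs: "length hs = e" by (simp add: hs_def)
  have hs: "hs ! i = \<tau> (g i)" if "i < e" for i using that by (simp add: hs_def)
  note dual = poly3.dual_family_independent[of e "\<lambda>l f. coeff (\<tau> f) l" l g, OF functional]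
  have inj: "inj_on g {..<e}" and de: "poly3.dim (poly3.span (g ` {..<e})) = e"
    by (rule dual; use D(4) in \<open>simp add: e_def\<close>)+
  let ?L = "poly3.span (g ` {..<e})"
  let ?bad = "{s. \<exists>x. [:-s, 1:] ^ length hs dvd (\<Sum>i<length hs. Polynomial.smult (x i) (hs ! i)) \<and>
                       (\<Sum>i<length hs. Polynomial.smult (x i) (hs ! i)) \<noteq> 0}"
  have "{b. \<not> poly3.dim {f\<in>K. [:-b, 1:] ^ c dvd \<tau> f}
     \<le> max (poly3.dim {f\<in>K. \<tau> f = 0}) (poly3.dim K - c)} \<subseteq> ?bad"
  proof (rule subsetI, rule ccontr)
    fix b assume b: "b \<in> {b. \<not> poly3.dim {f\<in>K. [:-b, 1:] ^ c dvd \<tau> f}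
     \<le> max (poly3.dim {f\<in>K. \<tau> f = 0}) (poly3.dim K - c)}" and nb: "b \<notin> ?bad"
    let ?C = "{f\<in>K. [:-b, 1:] ^ c dvd \<tau> f}"
    have sC: "poly3.subspace ?C" using sub
      by (auto simp: poly3.subspace_def \<tau>0 add scale dvd_smult)
    have LK: "?L \<subseteq> K" by (rule poly3.span_minimal) (use D(3) sub in \<open>auto simp: e_def\<close>)
    have "?C \<inter> ?L \<subseteq> {0}"
    proof
      fix f assume f: "f \<in> ?C \<inter> ?L"
      have "f \<in> range (\<lambda>u. \<Sum>v\<in>g ` {..<e}. scale3 (u v) v)"
        using f poly3.span_finite[of "g ` {..<e}"] by simp
      then obtain u where "f = (\<Sum>v\<in>g ` {..<e}. scale3 (u v) v)" by (rule rangeE)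
      hence fu: "f = (\<Sum>j<e. scale3 (u (g j)) (g j))" by (simp add: sum.reindex[OF inj])
      hence tf: "\<tau> f = (\<Sum>j<length hs. Polynomial.smult (u (g j)) (hs ! j))"
        by (simp add: \<tau>sum scale lhs hs)
      have "[:-b, 1:] ^ length hs dvd \<tau> f"
        using f le_imp_power_dvd[of e c "[:-b, 1:]"] by (auto simp: lhs e_def intro: dvd_trans)
      hence "\<tau> f \<noteq> 0 \<Longrightarrow> b \<in> ?bad"
        unfolding tf by (intro CollectI exI[of _ "\<lambda>j. u (g j)"] conjI)
      hence "\<tau> f = 0" using nb by blast
      have "u (g j) = 0" if j: "j < e" for j
      proof -
        have "0 = coeff (\<tau> f) (l j)" using \<open>\<tau> f = 0\<close> by simp
        also have "\<dots> = (\<Sum>i<e. if i = j then u (g i) else 0)"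
          unfolding tf lhs coeff_sum using D(4) j by (intro sum.cong) (auto simp: hs e_def)
        also have "\<dots> = u (g j)" using j by simp
        finally show ?thesis by simp
      qed
      thus "f \<in> {0}" using fu by simp
    qed
    hence "poly3.dim (?C \<inter> ?L) = 0" using poly3.dim_le_card[of "?C \<inter> ?L" "{}"] by simp
    moreover have "poly3.dim ?C + poly3.dim ?L \<le> poly3.dim K + poly3.dim (?C \<inter> ?L)"
      by (rule poly3.dim_Int_modular[OF fd sub sC poly3.subspace_span _ LK]) auto
    ultimately have "poly3.dim ?C + e \<le> poly3.dim K" using de by simp
    moreover have "r + poly3.dim {f\<in>K. \<tau> f = 0} = poly3.dim K" using D(1) ker by simp
    ultimately show False using b unfolding e_def by auto
  qed
  moreover have "finite ?bad" by (rule generic_point_not_inflection)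
  ultimately show ?thesis by (rule finite_subset)
qed

section \<open>Taylor coefficients in sheared coordinates\<close>

text \<open>Substituting \<open>(\<xi>, b \<xi> + \<eta>)\<close> for the local coordinates, these are the coefficients of
  \<open>\<xi> ^ p * \<eta> ^ q\<close>.\<close>

definition sheared_taylor_coeff :: "complex \<Rightarrow> complex \<Rightarrow> complex \<Rightarrow> nat \<Rightarrow> nat \<Rightarrow> monom3 \<Rightarrow> complex" where
  "sheared_taylor_coeff x y b p q a =
     (\<Sum>j\<le>p. of_nat ((q + j) choose j) * b ^ j * taylor_coeff x y (p - j) (q + j) a)"

definition sheared_taylor :: "complex \<Rightarrow> complex \<Rightarrow> complex \<Rightarrow> nat \<Rightarrow> nat \<Rightarrow> poly3 \<Rightarrow> complex" where
  "sheared_taylor x y b p q = lin (sheared_taylor_coeff x y b p q)"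

lemma sheared_taylor_eq:
  "sheared_taylor x y b p q f =
     (\<Sum>j\<le>p. of_nat ((q + j) choose j) * b ^ j * taylor x y (p - j) (q + j) f)"
  unfolding sheared_taylor_def sheared_taylor_coeff_def[abs_def] lin_sum lin_mult taylor_def ..

lemma sheared_taylor_eq_0:
  assumes "f \<in> forms (int d)" "d < p + q"
  shows "sheared_taylor x y b p q f = 0"
  unfolding sheared_taylor_eq
  by (intro sum.neutral ballI) (use assms taylor_eq_0 in auto)

lemma sheared_taylor_formula:
  assumes f: "f \<in> forms (int d)" and M: "d \<le> M"
  shows "eval3 (triple (x + \<xi>) (y + b * \<xi> + \<eta>) 1) f =
    (\<Sum>p\<le>M. \<Sum>q\<le>M. sheared_taylor x y b p q f * (\<xi> ^ p * \<eta> ^ q))"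
proof -
  let ?T = "\<lambda>p q. taylor x y p q f"
  let ?U = "{(p, q). p + q \<le> d}"
  have nz: "p + q \<le> d" if "?T p q \<noteq> 0" for p q
    using that taylor_eq_0[OF f, of p q x y] by (meson not_le)
  have nzs: "p + q \<le> d" if "sheared_taylor x y b p q f \<noteq> 0" for p q
    using that sheared_taylor_eq_0[OF f, of p q x y b] by (meson not_le)
  have fin: "finite ?U" by (rule finite_subset[of _ "{..d} \<times> {..d}"]) auto
  have "eval3 (triple (x + \<xi>) (y + b * \<xi> + \<eta>) 1) f = (\<Sum>p\<le>d. \<Sum>q\<le>d. ?T p q * (\<xi> ^ p * (b * \<xi> + \<eta>) ^ q))"
    by (subst homogeneous_taylor_formula[OF f, of _ _ _ x y]) (simp add: add.assoc)
  also have "\<dots> = (\<Sum>(p, q)\<in>{..d} \<times> {..d}. ?T p q * (\<xi> ^ p * (b * \<xi> + \<eta>) ^ q))"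
    by (simp add: sum.cartesian_product)
  also have "\<dots> = (\<Sum>(p, q)\<in>?U. ?T p q * (\<xi> ^ p * (b * \<xi> + \<eta>) ^ q))"
    by (rule sum.mono_neutral_right) (auto intro: nz)
  also have "\<dots> = (\<Sum>(p, q)\<in>?U. \<Sum>j\<le>q. of_nat (q choose j) * b ^ j * ?T p q * (\<xi> ^ (p + j) * \<eta> ^ (q - j)))"
    by (intro sum.cong refl) (auto simp: binomial_ring sum_distrib_left power_mult_distrib power_add mult_ac)
  also have "\<dots> = (\<Sum>((p, q), j)\<in>Sigma ?U (\<lambda>(p, q). {..q}).
       of_nat (q choose j) * b ^ j * ?T p q * (\<xi> ^ (p + j) * \<eta> ^ (q - j)))"
    by (subst sum.Sigma[symmetric]) (use fin in \<open>auto intro!: sum.cong\<close>)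
  also have "\<dots> = (\<Sum>((p, q), j)\<in>Sigma ?U (\<lambda>(p, q). {..p}).
       of_nat ((q + j) choose j) * b ^ j * ?T (p - j) (q + j) * (\<xi> ^ p * \<eta> ^ q))"
    by (rule sum.reindex_bij_witness[where i = "\<lambda>((p, q), j). ((p - j, q + j), j)"
          and j = "\<lambda>((p, q), j). ((p + j, q - j), j)"]) auto
  also have "\<dots> = (\<Sum>(p, q)\<in>?U. \<Sum>j\<le>p. of_nat ((q + j) choose j) * b ^ j * ?T (p - j) (q + j) * (\<xi> ^ p * \<eta> ^ q))"
    by (subst sum.Sigma[symmetric]) (use fin in \<open>auto intro!: sum.cong\<close>)
  also have "\<dots> = (\<Sum>(p, q)\<in>?U. sheared_taylor x y b p q f * (\<xi> ^ p * \<eta> ^ q))"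
    by (intro sum.cong refl) (auto simp: sheared_taylor_eq sum_distrib_right)
  also have "\<dots> = (\<Sum>(p, q)\<in>{..M} \<times> {..M}. sheared_taylor x y b p q f * (\<xi> ^ p * \<eta> ^ q))"
    by (rule sum.mono_neutral_left) (use M in \<open>auto intro: nzs\<close>)
  finally show ?thesis by (simp add: sum.cartesian_product)
qed

text \<open>The exponents of the limit conditions at a centre. There are \<open>tri k + c\<close> of them if \<open>c \<le> k + 1\<close>.\<close>

definition cluster_exponents :: "nat \<Rightarrow> nat \<Rightarrow> (nat \<times> nat) set" where
  "cluster_exponents k c = {(p, q). p + q < k \<or> (p + q = k \<and> q < c)}"

text \<open>The part of degree \<open>k\<close> of the Taylor expansion at \<open>(x, y)\<close>, dehomogenised by \<open>\<xi> = 1\<close>.\<close>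

definition leading_form :: "nat \<Rightarrow> complex \<Rightarrow> complex \<Rightarrow> poly3 \<Rightarrow> complex poly" where
  "leading_form k x y f = (\<Sum>q\<le>k. monom (taylor x y (k - q) q f) q)"

lemma coeff_leading_form:
  "coeff (leading_form k x y f) q = (if q \<le> k then taylor x y (k - q) q f else 0)"
  by (simp add: leading_form_def coeff_sum)

lemma leading_form_add: "leading_form k x y (f + g) = leading_form k x y f + leading_form k x y g"
  using functional_lin by (intro poly_eqI) (simp add: coeff_leading_form taylor_def poly3.functional_def)

lemma leading_form_scale: "leading_form k x y (scale3 a f) = Polynomial.smult a (leading_form k x y f)"
  using functional_lin by (intro poly_eqI) (simp add: coeff_leading_form taylor_def poly3.functional_def)

lemma leading_form_eq_0_iff:
  "leading_form k x y f = 0 \<longleftrightarrow> (\<forall>p q. p + q = k \<longrightarrow> taylor x y p q f = 0)"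
proof
  assume z: "leading_form k x y f = 0"
  show "\<forall>p q. p + q = k \<longrightarrow> taylor x y p q f = 0"
  proof (intro allI impI)
    fix p q assume "p + q = k"
    thus "taylor x y p q f = 0" using coeff_leading_form[of k x y f q] z by auto
  qed
next
  assume "\<forall>p q. p + q = k \<longrightarrow> taylor x y p q f = 0"
  thus "leading_form k x y f = 0" unfolding leading_form_def by (intro sum.neutral) auto
qed

lemma coeff_leading_form_shift:
  assumes "q \<le> k"
  shows "coeff (leading_form k x y f \<circ>\<^sub>p [:b, 1:]) q = sheared_taylor x y b (k - q) q f"
proof -
  have shift: "coeff ([:b, 1:] ^ n) q = of_nat (n choose q) * b ^ (n - q)" for n
    by (cases "q \<le> n") (simp_all add: coeff_linear_poly_power coeff_eq_0 degree_linear_power)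
  have pm: "monom a n \<circ>\<^sub>p r = Polynomial.smult a (r ^ n)" for a :: complex and n r
    by (induction n) (simp_all add: monom_0 monom_Suc pcompose_pCons)
  have bs: "n choose (n - q) = n choose q" if "q \<le> n" for n
    using binomial_symmetric[OF that] by simp
  have "coeff (leading_form k x y f \<circ>\<^sub>p [:b, 1:]) q =
      (\<Sum>n\<le>k. taylor x y (k - n) n f * (of_nat (n choose q) * b ^ (n - q)))"
    unfolding leading_form_def
    by (simp add: pcompose_sum coeff_sum pm shift)
  also have "\<dots> = (\<Sum>n\<in>{q..k}. taylor x y (k - n) n f * (of_nat (n choose q) * b ^ (n - q)))"
    by (rule sum.mono_neutral_right) auto
  also have "\<dots> = (\<Sum>j\<le>k - q. of_nat ((q + j) choose j) * b ^ j * taylor x y (k - q - j) (q + j) f)"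
    by (rule sum.reindex_bij_witness[where i = "\<lambda>j. q + j" and j = "\<lambda>n. n - q"])
       (use assms in \<open>auto simp: bs mult_ac\<close>)
  finally show ?thesis by (simp add: sheared_taylor_eq)
qed

text \<open>The two kinds of coefficients of a fixed order are related by a unitriangular matrix, with respect to \<open>p\<close>.\<close>

lemma sheared_taylor_below_iff:
  "(\<forall>p q. p + q < k \<longrightarrow> sheared_taylor x y b p q f = 0) \<longleftrightarrow> (\<forall>p q. p + q < k \<longrightarrow> taylor x y p q f = 0)"
proof
  assume *: "\<forall>p q. p + q < k \<longrightarrow> sheared_taylor x y b p q f = 0"
  have "p + q < k \<Longrightarrow> taylor x y p q f = 0" for p q
  proof (induction p arbitrary: q rule: less_induct)
    case (less p)
    have "0 = sheared_taylor x y b p q f" using * less.prems by simp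
    also have "\<dots> = (\<Sum>j\<le>p. if j = 0 then taylor x y p q f else 0)"
      unfolding sheared_taylor_eq using less by (intro sum.cong) auto
    finally show ?case by simp
  qed
  thus "\<forall>p q. p + q < k \<longrightarrow> taylor x y p q f = 0" by blast
qed (auto simp: sheared_taylor_eq intro!: sum.neutral)

lemma cluster_conditions_iff:
  assumes c: "c \<le> Suc k"
  shows "(\<forall>(p, q)\<in>cluster_exponents k c. sheared_taylor x y b p q f = 0) \<longleftrightarrow>
    (\<forall>p q. p + q < k \<longrightarrow> taylor x y p q f = 0) \<and> [:-b, 1:] ^ c dvd leading_form k x y f"
proof -
  have "(\<forall>q<c. coeff (leading_form k x y f \<circ>\<^sub>p [:b, 1:]) q = 0) \<longleftrightarrow>
      (\<forall>p q. p + q = k \<and> q < c \<longrightarrow> sheared_taylor x y b p q f = 0)"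
  proof (intro iffI allI impI)
    fix p q assume *: "\<forall>q<c. coeff (leading_form k x y f \<circ>\<^sub>p [:b, 1:]) q = 0" "p + q = k \<and> q < c"
    hence "k - q = p" by auto
    thus "sheared_taylor x y b p q f = 0"
      using * coeff_leading_form_shift[of q k x y f b] by auto
  next
    fix q assume "\<forall>p q. p + q = k \<and> q < c \<longrightarrow> sheared_taylor x y b p q f = 0" "q < c"
    thus "coeff (leading_form k x y f \<circ>\<^sub>p [:b, 1:]) q = 0"
      using coeff_leading_form_shift[of q k x y f b] c by simp
  qed
  thus ?thesis
    using sheared_taylor_below_iff[of k x y b f]
    unfolding power_linear_dvd_iff_coeff cluster_exponents_def by blast
qed

definition cluster_system :: "int \<Rightarrow> nat \<Rightarrow> nat \<Rightarrow> nat \<Rightarrow> configuration \<Rightarrow> poly3 set" where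
  "cluster_system d k c n u =
     poly3.common_kernel (forms d) {(i, p, q). i < n \<and> (p, q) \<in> cluster_exponents k c}
       (\<lambda>x. lin ((\<lambda>(i, p, q). sheared_taylor_coeff (u i 0) (u i 1) (u i 2) p q) x))"

lemma mem_cluster_system:
  assumes "c \<le> Suc k"
  shows "f \<in> cluster_system d k c n u \<longleftrightarrow> f \<in> forms d \<and>
    (\<forall>i<n. (\<forall>p q. p + q < k \<longrightarrow> taylor (u i 0) (u i 1) p q f = 0) \<and>
       [:- u i 2, 1:] ^ c dvd leading_form k (u i 0) (u i 1) f)"
proof -
  have "f \<in> cluster_system d k c n u \<longleftrightarrow> f \<in> forms d \<and>
     (\<forall>i<n. \<forall>(p, q)\<in>cluster_exponents k c. sheared_taylor (u i 0) (u i 1) (u i 2) p q f = 0)"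
    by (auto simp: cluster_system_def poly3.common_kernel_def sheared_taylor_def)
  thus ?thesis unfolding cluster_conditions_iff[OF assms] .
qed

text \<open>The members of the cluster system whose leading form at the centre \<open>s\<close> vanishes. The Boolean in the index separates
  these extra conditions from the others.\<close>

definition marked_cluster_system :: "int \<Rightarrow> nat \<Rightarrow> nat \<Rightarrow> nat \<Rightarrow> nat \<Rightarrow> configuration \<Rightarrow> poly3 set" where
  "marked_cluster_system d k c n s u =
     poly3.common_kernel (forms d)
       ({(False, i, p, q) |i p q. i < n \<and> (p, q) \<in> cluster_exponents k c} \<union> {(True, s, p, q) |p q. p + q = k})
       (\<lambda>x. lin ((\<lambda>(m, i, p, q). if m then taylor_coeff (u i 0) (u i 1) p q
           else sheared_taylor_coeff (u i 0) (u i 1) (u i 2) p q) x))"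

lemma mem_marked_cluster_system:
  "f \<in> marked_cluster_system d k c n s u \<longleftrightarrow>
     f \<in> cluster_system d k c n u \<and> leading_form k (u s 0) (u s 1) f = 0"
proof -
  have 1: "(\<forall>x\<in>{(False, i, p, q) |i p q. P i p q} \<union> {(True, s, p, q) |p q. Q p q}. R x) \<longleftrightarrow>
      (\<forall>i p q. P i p q \<longrightarrow> R (False, i, p, q)) \<and> (\<forall>p q. Q p q \<longrightarrow> R (True, s, p, q))"
    for P :: "nat \<Rightarrow> nat \<Rightarrow> nat \<Rightarrow> bool" and Q :: "nat \<Rightarrow> nat \<Rightarrow> bool" and R
    by blast
  have 2: "(\<forall>x\<in>{(i, p, q). P i p q}. R x) \<longleftrightarrow> (\<forall>i p q. P i p q \<longrightarrow> R (i, p, q))"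
    for P :: "nat \<Rightarrow> nat \<Rightarrow> nat \<Rightarrow> bool" and R
    by blast
  show ?thesis
    unfolding leading_form_eq_0_iff marked_cluster_system_def cluster_system_def
      poly3.common_kernel_def taylor_def mem_Collect_eq 1 2
    by simp
qed

lemma poly_on_lines_sheared_taylor_coeff [intro]:
  assumes "poly_on_lines X" "poly_on_lines Y" "poly_on_lines B"
  shows "poly_on_lines (\<lambda>u. sheared_taylor_coeff (X u) (Y u) (B u) p q a)"
  unfolding sheared_taylor_coeff_def
  by (intro poly_on_lines_sum poly_on_lines_mult poly_on_lines_power poly_on_lines_const
      poly_on_lines_taylor_coeff assms)

lemma generic_cluster_system_dim:
  assumes "poly3.dim (cluster_system d k c n u) \<le> r"
  shows "generic (\<lambda>u. poly3.dim (cluster_system d k c n u) \<le> r)"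
  unfolding cluster_system_def
  by (rule generic_kernel_dim[OF finite_monoms, where
        c = "\<lambda>x u. (\<lambda>(i, p, q). sheared_taylor_coeff (u i 0) (u i 1) (u i 2) p q) x"])
     (use assms in \<open>auto simp: cluster_system_def\<close>)

lemma generic_marked_cluster_system_dim:
  assumes "poly3.dim (marked_cluster_system d k c n s u) \<le> r"
  shows "generic (\<lambda>u. poly3.dim (marked_cluster_system d k c n s u) \<le> r)"
  unfolding marked_cluster_system_def
  by (rule generic_kernel_dim[OF finite_monoms, where
        c = "\<lambda>x u. (\<lambda>(m, i, p, q). if m then taylor_coeff (u i 0) (u i 1) p q
           else sheared_taylor_coeff (u i 0) (u i 1) (u i 2) p q) x"])
     (use assms in \<open>auto simp: marked_cluster_system_def
        intro!: poly_on_lines_sheared_taylor_coeff poly_on_lines_taylor_coeff\<close>)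

section \<open>Forms with collided clusters at generic points\<close>

lemma subspace_leading_form_dvd: "poly3.subspace {f. r dvd leading_form k x y f}"
proof -
  have "leading_form k x y 0 = 0" using leading_form_scale[of k x y 0 0] by simp
  thus ?thesis
    by (auto simp: poly3.subspace_def leading_form_add leading_form_scale dvd_smult)
qed

lemma subspace_affine_system: "poly3.subspace (affine_system d m n u)"
  unfolding affine_system_def by (rule poly3.subspace_common_kernel[OF subspace_polys_on functional_lin])

lemma subspace_cluster_system: "poly3.subspace (cluster_system d k c n u)"
  unfolding cluster_system_def by (rule poly3.subspace_common_kernel[OF subspace_polys_on functional_lin])

lemma subspace_marked_cluster_system: "poly3.subspace (marked_cluster_system d k c n s u)"
  unfolding marked_cluster_system_def by (rule poly3.subspace_common_kernel[OF subspace_polys_on functional_lin])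

lemma fin_dim_cluster_system: "poly3.fin_dim (cluster_system d k c n u)"
  by (rule poly3.fin_dim_subset[OF fin_dim_polys_on[OF finite_monoms[of d]]])
     (auto simp: cluster_system_def poly3.common_kernel_def)

text \<open>In unsheared coordinates the limit conditions are some of the conditions for multiplicity \<open>k + 1\<close>. A subset of a set of
  independent conditions is independent.\<close>

lemma cluster_system_dim_independent:
  assumes c: "c \<le> Suc k"
    and u: "poly3.dim (affine_system d (Suc k) n u) + n * tri (Suc k) \<le> D"
  shows "\<exists>u. poly3.dim (cluster_system d k c n u) + n * (tri k + c) \<le> D"
proof -
  define v where "v = (\<lambda>i j. if j = 2 then 0 else u i j)"
  let ?A = "{..<n} \<times> (\<lambda>q. (k - q, q)) ` {c..k}"
  let ?X = "cluster_system d k c n v"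
  let ?l = "\<lambda>x. lin ((\<lambda>(i, p, q). taylor_coeff (v i 0) (v i 1) p q) x)"
  have X: "f \<in> ?X \<longleftrightarrow> f \<in> forms d \<and> (\<forall>i<n. (\<forall>p q. p + q < k \<longrightarrow> taylor (u i 0) (u i 1) p q f = 0) \<and>
       (\<forall>q<c. taylor (u i 0) (u i 1) (k - q) q f = 0))" for f
  proof -
    have "[:0, 1:] ^ c dvd leading_form k x y f \<longleftrightarrow> (\<forall>q<c. taylor x y (k - q) q f = 0)" for x y
      using power_linear_dvd_iff_coeff[of 0 c "leading_form k x y f"] c
      by (auto simp: coeff_leading_form)
    thus ?thesis unfolding mem_cluster_system[OF c] by (simp add: v_def)
  qed
  have sub: "poly3.common_kernel ?X ?A ?l \<subseteq> affine_system d (Suc k) n u"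
  proof
    fix f assume f: "f \<in> poly3.common_kernel ?X ?A ?l"
    have "taylor (u i 0) (u i 1) p q f = 0" if i: "i < n" and pq: "p + q < Suc k" for i p q
    proof -
      consider "p + q < k" | "p = k - q" "q < c" | "p = k - q" "c \<le> q" "q \<le> k" using pq by linarith
      thus ?thesis
      proof cases
        case 3
        hence "(i, p, q) \<in> ?A" using i by auto
        hence "?l (i, p, q) f = 0" using f unfolding poly3.common_kernel_def by blast
        thus ?thesis by (simp add: v_def taylor_def)
      qed (use f i X in \<open>auto simp: poly3.common_kernel_def\<close>)
    qed
    thus "f \<in> affine_system d (Suc k) n u" using f X by (auto simp: mem_affine_system poly3.common_kernel_def)
  qed
  have cA: "card ?A = n * (Suc k - c)"
    by (subst card_cartesian_product, subst card_image) (auto simp: inj_on_def)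
  have "poly3.dim ?X \<le> poly3.dim (poly3.common_kernel ?X ?A ?l) + card ?A"
    by (rule poly3.dim_common_kernel_ge[OF _ fin_dim_cluster_system subspace_cluster_system functional_lin]) auto
  also have "poly3.dim (poly3.common_kernel ?X ?A ?l) \<le> poly3.dim (affine_system d (Suc k) n u)"
    by (rule poly3.dim_mono_fin[OF fin_dim_affine_system sub])
  finally have "poly3.dim ?X \<le> poly3.dim (affine_system d (Suc k) n u) + n * (Suc k - c)" by (simp add: cA)
  moreover have "n * tri (Suc k) = n * (tri k + c) + n * (Suc k - c)"
    using c by (simp add: tri_Suc flip: add_mult_distrib2)
  ultimately have "poly3.dim ?X + n * (tri k + c) \<le> D" using u by linarith
  thus ?thesis by blast
qed

lemma generic_least_dim:
  assumes "\<And>u r. poly3.dim (S u) \<le> r \<Longrightarrow> generic (\<lambda>u. poly3.dim (S u) \<le> r)"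
  shows "generic (\<lambda>u. \<forall>v. poly3.dim (S u) \<le> poly3.dim (S v))"
proof -
  define r where "r = (LEAST r. \<exists>u. poly3.dim (S u) = r)"
  have "\<exists>u. poly3.dim (S u) = r" unfolding r_def by (rule LeastI_ex) blast
  then obtain w where w: "poly3.dim (S w) = r" by blast
  have "r \<le> poly3.dim (S v)" for v unfolding r_def by (rule Least_le) blast
  hence "(\<forall>v. poly3.dim (S u) \<le> poly3.dim (S v)) \<longleftrightarrow> poly3.dim (S u) \<le> r" for u
    using w by (meson le_trans)
  thus ?thesis using assms[of w r] w by simp
qed

text \<open>At a configuration for which all the dimensions involved are minimal, compare the cluster system \<open>X\<close> with the
  marked systems \<open>Y s\<close>. Permuting the centres shows that the \<open>Y s\<close> have the same dimension. If this
  is the dimension of \<open>X\<close>, members of \<open>X\<close> have multiplicity \<open>k + 1\<close> at all centres. If it is smaller,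
  release the \<open>c\<close> conditions on the leading form at the centre \<open>i\<close>, obtaining \<open>K i\<close>, and impose
  them again in a generic direction: the result cannot be \<open>Y i\<close>, which is too small, so it has
  codimension \<open>c\<close> in \<open>K i\<close>. Hence every group of \<open>c\<close> conditions is independent of all the others.\<close>

lemma cluster_system_dim_dependent:
  assumes c: "c \<le> Suc k"
    and u0: "poly3.dim (affine_system d (Suc k) n u0) = 0"
    and w0: "poly3.dim (affine_system d k n w0) + n * tri k \<le> D"
  shows "\<exists>u. poly3.dim (cluster_system d k c n u) = 0 \<or>
      poly3.dim (cluster_system d k c n u) + n * (tri k + c) \<le> D"
proof -
  let ?X = "cluster_system d k c n"
  let ?Y = "marked_cluster_system d k c n"
  have g1: "generic (\<lambda>u. \<forall>v. poly3.dim (?X u) \<le> poly3.dim (?X v))"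
    by (rule generic_least_dim) (rule generic_cluster_system_dim)
  have g2: "generic (\<lambda>u. \<forall>s\<in>{..<n}. \<forall>v. poly3.dim (?Y s u) \<le> poly3.dim (?Y s v))"
    by (rule generic_all) (auto intro!: generic_least_dim generic_marked_cluster_system_dim)
  have g3: "generic (\<lambda>u. poly3.dim (affine_system d (Suc k) n u) \<le> 0)"
    by (rule generic_affine_system_dim[of _ _ _ u0]) (simp add: u0)
  have g4: "generic (\<lambda>u. poly3.dim (affine_system d k n u) \<le> D - n * tri k)"
    by (rule generic_affine_system_dim[of _ _ _ w0]) (use w0 in linarith)
  obtain u where *: "((\<forall>v. poly3.dim (?X u) \<le> poly3.dim (?X v)) \<and>
      (\<forall>s\<in>{..<n}. \<forall>v. poly3.dim (?Y s u) \<le> poly3.dim (?Y s v))) \<and>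
      poly3.dim (affine_system d (Suc k) n u) \<le> 0 \<and>
      poly3.dim (affine_system d k n u) \<le> D - n * tri k"
    using generic_ex[OF generic_conj[OF generic_conj[OF g1 g2] generic_conj[OF g3 g4]]] by (rule exE)
  have u: "\<And>v. poly3.dim (?X u) \<le> poly3.dim (?X v)"
    "\<And>s v. s < n \<Longrightarrow> poly3.dim (?Y s u) \<le> poly3.dim (?Y s v)"
    "poly3.dim (affine_system d (Suc k) n u) = 0"
    "poly3.dim (affine_system d k n u) \<le> D - n * tri k"
    using * by auto
  let ?lead = "\<lambda>i. leading_form k (u i 0) (u i 1)"
  let ?dvd = "\<lambda>i f. [:- u i 2, 1:] ^ c dvd ?lead i f"
  have memX: "f \<in> ?X u \<longleftrightarrow> f \<in> affine_system d k n u \<and> (\<forall>i<n. ?dvd i f)" for f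
    unfolding mem_cluster_system[OF c] mem_affine_system by blast
  have YX: "?Y s u \<subseteq> ?X u" for s by (auto simp: mem_marked_cluster_system)
  have symmetric: "poly3.dim (?Y s u) \<le> poly3.dim (?Y s' u)" if s: "s < n" "s' < n" for s s'
  proof -
    define \<pi> where "\<pi> i = (if i = s then s' else if i = s' then s else i)" for i
    have \<pi>: "\<pi> i < n \<longleftrightarrow> i < n" "\<pi> (\<pi> i) = i" for i using s by (auto simp: \<pi>_def)
    have all: "(\<forall>i<n. P (\<pi> i)) \<longleftrightarrow> (\<forall>i<n. P i)" for P using \<pi> by metis
    have "?Y s (\<lambda>i. u (\<pi> i)) = ?Y (\<pi> s) u"
      unfolding set_eq_iff mem_marked_cluster_system mem_cluster_system[OF c]
      using all[of "\<lambda>i. (\<forall>p q. p + q < k \<longrightarrow> taylor (u i 0) (u i 1) p q _ = 0) \<and>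
       [:- u i 2, 1:] ^ c dvd leading_form k (u i 0) (u i 1) _"] by simp
    thus ?thesis using u(2)[OF s(1), of "\<lambda>i. u (\<pi> i)"] by (simp add: \<pi>_def)
  qed
  show ?thesis
  proof (cases "\<exists>s<n. poly3.dim (?X u) \<le> poly3.dim (?Y s u)")
    case True
    have "?X u \<subseteq> affine_system d (Suc k) n u"
    proof
      fix f assume f: "f \<in> ?X u"
      have "?lead s f = 0" if s: "s < n" for s
      proof -
        have "poly3.dim (?X u) \<le> poly3.dim (?Y s u)" using True symmetric s by (meson le_trans)
        hence "?Y s u = ?X u"
          by (rule poly3.subspace_eq_if_dim_ge[OF fin_dim_cluster_system subspace_marked_cluster_system YX])
        thus ?thesis using f mem_marked_cluster_system by blast
      qed
      hence "taylor (u s 0) (u s 1) p q f = 0" if "s < n" "p + q < Suc k" for s p q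
        using that f less_Suc_eq[of "p + q" k]
        unfolding mem_cluster_system[OF c] leading_form_eq_0_iff by auto
      thus "f \<in> affine_system d (Suc k) n u"
        using f unfolding mem_cluster_system[OF c] mem_affine_system by blast
    qed
    hence "poly3.dim (?X u) \<le> 0" using poly3.dim_mono_fin[OF fin_dim_affine_system] u(3) by metis
    thus ?thesis by auto
  next
    case False
    define K where "K i = {f \<in> affine_system d k n u. \<forall>j<n. j \<noteq> i \<longrightarrow> ?dvd j f}" for i
    define Z where "Z i = {f \<in> affine_system d k n u. \<forall>j<i. ?dvd j f}" for i
    have sub_dvd: "poly3.subspace {f \<in> affine_system d k n u. \<forall>j\<in>J. ?dvd j f}" for J
      using subspace_affine_system[of d k n u] subspace_leading_form_dvd[of "[:- u _ 2, 1:] ^ c" k "u _ 0" "u _ 1"]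
      unfolding poly3.subspace_def by auto
    have sK: "poly3.subspace (K i)" for i
      using sub_dvd[of "{j. j < n \<and> j \<noteq> i}"] by (simp add: K_def imp_conjL)
    have sZ: "poly3.subspace (Z i)" for i
      using sub_dvd[of "{j. j < i}"] by (simp add: Z_def)
    have fK: "poly3.fin_dim (K i)" for i
      by (rule poly3.fin_dim_subset[OF fin_dim_affine_system]) (auto simp: K_def)
    have fZ: "poly3.fin_dim (Z i)" for i
      by (rule poly3.fin_dim_subset[OF fin_dim_affine_system]) (auto simp: Z_def)
    have dimK: "poly3.dim (?X u) + c \<le> poly3.dim (K i)" if i: "i < n" for i
    proof -
      have "finite {b. \<not> poly3.dim {f\<in>K i. [:-b, 1:] ^ c dvd ?lead i f}
           \<le> max (poly3.dim {f\<in>K i. ?lead i f = 0}) (poly3.dim (K i) - c)}" (is "finite ?B")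
        by (rule generic_osculation_dim[OF fK sK leading_form_add leading_form_scale])
      then obtain b where "b \<notin> ?B" using ex_new_if_finite[OF infinite_UNIV_char_0] by blast
      hence b: "poly3.dim {f\<in>K i. [:-b, 1:] ^ c dvd ?lead i f}
           \<le> max (poly3.dim {f\<in>K i. ?lead i f = 0}) (poly3.dim (K i) - c)" by simp
      define v where "v = (\<lambda>j l. if j = i \<and> l = 2 then b else u j l)"
      have "{f\<in>K i. [:-b, 1:] ^ c dvd ?lead i f} = ?X v"
        unfolding set_eq_iff mem_cluster_system[OF c] mem_affine_system K_def
        using i by (auto simp: v_def)
      moreover have "{f\<in>K i. ?lead i f = 0} = ?Y i u"
        unfolding set_eq_iff mem_marked_cluster_system memX K_def mem_Collect_eq by (metis dvd_0_right)
      moreover have "poly3.dim (?Y i u) < poly3.dim (?X u)" using False i by auto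
      ultimately show ?thesis using b u(1)[of v] by auto
    qed
    \<comment> \<open>Conditions independent of all other groups are independent of the preceding groups.\<close>
    have step: "poly3.dim (Z (Suc i)) + c \<le> poly3.dim (Z i)" if i: "i < n" for i
    proof -
      have "poly3.dim (K i) + poly3.dim (Z (Suc i)) \<le> poly3.dim (Z i) + poly3.dim (K i \<inter> Z (Suc i))"
        by (rule poly3.dim_Int_modular[OF fZ sZ sK sZ]) (use i in \<open>auto simp: K_def Z_def\<close>)
      moreover have "K i \<inter> Z (Suc i) = ?X u"
        unfolding set_eq_iff Int_iff memX K_def Z_def mem_Collect_eq using i by (auto simp: less_Suc_eq)
      ultimately show ?thesis using dimK[OF i] by simp
    qed
    have "i \<le> n \<Longrightarrow> poly3.dim (Z i) + i * c \<le> poly3.dim (Z 0)" for i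
    proof (induction i)
      case (Suc i)
      thus ?case using step[of i] by simp
    qed simp
    hence "poly3.dim (Z n) + n * c \<le> poly3.dim (Z 0)" by blast
    moreover have "Z n = ?X u" unfolding set_eq_iff memX Z_def by simp
    moreover have "Z 0 = affine_system d k n u" by (simp add: Z_def)
    ultimately have "poly3.dim (?X u) + n * c \<le> D - n * tri k" using u(4) by simp
    moreover have "n * tri k \<le> D" using w0 by simp
    ultimately have "poly3.dim (?X u) + n * (tri k + c) \<le> D" by (simp add: add_mult_distrib2)
    thus ?thesis by blast
  qed
qed

lemma cluster_system_expected_dim:
  assumes c: "c \<le> Suc k"
    and k: "poly3.dim (affine_system d k n u1) \<le> D - n * tri k"
    and Suc_k: "poly3.dim (affine_system d (Suc k) n u2) \<le> D - n * tri (Suc k)"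
  shows "\<exists>u. poly3.dim (cluster_system d k c n u) \<le> D - n * (tri k + c)"
proof -
  consider "n * tri (Suc k) \<le> D" | "D \<le> n * tri k" | "n * tri k \<le> D" "D \<le> n * tri (Suc k)" by linarith
  thus ?thesis
  proof cases
    case 1
    hence "poly3.dim (affine_system d (Suc k) n u2) + n * tri (Suc k) \<le> D" using Suc_k by linarith
    from cluster_system_dim_independent[OF c this] show ?thesis by (metis add_le_imp_le_diff)
  next
    case 2
    have "cluster_system d k c n u1 \<subseteq> affine_system d k n u1"
      unfolding subset_iff mem_cluster_system[OF c] mem_affine_system by blast
    hence "poly3.dim (cluster_system d k c n u1) \<le> poly3.dim (affine_system d k n u1)"
      by (rule poly3.dim_mono_fin[OF fin_dim_affine_system])
    thus ?thesis using 2 k by (intro exI[of _ u1]) simp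
  next
    case 3
    have "poly3.dim (affine_system d (Suc k) n u2) = 0" using Suc_k 3 by simp
    moreover have "poly3.dim (affine_system d k n u1) + n * tri k \<le> D" using k 3 by linarith
    ultimately show ?thesis
      using cluster_system_dim_dependent[OF c, of d n u2 u1 D] by (metis add_le_imp_le_diff zero_le)
  qed
qed

section \<open>A template for the points of one cluster\<close>

lemma vanishing_on_affine_lines:
  assumes f: "f \<in> forms (int d)" and T: "\<And>p q. p + q < m \<Longrightarrow> taylor x y p q f = 0"
  shows "monom 1 m dvd eval_poly (triple [:x, a:] [:y, b:] 1) f"
proof -
  have "vanishes_along m (triple x y 1) f"
    by (rule vanishes_along_if_taylor[OF f]) (use T in auto)
  hence "monom 1 m dvd eval_poly (\<lambda>j. [:triple x y 1 j, triple a b 0 j:]) f"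
    unfolding vanishes_along_def by (rule spec)
  moreover have "(\<lambda>j. [:triple x y 1 j, triple a b 0 j:]) = triple [:x, a:] [:y, b:] 1"
    unfolding triple_def one_pCons by (rule ext) simp
  ultimately show ?thesis by simp
qed

lemma eq_0_if_dim_0:
  assumes "poly3.fin_dim V" "poly3.dim V = 0" "f \<in> V"
  shows "f = 0"
proof (rule ccontr)
  assume "f \<noteq> 0"
  hence "poly3.independent {f}" by simp
  from poly3.independent_le_dim[OF assms(1) this] show False using assms by simp
qed

lemma eq_0_if_eval3_0:
  assumes "\<And>x. eval3 x f = 0"
  shows "f = 0"
proof -
  have "Poly_Mapping.lookup f a = 0" if "a \<in> Poly_Mapping.keys f" for a
    by (rule coeffs_zero_if_vanishing[of "Poly_Mapping.keys f"])
       (use assms that in \<open>auto simp: eval3_def lin_def\<close>)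
  thus ?thesis by (metis in_keys_iff keys_eq_empty equals0I)
qed

text \<open>The form \<open>g (x + b * y, y, z)\<close>, expanded by the binomial theorem.\<close>

definition shear_form :: "complex \<Rightarrow> poly3 \<Rightarrow> poly3" where
  "shear_form b g = (\<Sum>a\<in>Poly_Mapping.keys g. \<Sum>j\<le>Poly_Mapping.lookup a 1.
     Poly_Mapping.single (mon (Poly_Mapping.lookup a 1 - j) (Poly_Mapping.lookup a 2 + j) (Poly_Mapping.lookup a 3))
       (Poly_Mapping.lookup g a * of_nat (Poly_Mapping.lookup a 1 choose j) * b ^ j))"

lemma polys_on_sum: "(\<And>i. i \<in> I \<Longrightarrow> F i \<in> polys_on M) \<Longrightarrow> (\<Sum>i\<in>I. F i) \<in> polys_on M"
  by (rule poly3.subspace_sum[OF subspace_polys_on])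

lemma shear_form_in_forms: "g \<in> forms d \<Longrightarrow> shear_form b g \<in> forms d"
  unfolding shear_form_def by (intro polys_on_sum) (auto simp: polys_on_def monoms_def mdeg_eq)

lemma eval3_shear_form: "eval3 (triple X Y Z) (shear_form b g) = eval3 (triple (X + b * Y) Y Z) g"
proof -
  have "eval3 (triple X Y Z) (shear_form b g) = (\<Sum>a\<in>Poly_Mapping.keys g. Poly_Mapping.lookup g a *
      ((b * Y + X) ^ Poly_Mapping.lookup a 1 * Y ^ Poly_Mapping.lookup a 2 * Z ^ Poly_Mapping.lookup a 3))"
    unfolding shear_form_def eval3_sum eval3_single prod_UNIV_3 binomial_ring
    by (intro sum.cong refl)
       (simp add: sum_distrib_left sum_distrib_right power_add power_mult_distrib mult_ac)
  thus ?thesis by (simp add: eval3_def lin_def prod_UNIV_3 add.commute)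
qed

text \<open>The part of highest degree in the affine coordinates, as a polynomial in \<open>x\<close> with \<open>y = 1\<close>.\<close>

definition top_form :: "poly3 \<Rightarrow> complex poly" where
  "top_form = eval_poly (triple [:0, 1:] 1 0)"

lemma poly_top_form: "poly (top_form f) s = eval3 (triple s 1 0) f"
  unfolding top_form_def poly_eval_poly
  by (intro arg_cong[where f = "\<lambda>x. eval3 x f"] ext) (auto simp: triple_def)

lemma top_form_add: "top_form (f + g) = top_form f + top_form g"
  by (rule poly_eqI') (simp add: poly_top_form eval3_add)

lemma top_form_scale: "top_form (scale3 a f) = Polynomial.smult a (top_form f)"
  by (rule poly_eqI') (simp add: poly_top_form eval3_def poly3.functional_scale[OF functional_lin])

lemma lookup_eq_0_if_top_form_0:
  assumes f: "f \<in> forms d" and z: "top_form f = 0" and a: "Poly_Mapping.lookup a (3::3) = 0"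
  shows "Poly_Mapping.lookup f a = 0"
proof (cases "a \<in> monoms d")
  case False
  thus ?thesis using f by (auto simp: polys_on_def in_keys_iff)
next
  case True
  have "0 = coeff (top_form f) (Poly_Mapping.lookup a 1)" using z by simp
  also have "\<dots> = lin (\<lambda>e. if e = a then 1 else 0) f"
    unfolding top_form_def coeff_eval_poly
  proof (rule lin_cong)
    fix e assume "e \<in> Poly_Mapping.keys f"
    hence e: "e \<in> monoms d" using f by (auto simp: polys_on_def)
    have X: "[:0, 1:] ^ n = (monom 1 n :: complex poly)" for n
      using monom_power[of "1::complex" 1 n] by (simp add: monom_Suc monom_0)
    have "e = a" if "Poly_Mapping.lookup e 3 = 0" "Poly_Mapping.lookup e 1 = Poly_Mapping.lookup a 1"
      by (rule monom3_eqI) (use that a e True in \<open>auto simp: monoms_def mdeg_eq\<close>)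
    thus "coeff (\<Prod>j\<in>UNIV. triple [:0, 1:] 1 0 j ^ Poly_Mapping.lookup e j) (Poly_Mapping.lookup a 1)
        = (if e = a then 1 else 0 :: complex)"
      using a by (auto simp: prod_UNIV_3 X power_0_left)
  qed
  also have "\<dots> = (\<Sum>e\<in>Poly_Mapping.keys f. if e = a then Poly_Mapping.lookup f e else 0)"
    unfolding lin_def by (intro sum.cong) auto
  also have "\<dots> = Poly_Mapping.lookup f a" by (simp add: in_keys_iff)
  finally show ?thesis by simp
qed

text \<open>A form of degree \<open>k\<close> without terms of degree \<open>k\<close> in the affine coordinates is \<open>z\<close> times a form of
  degree \<open>k - 1\<close> with the same Taylor coefficients.\<close>

lemma top_form_injective:
  assumes f: "f \<in> affine_system k m n u" and z: "top_form f = 0"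
    and low: "poly3.dim (affine_system (k - 1) m n u) = 0"
  shows "f = 0"
proof -
  have fk: "f \<in> forms k" using f by (simp add: mem_affine_system)
  define up where "up a = a + Poly_Mapping.single (3::3) (1::nat)" for a :: monom3
  have up: "Poly_Mapping.lookup (up a) 1 = Poly_Mapping.lookup a 1" "Poly_Mapping.lookup (up a) 2 = Poly_Mapping.lookup a 2"
    "Poly_Mapping.lookup (up a) 3 = Suc (Poly_Mapping.lookup a 3)" for a
    by (simp_all add: up_def lookup_add lookup_single)
  have inj: "inj_on up A" for A by (simp add: up_def inj_on_def)
  define g where "g = (\<Sum>a\<in>monoms (k - 1). Poly_Mapping.single a (Poly_Mapping.lookup f (up a)))"
  have gk: "g \<in> forms (k - 1)"
    unfolding g_def by (intro polys_on_sum) (auto simp: polys_on_def)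
  have image: "up ` monoms (k - 1) = {a\<in>monoms k. Poly_Mapping.lookup a 3 \<noteq> 0}"
  proof (intro equalityI subsetI)
    fix a assume "a \<in> {a\<in>monoms k. Poly_Mapping.lookup a 3 \<noteq> 0}"
    hence a: "a \<in> monoms k" "Poly_Mapping.lookup a 3 \<noteq> 0" by auto
    have "a = up (mon (Poly_Mapping.lookup a 1) (Poly_Mapping.lookup a 2) (Poly_Mapping.lookup a 3 - 1))"
      by (rule monom3_eqI) (use a in \<open>auto simp: up\<close>)
    thus "a \<in> up ` monoms (k - 1)"
      by (rule image_eqI) (use a in \<open>auto simp: monoms_def mdeg_eq\<close>)
  qed (auto simp: monoms_def mdeg_eq up)
  have lin: "lin c f = lin c g" if "\<And>a. c (up a) = c a" for c
  proof -
    have "lin c f = (\<Sum>a\<in>monoms k. Poly_Mapping.lookup f a * c a)"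
      by (rule lin_superset[OF finite_monoms]) (use fk in \<open>simp add: polys_on_def\<close>)
    also have "\<dots> = (\<Sum>a\<in>up ` monoms (k - 1). Poly_Mapping.lookup f a * c a)"
      unfolding image by (rule sum.mono_neutral_right)
        (use finite_monoms lookup_eq_0_if_top_form_0[OF fk z] in auto)
    also have "\<dots> = (\<Sum>a\<in>monoms (k - 1). Poly_Mapping.lookup f (up a) * c a)"
      by (subst sum.reindex[OF inj]) (simp add: that)
    also have "\<dots> = lin c g"
      unfolding g_def poly3.functional_sum[OF functional_lin] by simp
    finally show ?thesis .
  qed
  have "taylor x y p q f = taylor x y p q g" for x y p q
    unfolding taylor_def by (rule lin) (simp add: taylor_coeff_def up)
  hence "g \<in> affine_system (k - 1) m n u" using f gk by (simp add: mem_affine_system)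
  hence "g = 0" using eq_0_if_dim_0[OF fin_dim_affine_system low] by blast
  have "Poly_Mapping.lookup f a = 0" for a
  proof (cases "a \<in> up ` monoms (k - 1)")
    case True
    then obtain a' where a': "a = up a'" "a' \<in> monoms (k - 1)" by blast
    have "Poly_Mapping.lookup g a' = (\<Sum>e\<in>monoms (k - 1). if e = a' then Poly_Mapping.lookup f (up e) else 0)"
      unfolding g_def lookup_sum by (intro sum.cong) (auto simp: lookup_single when_def)
    also have "\<dots> = Poly_Mapping.lookup f a" using a' finite_monoms by simp
    finally show ?thesis using \<open>g = 0\<close> by simp
  next
    case False
    show ?thesis
    proof (cases "a \<in> monoms k")
      case True
      thus ?thesis using False lookup_eq_0_if_top_form_0[OF fk z] unfolding image by auto
    next
      case False
      thus ?thesis using fk by (auto simp: polys_on_def in_keys_iff)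
    qed
  qed
  thus ?thesis by (intro poly_mapping_eqI) simp
qed

text \<open>The forms on these monomials are homogenised affine polynomials with exponents in
  \<open>cluster_exponents\<close>.\<close>

definition cluster_monoms :: "nat \<Rightarrow> nat \<Rightarrow> monom3 set" where
  "cluster_monoms k c =
     {a\<in>monoms (int k). (Poly_Mapping.lookup a 1, Poly_Mapping.lookup a 2) \<in> cluster_exponents k c}"

text \<open>The forms of degree \<open>k\<close> with multiplicity \<open>m\<close> at \<open>n\<close> general points make up a space of dimension at most
  \<open>k + 1 - c\<close>, and they are determined by their top forms. A form on the cluster monomials has a top form
  divisible by the \<open>(k + 1 - c)\<close>-th power of \<open>x\<close>. After the change of coordinates that replaces \<open>x\<close> by
  \<open>x - b y\<close>, it would provide a member of the space whose top form vanishes to order \<open>k + 1 - c\<close> at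
  \<open>b\<close>, which is impossible for generic \<open>b\<close>.\<close>

lemma exists_template:
  assumes c: "n * tri m = tri k + c" "c \<le> Suc k"
    and low: "poly3.dim (affine_system (int k - 1) m n u1) = 0"
    and high: "poly3.dim (affine_system (int k) m n u2) \<le> Suc k - c"
  shows "\<exists>y :: configuration. \<forall>g\<in>polys_on (cluster_monoms k c).
    (\<forall>j<n. \<forall>p q. p + q < m \<longrightarrow> taylor (y j 0) (y j 1) p q g = 0) \<longrightarrow> g = 0"
proof -
  have g1: "generic (\<lambda>u. poly3.dim (affine_system (int k - 1) m n u) \<le> 0)"
    by (rule generic_affine_system_dim[of _ _ _ u1]) (simp add: low)
  have g2: "generic (\<lambda>u. poly3.dim (affine_system (int k) m n u) \<le> Suc k - c)"
    by (rule generic_affine_system_dim[OF high])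
  obtain u where *: "poly3.dim (affine_system (int k - 1) m n u) \<le> 0 \<and>
      poly3.dim (affine_system (int k) m n u) \<le> Suc k - c"
    using generic_ex[OF generic_conj[OF g1 g2]] by (rule exE)
  let ?K = "affine_system (int k) m n u"
  have inj: "f = 0" if "f \<in> ?K" "top_form f = 0" for f
    using top_form_injective[OF that] * by simp
  have "finite {b. \<not> poly3.dim {f\<in>?K. [:-b, 1:] ^ (Suc k - c) dvd top_form f}
     \<le> max (poly3.dim {f\<in>?K. top_form f = 0}) (poly3.dim ?K - (Suc k - c))}" (is "finite ?B")
    by (rule generic_osculation_dim[OF fin_dim_affine_system subspace_affine_system top_form_add top_form_scale])
  then obtain b where "b \<notin> ?B" using ex_new_if_finite[OF infinite_UNIV_char_0] by blast
  hence b: "poly3.dim {f\<in>?K. [:-b, 1:] ^ (Suc k - c) dvd top_form f}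
     \<le> max (poly3.dim {f\<in>?K. top_form f = 0}) (poly3.dim ?K - (Suc k - c))" by simp
  have "{f\<in>?K. top_form f = 0} \<subseteq> {0}" using inj by blast
  hence "poly3.dim {f\<in>?K. top_form f = 0} = 0"
    using poly3.dim_le_card[of "{f\<in>?K. top_form f = 0}" "{}"] by simp
  hence d0: "poly3.dim {f\<in>?K. [:-b, 1:] ^ (Suc k - c) dvd top_form f} = 0" using b * by simp
  define y where "y = (\<lambda>j (l::nat). if l = 0 then u j 0 - b * u j 1 else u j l)"
  show ?thesis
  proof (intro exI[of _ y] ballI impI)
    fix g assume g: "g \<in> polys_on (cluster_monoms k c)"
      and van: "\<forall>j<n. \<forall>p q. p + q < m \<longrightarrow> taylor (y j 0) (y j 1) p q g = 0"
    have gk: "g \<in> forms (int k)" using g by (auto simp: polys_on_def cluster_monoms_def)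
    define f where "f = shear_form (- b) g"
    have fk: "f \<in> forms (int k)" unfolding f_def by (rule shear_form_in_forms[OF gk])
    have "taylor (u j 0) (u j 1) p q f = 0" if j: "j < n" and pq: "p + q < m" for j p q
    proof (rule taylor_eq_0_if_vanishes[OF fk _ pq])
      fix v w
      have "eval_poly (triple [:u j 0, v:] [:u j 1, w:] 1) f
          = eval_poly (triple [:y j 0, v - b * w:] [:y j 1, w:] 1) g"
      proof (rule poly_eqI')
        fix t
        have 1: "(\<lambda>i. poly (triple p q 1 i) t) = triple (poly p t) (poly q t) 1" for p q :: "complex poly"
          by (rule ext) (simp add: triple_def)
        show "poly (eval_poly (triple [:u j 0, v:] [:u j 1, w:] 1) f) t
          = poly (eval_poly (triple [:y j 0, v - b * w:] [:y j 1, w:] 1) g) t"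
          unfolding poly_eval_poly 1 f_def eval3_shear_form by (simp add: y_def algebra_simps)
      qed
      thus "monom 1 m dvd eval_poly (triple [:u j 0, v:] [:u j 1, w:] 1) f"
        using vanishing_on_affine_lines[OF gk, of m "y j 0" "y j 1"] van j by simp
    qed
    hence fK: "f \<in> ?K" using fk by (simp add: mem_affine_system)
    have "[:-b, 1:] ^ (Suc k - c) dvd top_form f"
    proof -
      have "top_form f = (\<Sum>a\<in>Poly_Mapping.keys g. Polynomial.smult (Poly_Mapping.lookup g a * 0 ^ Poly_Mapping.lookup a 3)
           ([:-b, 1:] ^ Poly_Mapping.lookup a 1))"
        by (rule poly_eqI')
           (simp add: poly_top_form f_def eval3_shear_form, simp add: eval3_def lin_def prod_UNIV_3 poly_sum mult_ac)
      moreover have "[:-b, 1:] ^ (Suc k - c) dvd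
           Polynomial.smult (Poly_Mapping.lookup g a * 0 ^ Poly_Mapping.lookup a 3) ([:-b, 1:] ^ Poly_Mapping.lookup a 1)"
        if a: "a \<in> Poly_Mapping.keys g" for a
      proof (cases "Poly_Mapping.lookup a 3 = 0")
        case True
        have "a \<in> cluster_monoms k c" using a g by (auto simp: polys_on_def)
        hence "Suc k - c \<le> Poly_Mapping.lookup a 1"
          using True by (auto simp: cluster_monoms_def cluster_exponents_def monoms_def mdeg_eq)
        thus ?thesis by (intro dvd_smult le_imp_power_dvd)
      qed (simp add: power_0_left)
      ultimately show ?thesis by (simp add: dvd_sum)
    qed
    hence "f = 0"
      using eq_0_if_dim_0[OF _ d0, of f] fK
      by (auto intro: poly3.fin_dim_subset[OF fin_dim_affine_system[of "int k" m n u]])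
    show "g = 0"
    proof (rule eq_0_if_eval3_0)
      fix x :: "3 \<Rightarrow> complex"
      have "eval3 (triple (x 1) (x 2) (x 3)) g = eval3 (triple (x 1 + b * x 2) (x 2) (x 3)) f"
        by (simp add: f_def eval3_shear_form)
      thus "eval3 x g = 0" using \<open>f = 0\<close> by (simp add: triple_eta)
    qed
  qed
qed

text \<open>The conditions of multiplicity \<open>m\<close> at the points of the template separate the forms on the cluster monomials, so
  their linear combinations include a functional \<open>\<psi> \<alpha>\<close> extracting the coefficient of
  \<open>\<alpha>\<close> from such forms. On other monomials its values are arbitrary.\<close>

lemma exists_dual_functionals:
  fixes y :: configuration
  assumes y: "\<And>g. g \<in> polys_on (cluster_monoms k c) \<Longrightarrow>
    (\<And>j p q. j < n \<Longrightarrow> p + q < m \<Longrightarrow> taylor (y j 0) (y j 1) p q g = 0) \<Longrightarrow> g = 0"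
  obtains \<psi> :: "nat \<times> nat \<Rightarrow> nat \<times> nat \<Rightarrow> complex" where
    "\<And>\<alpha> \<beta>. \<alpha> \<in> cluster_exponents k c \<Longrightarrow> \<beta> \<in> cluster_exponents k c \<Longrightarrow> \<psi> \<alpha> \<beta> = (if \<alpha> = \<beta> then 1 else 0)"
    "\<And>\<alpha> h. \<alpha> \<in> cluster_exponents k c \<Longrightarrow> (\<And>j p q. j < n \<Longrightarrow> p + q < m \<Longrightarrow> taylor (y j 0) (y j 1) p q h = 0) \<Longrightarrow>
       lin (\<lambda>a. \<psi> \<alpha> (Poly_Mapping.lookup a 1, Poly_Mapping.lookup a 2)) h = 0"
proof -
  let ?V = "polys_on (cluster_monoms k c)"
  have fin: "finite (cluster_monoms k c)"
    by (rule finite_subset[OF _ finite_monoms[of "int k"]]) (auto simp: cluster_monoms_def)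
  let ?A = "{(j, p, q). j < n \<and> p + q < m}"
  let ?l = "\<lambda>x. lin ((\<lambda>(j, p, q). taylor_coeff (y j 0) (y j 1) p q) x)"
  have sep: "poly3.common_kernel ?V ?A ?l \<subseteq> {0}"
  proof
    fix g assume g: "g \<in> poly3.common_kernel ?V ?A ?l"
    have "taylor (y j 0) (y j 1) p q g = 0" if "j < n" "p + q < m" for j p q
    proof -
      have "(j, p, q) \<in> ?A" using that by simp
      hence "?l (j, p, q) g = 0" using g unfolding poly3.common_kernel_def by blast
      thus ?thesis by (simp add: taylor_def)
    qed
    thus "g \<in> {0}" using y g by (simp add: poly3.common_kernel_def)
  qed
  define P where "P \<alpha> \<psi> \<longleftrightarrow> (\<forall>\<beta>\<in>cluster_exponents k c. \<psi> \<beta> = (if \<alpha> = \<beta> then 1 else 0)) \<and>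
     (\<forall>h. (\<forall>j p q. j < n \<and> p + q < m \<longrightarrow> taylor (y j 0) (y j 1) p q h = 0) \<longrightarrow>
       lin (\<lambda>a. \<psi> (Poly_Mapping.lookup a 1, Poly_Mapping.lookup a 2)) h = 0)"
    for \<alpha> and \<psi> :: "nat \<times> nat \<Rightarrow> complex"
  have ex: "\<exists>\<psi>. P \<alpha> \<psi>" if \<alpha>: "\<alpha> \<in> cluster_exponents k c" for \<alpha>
  proof -
    let ?m = "\<lambda>\<beta>. mon (fst \<beta>) (snd \<beta>) (k - fst \<beta> - snd \<beta>)"
    let ?\<phi> = "lin (\<lambda>a. if (Poly_Mapping.lookup a 1, Poly_Mapping.lookup a 2) = \<alpha> then 1 else 0)"
    obtain r :: nat and b e where
      b: "\<And>i. i < r \<Longrightarrow> b i \<in> ?A" and e: "\<And>f. f \<in> ?V \<Longrightarrow> ?\<phi> f = (\<Sum>i<r. e i * ?l (b i) f)"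
      by (rule poly3.functional_in_span_of_separating[OF fin_dim_polys_on[OF fin] subspace_polys_on, of ?A ?l,
            OF functional_lin sep functional_lin]) (blast intro: that)
    define \<psi> where "\<psi> \<beta> = (\<Sum>i<r. e i * (\<lambda>(j, p, q). taylor_coeff (y j 0) (y j 1) p q) (b i) (mon (fst \<beta>) (snd \<beta>) 0))"
      for \<beta>
    have tc: "(\<lambda>(j, p, q). taylor_coeff (y j 0) (y j 1) p q) z a =
        (\<lambda>(j, p, q). taylor_coeff (y j 0) (y j 1) p q) z (mon (Poly_Mapping.lookup a 1) (Poly_Mapping.lookup a 2) 0)" for z a
      by (cases z) (simp add: taylor_coeff_def split_def)
    have lin_\<psi>: "lin (\<lambda>a. \<psi> (Poly_Mapping.lookup a 1, Poly_Mapping.lookup a 2)) h = (\<Sum>i<r. e i * ?l (b i) h)" for h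
      unfolding \<psi>_def lin_sum lin_mult fst_conv snd_conv tc[symmetric] ..
    show ?thesis unfolding P_def
    proof (intro exI[of _ \<psi>] conjI ballI allI impI)
      fix \<beta> assume \<beta>: "\<beta> \<in> cluster_exponents k c"
      hence V: "Poly_Mapping.single (?m \<beta>) 1 \<in> ?V"
        by (auto simp: polys_on_def cluster_monoms_def monoms_def mdeg_eq cluster_exponents_def)
      have "\<psi> \<beta> = lin (\<lambda>a. \<psi> (Poly_Mapping.lookup a 1, Poly_Mapping.lookup a 2)) (Poly_Mapping.single (?m \<beta>) 1)"
        by simp
      also have "\<dots> = ?\<phi> (Poly_Mapping.single (?m \<beta>) 1)" unfolding lin_\<psi> e[OF V] ..
      also have "\<dots> = (if \<alpha> = \<beta> then 1 else 0)" by auto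
      finally show "\<psi> \<beta> = (if \<alpha> = \<beta> then 1 else 0)" .
    next
      fix h assume h: "\<forall>j p q. j < n \<and> p + q < m \<longrightarrow> taylor (y j 0) (y j 1) p q h = 0"
      have "?l (b i) h = 0" if "i < r" for i
        using b[OF that] h by (auto simp: taylor_def)
      thus "lin (\<lambda>a. \<psi> (Poly_Mapping.lookup a 1, Poly_Mapping.lookup a 2)) h = 0"
        unfolding lin_\<psi> by simp
    qed
  qed
  hence "\<forall>\<alpha>\<in>cluster_exponents k c. \<exists>\<psi>. P \<alpha> \<psi>" by blast
  from bchoice[OF this] obtain \<psi> where "\<forall>\<alpha>\<in>cluster_exponents k c. P \<alpha> (\<psi> \<alpha>)" by (rule exE)
  hence \<psi>: "P \<alpha> (\<psi> \<alpha>)" if "\<alpha> \<in> cluster_exponents k c" for \<alpha> using that by blast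
  show thesis
  proof (rule that[of \<psi>])
    show "\<psi> \<alpha> \<beta> = (if \<alpha> = \<beta> then 1 else 0)"
      if "\<alpha> \<in> cluster_exponents k c" "\<beta> \<in> cluster_exponents k c" for \<alpha> \<beta>
      using \<psi>[OF that(1)] that(2) unfolding P_def by blast
    show "lin (\<lambda>a. \<psi> \<alpha> (Poly_Mapping.lookup a 1, Poly_Mapping.lookup a 2)) h = 0"
      if "\<alpha> \<in> cluster_exponents k c"
        "\<And>j p q. j < n \<Longrightarrow> p + q < m \<Longrightarrow> taylor (y j 0) (y j 1) p q h = 0" for \<alpha> h
      using \<psi>[OF that(1)] that(2) unfolding P_def by blast
  qed
qed

section \<open>Scaling the template towards the centres\<close>

text \<open>The cluster exponents are an initial segment for the weight given to \<open>\<xi>\<close> and \<open>\<eta>\<close> by the powers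
  \<open>t ^ (k + 2)\<close> and \<open>t ^ (k + 3)\<close>.\<close>

lemma weight_less:
  assumes "\<alpha> \<in> cluster_exponents k c" "\<beta> \<notin> cluster_exponents k c" "c \<le> Suc k"
  shows "(fst \<alpha> + snd \<alpha>) * (k + 2) + snd \<alpha> < (fst \<beta> + snd \<beta>) * (k + 2) + snd \<beta>"
proof (cases "fst \<alpha> + snd \<alpha> < fst \<beta> + snd \<beta>")
  case True
  hence "Suc (fst \<alpha> + snd \<alpha>) * (k + 2) \<le> (fst \<beta> + snd \<beta>) * (k + 2)" by (intro mult_le_mono1) simp
  moreover have "snd \<alpha> < k + 2" using assms(1) by (auto simp: cluster_exponents_def)
  ultimately show ?thesis by simp
next
  case False
  hence "fst \<alpha> + snd \<alpha> = k" "fst \<beta> + snd \<beta> = k" "snd \<alpha> < c" "c \<le> snd \<beta>"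
    using assms(1,2) by (auto simp: cluster_exponents_def split: prod.splits)
  thus ?thesis by simp
qed

text \<open>Place at each centre a copy of the template, scaled by \<open>t ^ (k + 2)\<close> in the direction \<open>\<xi>\<close> and by
  \<open>t ^ (k + 3)\<close> in the direction \<open>\<eta>\<close>. A form \<open>f\<close> with multiplicity \<open>m\<close> at these points is
  killed by \<open>\<psi> \<alpha>\<close> in the rescaled local coordinates, where its coefficients are \<open>t ^ \<omega> \<beta>\<close> times the
  sheared Taylor coefficients of index \<open>\<beta>\<close>. By duality all \<open>\<beta>\<close> other than \<open>\<alpha>\<close> that
  contribute lie outside the cluster exponents and so have larger weight. After division by \<open>t ^ \<omega> \<alpha>\<close> the condition
  is polynomial in \<open>t\<close> and at \<open>t = 0\<close> becomes the limit condition with index \<open>\<alpha>\<close>; semicontinuity then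
  gives some \<open>t \<noteq> 0\<close>.\<close>

lemma collision:
  fixes y :: configuration
  assumes c: "c \<le> Suc k"
    and u: "poly3.dim (cluster_system (int d) k c n1 u) \<le> r"
    and y: "\<And>g. g \<in> polys_on (cluster_monoms k c) \<Longrightarrow>
      (\<And>j p q. j < n2 \<Longrightarrow> p + q < m \<Longrightarrow> taylor (y j 0) (y j 1) p q g = 0) \<Longrightarrow> g = 0"
  shows "\<exists>v. poly3.dim (affine_system (int d) m (n1 * n2) v) \<le> r"
proof -
  let ?\<Delta> = "cluster_exponents k c"
  obtain \<psi> :: "nat \<times> nat \<Rightarrow> nat \<times> nat \<Rightarrow> complex" where
    \<psi>: "\<And>\<alpha> \<beta>. \<alpha> \<in> ?\<Delta> \<Longrightarrow> \<beta> \<in> ?\<Delta> \<Longrightarrow> \<psi> \<alpha> \<beta> = (if \<alpha> = \<beta> then 1 else 0)" and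
    van: "\<And>\<alpha> h. \<alpha> \<in> ?\<Delta> \<Longrightarrow> (\<And>j p q. j < n2 \<Longrightarrow> p + q < m \<Longrightarrow> taylor (y j 0) (y j 1) p q h = 0) \<Longrightarrow>
       lin (\<lambda>a. \<psi> \<alpha> (Poly_Mapping.lookup a 1, Poly_Mapping.lookup a 2)) h = 0"
    by (rule exists_dual_functionals[of k c n2 m y, OF y]) (blast intro: that)+
  define \<omega> where "\<omega> \<beta> = (fst \<beta> + snd \<beta>) * (k + 2) + snd \<beta>" for \<beta> :: "nat \<times> nat"
  have \<omega>: "\<omega> \<alpha> < \<omega> \<beta>" if "\<alpha> \<in> ?\<Delta>" "\<beta> \<notin> ?\<Delta>" for \<alpha> \<beta>
    unfolding \<omega>_def using weight_less[OF that c] .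
  \<comment> \<open>A bound for all exponents that occur, both in forms of degree \<open>d\<close> and among the cluster exponents.\<close>
  define M where "M = d + k"
  let ?S = "\<lambda>i p q. sheared_taylor_coeff (u i 0) (u i 1) (u i 2) p q"
  define \<Phi> where "\<Phi> x t a = (\<Sum>p\<le>M. \<Sum>q\<le>M.
     t ^ (\<omega> (p, q) - \<omega> (snd x)) * \<psi> (snd x) (p, q) * ?S (fst x) p q a)" for x t a
  let ?A = "{..<n1} \<times> ?\<Delta>"
  have \<Phi>0: "\<Phi> x 0 = ?S (fst x) (fst (snd x)) (snd (snd x))" if x: "x \<in> ?A" for x
  proof
    fix a
    obtain i p' q' where x': "x = (i, p', q')" by (cases x)
    have "(p', q') \<in> ?\<Delta>" using x x' by simp
    hence le: "p' \<le> M" "q' \<le> M" by (auto simp: M_def cluster_exponents_def)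
    have "\<Phi> x 0 a = (\<Sum>p\<le>M. \<Sum>q\<le>M. if p = p' \<and> q = q' then ?S i p' q' a else 0)"
      unfolding \<Phi>_def
    proof (intro sum.cong refl)
      fix p q
      show "0 ^ (\<omega> (p, q) - \<omega> (snd x)) * \<psi> (snd x) (p, q) * ?S (fst x) p q a =
        (if p = p' \<and> q = q' then ?S i p' q' a else 0)"
      proof (cases "(p, q) \<in> ?\<Delta>")
        case True
        thus ?thesis using \<psi>[OF \<open>(p', q') \<in> ?\<Delta>\<close> True] by (auto simp: x')
      next
        case False
        hence "(p, q) \<noteq> (p', q')" using \<open>(p', q') \<in> ?\<Delta>\<close> by blast
        thus ?thesis using \<omega>[OF \<open>(p', q') \<in> ?\<Delta>\<close> False] by (auto simp: x' power_0_left)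
      qed
    qed
    also have "\<dots> = (\<Sum>p\<le>M. if p = p' then ?S i p' q' a else 0)"
      using le by (intro sum.cong refl) auto
    also have "\<dots> = ?S i p' q' a" using le by simp
    finally show "\<Phi> x 0 a = ?S (fst x) (fst (snd x)) (snd (snd x)) a" by (simp add: x')
  qed
  have "poly3.common_kernel (forms (int d)) ?A (\<lambda>x. lin (\<Phi> x 0)) = cluster_system (int d) k c n1 u"
  proof -
    have "{(i, p, q). i < n1 \<and> (p, q) \<in> ?\<Delta>} = ?A" by auto
    thus ?thesis
      unfolding cluster_system_def poly3.common_kernel_def
      by (intro Collect_cong conj_cong refl ball_cong) (simp_all only: \<Phi>0 case_prod_beta)
  qed
  hence "poly3.dim (poly3.common_kernel (forms (int d)) ?A (\<lambda>x. lin (\<Phi> x 0))) \<le> r" using u by simp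
  hence "finite {t. \<not> poly3.dim (poly3.common_kernel (forms (int d)) ?A (\<lambda>x. lin (\<Phi> x t))) \<le> r}"
  proof (rule open_kernel_dim[OF finite_monoms, rotated])
    fix x a
    show "\<exists>P. \<forall>t. \<Phi> x t a = poly P t"
      by (rule exI[of _ "\<Sum>p\<le>M. \<Sum>q\<le>M. monom (\<psi> (snd x) (p, q) * ?S (fst x) p q a) (\<omega> (p, q) - \<omega> (snd x))"])
         (simp add: \<Phi>_def poly_sum poly_monom mult_ac)
  qed
  hence "finite (insert 0 {t. \<not> poly3.dim (poly3.common_kernel (forms (int d)) ?A (\<lambda>x. lin (\<Phi> x t))) \<le> r})"
    by simp
  then obtain t where "t \<notin> insert 0 {t. \<not> poly3.dim (poly3.common_kernel (forms (int d)) ?A (\<lambda>x. lin (\<Phi> x t))) \<le> r}"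
    using ex_new_if_finite[OF infinite_UNIV_char_0] by blast
  hence t: "t \<noteq> 0" "poly3.dim (poly3.common_kernel (forms (int d)) ?A (\<lambda>x. lin (\<Phi> x t))) \<le> r" by auto
  let ?\<xi> = "\<lambda>X. t ^ (k + 2) * X" and ?\<eta> = "\<lambda>Y. t ^ (k + 3) * Y"
  define v where "v = (\<lambda>s (l::nat).
     let i = s div n2; \<xi> = ?\<xi> (y (s mod n2) 0); \<eta> = ?\<eta> (y (s mod n2) 1) in
     if l = 0 then u i 0 + \<xi> else u i 1 + u i 2 * \<xi> + \<eta>)"
  have "affine_system (int d) m (n1 * n2) v \<subseteq> poly3.common_kernel (forms (int d)) ?A (\<lambda>x. lin (\<Phi> x t))"
  proof
    fix f assume f: "f \<in> affine_system (int d) m (n1 * n2) v"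
    hence fd: "f \<in> forms (int d)" by (simp add: mem_affine_system)
    have "lin (\<Phi> x t) f = 0" if x: "x \<in> ?A" for x
    proof -
      obtain i \<alpha> where x': "x = (i, \<alpha>)" by (cases x)
      have i: "i < n1" and \<alpha>: "\<alpha> \<in> ?\<Delta>" using x x' by auto
      let ?T = "\<lambda>p q. sheared_taylor (u i 0) (u i 1) (u i 2) p q f"
      \<comment> \<open>The restriction of \<open>f\<close> to the rescaled local coordinates, homogenised to degree \<open>2 * M\<close>.\<close>
      define H where "H = (\<Sum>p\<le>M. \<Sum>q\<le>M. Poly_Mapping.single (mon p q (2 * M - p - q)) (t ^ \<omega> (p, q) * ?T p q))"
      have Hf: "H \<in> forms (int (2 * M))"
        unfolding H_def by (intro polys_on_sum) (auto simp: polys_on_def monoms_def mdeg_eq)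
      have evH: "eval3 (triple X Y 1) H = eval3 (triple (u i 0 + ?\<xi> X) (u i 1 + u i 2 * ?\<xi> X + ?\<eta> Y) 1) f" for X Y
      proof -
        have "?\<xi> X ^ p * ?\<eta> Y ^ q = t ^ \<omega> (p, q) * (X ^ p * Y ^ q)" for p q
        proof -
          have "?\<xi> X ^ p * ?\<eta> Y ^ q = t ^ ((k + 2) * p) * X ^ p * (t ^ ((k + 3) * q) * Y ^ q)"
            by (simp only: power_mult_distrib power_mult)
          also have "\<dots> = t ^ ((k + 2) * p + (k + 3) * q) * (X ^ p * Y ^ q)"
            by (simp only: power_add mult_ac)
          also have "(k + 2) * p + (k + 3) * q = \<omega> (p, q)" by (simp add: \<omega>_def algebra_simps)
          finally show ?thesis .
        qed
        thus ?thesis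
          by (subst sheared_taylor_formula[OF fd, of M])
             (simp_all add: M_def H_def eval3_sum eval3_single prod_UNIV_3 mult_ac)
      qed
      have "taylor (y j 0) (y j 1) p q H = 0" if j: "j < n2" and pq: "p + q < m" for j p q
      proof (rule taylor_eq_0_if_vanishes[OF Hf _ pq])
        fix a b
        let ?s = "i * n2 + j"
        have s: "?s < n1 * n2"
        proof -
          have "?s < Suc i * n2" using j by simp
          also have "\<dots> \<le> n1 * n2" using i by (intro mult_le_mono1) simp
          finally show ?thesis .
        qed
        have "v ?s 0 = u i 0 + ?\<xi> (y j 0)" "v ?s 1 = u i 1 + u i 2 * ?\<xi> (y j 0) + ?\<eta> (y j 1)"
          using j by (simp_all add: v_def)
        hence "eval_poly (triple [:y j 0, a:] [:y j 1, b:] 1) H =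
            eval_poly (triple [:v ?s 0, ?\<xi> a:] [:v ?s 1, u i 2 * ?\<xi> a + ?\<eta> b:] 1) f"
        proof (intro poly_eqI')
          fix z
          have 1: "(\<lambda>i. poly (triple p q 1 i) z) = triple (poly p z) (poly q z) 1" for p q :: "complex poly"
            by (rule ext) (simp add: triple_def)
          assume v: "v ?s 0 = u i 0 + ?\<xi> (y j 0)" "v ?s 1 = u i 1 + u i 2 * ?\<xi> (y j 0) + ?\<eta> (y j 1)"
          show "poly (eval_poly (triple [:y j 0, a:] [:y j 1, b:] 1) H) z =
            poly (eval_poly (triple [:v ?s 0, ?\<xi> a:] [:v ?s 1, u i 2 * ?\<xi> a + ?\<eta> b:] 1) f) z"
            unfolding poly_eval_poly 1 evH v by (simp add: algebra_simps)
        qed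
        moreover have "monom 1 m dvd eval_poly (triple [:v ?s 0, ?\<xi> a:] [:v ?s 1, u i 2 * ?\<xi> a + ?\<eta> b:] 1) f"
          by (rule vanishing_on_affine_lines[OF fd]) (use f s in \<open>auto simp: mem_affine_system\<close>)
        ultimately show "monom 1 m dvd eval_poly (triple [:y j 0, a:] [:y j 1, b:] 1) H" by simp
      qed
      from van[OF \<alpha> this] have "0 = lin (\<lambda>a. \<psi> \<alpha> (Poly_Mapping.lookup a 1, Poly_Mapping.lookup a 2)) H" by simp
      also have "\<dots> = (\<Sum>p\<le>M. \<Sum>q\<le>M. t ^ \<omega> (p, q) * ?T p q * \<psi> \<alpha> (p, q))"
        unfolding H_def poly3.functional_sum[OF functional_lin] by simp
      also have "\<dots> = t ^ \<omega> \<alpha> * (\<Sum>p\<le>M. \<Sum>q\<le>M. t ^ (\<omega> (p, q) - \<omega> \<alpha>) * \<psi> \<alpha> (p, q) * ?T p q)"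
        unfolding sum_distrib_left
      proof (intro sum.cong refl)
        fix p q
        show "t ^ \<omega> (p, q) * ?T p q * \<psi> \<alpha> (p, q) = t ^ \<omega> \<alpha> * (t ^ (\<omega> (p, q) - \<omega> \<alpha>) * \<psi> \<alpha> (p, q) * ?T p q)"
        proof (cases "\<omega> \<alpha> \<le> \<omega> (p, q)")
          case True
          hence "t ^ \<omega> (p, q) = t ^ \<omega> \<alpha> * t ^ (\<omega> (p, q) - \<omega> \<alpha>)" by (simp flip: power_add)
          thus ?thesis by simp
        next
          case False
          hence "(p, q) \<in> ?\<Delta>" using \<omega>[OF \<alpha>, of "(p, q)"] by fastforce
          moreover have "\<alpha> \<noteq> (p, q)" using False by auto
          ultimately have "\<psi> \<alpha> (p, q) = 0" using \<psi>[OF \<alpha>] by simp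
          thus ?thesis by simp
        qed
      qed
      also have "(\<Sum>p\<le>M. \<Sum>q\<le>M. t ^ (\<omega> (p, q) - \<omega> \<alpha>) * \<psi> \<alpha> (p, q) * ?T p q) = lin (\<Phi> x t) f"
        unfolding \<Phi>_def[abs_def] lin_sum lin_mult sheared_taylor_def x' by simp
      finally show ?thesis using t(1) by simp
    qed
    thus "f \<in> poly3.common_kernel (forms (int d)) ?A (\<lambda>x. lin (\<Phi> x t))"
      using fd by (simp add: poly3.common_kernel_def)
  qed
  hence "poly3.dim (affine_system (int d) m (n1 * n2) v)
      \<le> poly3.dim (poly3.common_kernel (forms (int d)) ?A (\<lambda>x. lin (\<Phi> x t)))"
    by (intro poly3.dim_mono_fin poly3.fin_dim_subset[OF fin_dim_polys_on[OF finite_monoms[of "int d"]]])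
       (auto simp: poly3.common_kernel_def)
  thus ?thesis using t(2) by (meson le_trans)
qed

lemma bounds_on_k:
  fixes k :: int and N :: nat
  assumes "1 / 2 * (- 3 + sqrt (1 + 4 * real N)) \<le> real_of_int k"
    and "real_of_int k \<le> 1 / 2 * (- 1 + sqrt (1 + 4 * real N))" and "N \<ge> 2"
  shows "0 \<le> k" "k * (k + 1) \<le> int N" "int N \<le> (k + 1) * (k + 2)"
proof -
  define s where "s = sqrt (1 + 4 * real N)"
  have s2: "s\<^sup>2 = 1 + 4 * real N" by (simp add: s_def)
  have "sqrt 9 \<le> s" unfolding s_def using assms(3) by (intro real_sqrt_le_mono) simp
  moreover have "sqrt 9 = (3::real)" by (rule real_sqrt_unique) auto
  ultimately have s3: "3 \<le> s" by simp
  have lo: "s \<le> 2 * real_of_int k + 3" and hi: "2 * real_of_int k + 1 \<le> s"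
    using assms(1,2) by (simp_all add: s_def)
  from lo s3 have "0 \<le> real_of_int k" by simp
  thus k0: "0 \<le> k" by simp
  have "(2 * real_of_int k + 1)\<^sup>2 \<le> s\<^sup>2" using hi k0 by (intro power_mono) auto
  hence "real_of_int (k * (k + 1)) \<le> real_of_int (int N)"
    unfolding s2 by (simp add: power2_eq_square algebra_simps)
  thus "k * (k + 1) \<le> int N" by (simp only: of_int_le_iff)
  have "s\<^sup>2 \<le> (2 * real_of_int k + 3)\<^sup>2" using lo s3 by (intro power_mono) auto
  hence "real_of_int (int N) \<le> real_of_int ((k + 1) * (k + 2))"
    unfolding s2 by (simp add: power2_eq_square algebra_simps)
  thus "int N \<le> (k + 1) * (k + 2)" by (simp only: of_int_le_iff)
qed

theorem theorem2:
  fixes d m k :: int and n1 n2 :: nat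
  assumes "d \<ge> 0" and "m \<ge> 1" and "n1 \<ge> 1" and "n2 \<ge> 1"
    and "1 / 2 * (- 3 + sqrt (1 + 4 * real n2 * real_of_int m * (real_of_int m + 1)))
           \<le> real_of_int k"
    and "real_of_int k
           \<le> 1 / 2 * (- 1 + sqrt (1 + 4 * real n2 * real_of_int m * (real_of_int m + 1)))"
    and "non_special d (k + 1) n1"
    and "non_special d k n1"
    and "non_special (k - 1) m n2"
    and "non_special k m n2"
  shows "non_special d m (n1 * n2)"
proof -
  define d' m' k' where "d' = nat d" "m' = nat m" "k' = nat k"
  have d: "d = int d'" and m: "m = int m'" and m1: "m' \<ge> 1" using assms(1,2) by (simp_all add: d'_m'_k'_def)
  define N where "N = n2 * (m' * (m' + 1))"
  have "1 * (1 * 2) \<le> N" unfolding N_def using assms(4) m1 by (intro mult_le_mono) auto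
  hence N2: "2 \<le> N" by simp
  have "1 + 4 * real n2 * real_of_int m * (real_of_int m + 1) = 1 + 4 * real N"
    by (simp add: N_def m algebra_simps)
  note kb = bounds_on_k[OF assms(5,6)[unfolded this] N2]
  have k: "k = int k'" using kb(1) by (simp add: d'_m'_k'_def)
  have "int (k' * (k' + 1)) \<le> int N" "int N \<le> int (Suc k' * (Suc k' + 1))"
    using kb(2,3) unfolding k by (simp_all add: algebra_simps)
  hence "k' * (k' + 1) \<le> N" "N \<le> Suc k' * (Suc k' + 1)" by (simp_all only: of_nat_le_iff)
  moreover have "N = 2 * (n2 * tri m')" unfolding N_def using two_tri[of m'] by simp
  ultimately have bounds: "tri k' \<le> n2 * tri m'" "n2 * tri m' \<le> tri (Suc k')"
    using two_tri[of k'] two_tri[of "Suc k'"] by simp_all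
  define c where "c = n2 * tri m' - tri k'"
  have c: "n2 * tri m' = tri k' + c" "c \<le> Suc k'" using bounds by (simp_all add: c_def tri_Suc)
  have Suc_k: "k + 1 = int (Suc k')" by (simp add: k)
  obtain w1 where w1: "poly3.dim (affine_system d k' n1 w1) \<le> tri (nat (d + 1)) - n1 * tri k'"
    using assms(8) non_special_iff_affine_system[of d k' n1] assms(1) unfolding k by auto
  obtain w2 where w2: "poly3.dim (affine_system d (Suc k') n1 w2) \<le> tri (nat (d + 1)) - n1 * tri (Suc k')"
    using assms(7) non_special_iff_affine_system[of d "Suc k'" n1] assms(1) unfolding Suc_k by auto
  obtain w3 where w3: "poly3.dim (affine_system (k - 1) m' n2 w3) \<le> tri (nat (k - 1 + 1)) - n2 * tri m'"
    using assms(9) non_special_iff_affine_system[of "k - 1" m' n2] kb(1) unfolding m by auto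
  obtain w4 where w4: "poly3.dim (affine_system k m' n2 w4) \<le> tri (nat (k + 1)) - n2 * tri m'"
    using assms(10) non_special_iff_affine_system[of k m' n2] kb(1) unfolding m by auto
  have "poly3.dim (affine_system (int k' - 1) m' n2 w3) = 0"
    using w3 bounds by (simp add: k)
  moreover have "poly3.dim (affine_system (int k') m' n2 w4) \<le> Suc k' - c"
  proof -
    have "nat (k + 1) = Suc k'" by (simp add: k)
    hence "tri (nat (k + 1)) - n2 * tri m' = Suc k' - c" using c by (simp add: tri_Suc)
    thus ?thesis using w4 by (simp add: k)
  qed
  ultimately obtain y :: configuration where y: "\<forall>g\<in>polys_on (cluster_monoms k' c).
    (\<forall>j<n2. \<forall>p q. p + q < m' \<longrightarrow> taylor (y j 0) (y j 1) p q g = 0) \<longrightarrow> g = 0"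
    using exists_template[OF c] by blast
  obtain u where "poly3.dim (cluster_system d k' c n1 u) \<le> tri (nat (d + 1)) - n1 * (tri k' + c)"
    using cluster_system_expected_dim[OF c(2) w1 w2] by blast
  hence "\<exists>v. poly3.dim (affine_system d m' (n1 * n2) v) \<le> tri (nat (d + 1)) - n1 * (tri k' + c)"
    unfolding d by (rule collision[OF c(2), where y = y]) (use y in blast)
  thus ?thesis
    using non_special_iff_affine_system[of d m' "n1 * n2"] assms(1) c(1)
    by (simp add: m mult.assoc)
qed

end
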